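(* Let $\Xi_1^1$ be the set of all $Z=(X,Y)\in\Omega$ such that $X_i(\mathbf 0)Y_i(\mathbf 0)<0$ for $i=1,2$, $\det Z(\mathbf 0)=0$, and $\dfrac{\partial}{\partial x_i}\det Z(\mathbf 0)\neq0$ for $i=1,2$, where $\det Z=X_1Y_2-X_2Y_1$. Let $Z\in\Xi_1^1$. Then any one-parameter unfolding of $Z$ transverse to $\Xi_1^1$ at $Z$ is locally weak equivalent to the one-parameter family $$\tilde Z_\alpha(x_1,x_2)=\begin{cases}\tilde X_\alpha(x_1,x_2)=\begin{pmatrix}a-b\,c_2\,x_1\\ b+a\,\alpha\end{pmatrix}, & x_1x_2>0,\\[8pt] \tilde Y(x_1,x_2)=\begin{pmatrix}-a\\ -b+a\,c_1\,x_2\end{pmatrix}, & x_1x_2<0,\end{cases}$$ where $a=\operatorname{sgn}X_1(\mathbf 0)$, $b=\operatorname{sgn}X_2(\mathbf 0)$, $c_i=\operatorname{sgn}\dfrac{\partial}{\partial x_j}\det Z(\mathbf 0)$ with $i,j\in\{1,2\}$, $i\neq j$.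
   Context: Setting. Fix $r\ge 1$ and a bounded open neighborhood $\mathcal U$ of the origin $\mathbf 0$ in $\mathbb R^2$. Let $\Sigma=\{(x_1,x_2)\in\mathcal U: x_1x_2=0\}$, $\mathcal U^+=\{x_1x_2>0\}$, $\mathcal U^-=\{x_1x_2<0\}$. Write $\Sigma=\Sigma_1\cup\Sigma_2$ with $\Sigma_1=\{x_1=0\}$, $\Sigma_2=\{x_2=0\}$; $\Sigma_1^{\pm}=\{(0,x_2):\pm x_2>0\}$ and $\Sigma_2^{\pm}=\{(x_1,0):\pm x_1>0\}$. $\Omega$ is the set of piecewise smooth vector fields $Z=(X,Y)$, where $X=(X_1,X_2)$, $Y=(Y_1,Y_2)$ are $C^r$ vector fields on $\overline{\mathcal U}$, with $Z=X$ on $\mathcal U^+$ and $Z=Y$ on $\mathcal U^-$; $\Omega=\mathfrak X\times\mathfrak X$ has the product $C^r$ topology and is a Banach space. The set $\Xi_1^1$ is an embedded codimension one submanifold of $\Omega$. Regions of $\Sigma$. For $i=1,2$: crossing region $\Sigma_i^c=\{p\in\Sigma_i: X_iY_i(p)>0\}$; sliding region $\Sigma_i^s=\{p\in\Sigma_i^+:X_i(p)<0,Y_i(p)>0\}\cup\{p\in\Sigma_i^-:X_i(p)>0,Y_i(p)<0\}$; escaping region $\Sigma_i^e=\{p\in\Sigma_i^+:X_i(p)>0,Y_i(p)<0\}\cup\{p\in\Sigma_i^-:X_i(p)<0,Y_i(p)>0\}$. $\Sigma^{c},\Sigma^s,\Sigma^e$ are the unions over $i=1,2$. On $\Sigma_i^{s}\cup\Sigma_i^e$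 the sliding vector field is the one-dimensional vector field $Z_i^s=\dfrac{Y_iX_j-X_iY_j}{Y_i-X_i}\Big|_{\Sigma_i}$, $j\neq i$. Trajectories of $Z$. For $p\neq\mathbf 0$: if $p\in\mathcal U^{+}$ (resp. $\mathcal U^-$) follow the trajectory of $X$ (resp. $Y$), where trajectories meeting $\Sigma^s\cup\Sigma^e$ transversally are regarded as relatively open (they do not reach $\Sigma^s\cup\Sigma^e$ in finite time); if $p\in\Sigma^c$ concatenate the trajectories of $X$ and $Y$ through $p$; if $p\in\Sigma_i^s\cup\Sigma_i^e$ follow the trajectory of $Z_i^s$; if $p\in\partial\Sigma_i^e\cup\partial\Sigma_i^s\cup\partial\Sigma_i^c$ and the one-sided limits $\lim_{q\to p^\pm}\varphi_Z(t;q)$ along $\Sigma_i$ coincide, the trajectory is this limit; for other such boundary points it is $\{p\}$. For $\mathbf 0$: if $\Sigma=\overline{\Sigma^c}$, it is the unique trajectory of $X$ or $Y$ that crosses the origin; if $\mathbf 0\in\overline{\Sigma_i^e\cup\Sigma_i^s}\cap\overline{\Sigma_j^c}$, $i\ne j$, it is the trajectory of $Z_i^s$; if $\mathbf 0\in\bigcap_{i=1,2}\overline{\Sigma_i^e\cup\Sigma_i^s}$, it is $\{\mathbf 0\}$. Equivalence and unfoldings. $Z,\tilde Z\in\Omega$ are locally $\Sigma$-equivalent if there are neighborhoods $\mathcal U_0,\tilde{\mathcal U}_0$ of the origin and an orientation preserving homeomorphism $h:\mathcal U_0\to\tilde{\mathcal U}_0$ mapping trajectories of $Z$ to trajectories of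 $\tilde Z$ and $\Sigma$ to $\Sigma$. A one-parameter unfolding of $Z$ is a smooth map $\gamma:\delta\in(-\delta_0,\delta_0)\mapsto Z_\delta\in\Omega$ with $\gamma(0)=Z$; it is transverse to a codimension one submanifold $M\ni Z$ at $Z$ if $\gamma'(0)\notin T_ZM$. Two one-parameter families $Z_\delta,\tilde Z_{\tilde\delta}$ are locally weak equivalent if there is a homeomorphic change of parameters $\mu$ near $0$ (with $\mu(0)=0$) such that for each $\delta$ the fields $Z_\delta$ and $\tilde Z_{\mu(\delta)}$ are locally $\Sigma$-equivalent. *)

theory Defs
  imports "HOL-Complex_Analysis.Complex_Analysis"
begin

type_synonym plane = "real ^ 2"
type_synonym vfield = "plane \<Rightarrow> plane"

text \<open>A piecewise smooth field is the pair (X, Y), with X used where x_1 x_2 > 0 and Y where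
  x_1 x_2 < 0.\<close>

type_synonym pwfield = "vfield \<times> vfield"

definition other :: "2 \<Rightarrow> 2" where
  "other i = (if i = 1 then 2 else 1)"

definition pd :: "2 \<Rightarrow> (plane \<Rightarrow> 'b::real_normed_vector) \<Rightarrow> plane \<Rightarrow> 'b" where
  "pd i f x = frechet_derivative f (at x) (axis i 1)"

fun pds :: "2 list \<Rightarrow> (plane \<Rightarrow> 'b::real_normed_vector) \<Rightarrow> plane \<Rightarrow> 'b" where
  "pds [] f = f"
| "pds (i # is) f = pd i (pds is f)"

text \<open>Being of class C^r on the closure of the open set U means, as usual, being of class C^r on U
  with all partial derivatives of order at most r extending continuously to the closure. Fields are
  normalised to be 0 off the closure, so that equality of elements is equality of functions and
  the C^r norm below is a norm, for which the space is complete when U is bounded.\<close>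

definition Cr :: "nat \<Rightarrow> plane set \<Rightarrow> vfield set" where
  "Cr r U = {f. (\<forall>x. x \<notin> closure U \<longrightarrow> f x = 0) \<and> continuous_on (closure U) f \<and>
     (\<forall>is. length is < r \<longrightarrow> (\<forall>x\<in>U. pds is f differentiable (at x))) \<and>
     (\<forall>is. length is \<le> r \<longrightarrow>
        (\<exists>g. continuous_on (closure U) g \<and> (\<forall>x\<in>U. g x = pds is f x)))}"

definition Cr_norm :: "nat \<Rightarrow> plane set \<Rightarrow> vfield \<Rightarrow> real" where
  "Cr_norm r U f = (SUP (is, x) \<in> {is. length is \<le> r} \<times> U. norm (pds is f x))"

definition Omega :: "nat \<Rightarrow> plane set \<Rightarrow> pwfield set" where
  "Omega r U = Cr r U \<times> Cr r U"

definition has_Cr_derivative ::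
    "nat \<Rightarrow> plane set \<Rightarrow> (real \<Rightarrow> vfield) \<Rightarrow> vfield \<Rightarrow> real \<Rightarrow> bool" where
  "has_Cr_derivative r U g D t \<longleftrightarrow>
     ((\<lambda>h. Cr_norm r U (\<lambda>x. (g (t + h) x - g t x) /\<^sub>R h - D x)) \<longlongrightarrow> 0) (at 0)"

text \<open>The topology on pairs is the product topology, so differentiation is componentwise.\<close>

definition has_Omega_derivative ::
    "nat \<Rightarrow> plane set \<Rightarrow> (real \<Rightarrow> pwfield) \<Rightarrow> pwfield \<Rightarrow> real \<Rightarrow> bool" where
  "has_Omega_derivative r U \<gamma> V t \<longleftrightarrow>
     has_Cr_derivative r U (\<lambda>s. fst (\<gamma> s)) (fst V) t \<and>
     has_Cr_derivative r U (\<lambda>s. snd (\<gamma> s)) (snd V) t"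

text \<open>A smooth map from the open interval I to the Banach space: D k is the k-th derivative.\<close>

definition smooth_curve :: "nat \<Rightarrow> plane set \<Rightarrow> real set \<Rightarrow> (real \<Rightarrow> pwfield) \<Rightarrow> bool" where
  "smooth_curve r U I \<gamma> \<longleftrightarrow>
     (\<exists>D :: nat \<Rightarrow> real \<Rightarrow> pwfield. (\<forall>t\<in>I. D 0 t = \<gamma> t) \<and>
        (\<forall>k. \<forall>t\<in>I. D k t \<in> Omega r U \<and> has_Omega_derivative r U (D k) (D (Suc k) t) t))"

text \<open>The tangent space at Z of a submanifold M, as the set of velocities of smooth curves in M.\<close>

definition tangent_space :: "nat \<Rightarrow> plane set \<Rightarrow> pwfield set \<Rightarrow> pwfield \<Rightarrow> pwfield set" where
  "tangent_space r U M Z = {V \<in> Omega r U. \<exists>e>0. \<exists>\<sigma>. smooth_curve r U {-e<..<e} \<sigma> \<and>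
     (\<forall>t\<in>{-e<..<e}. \<sigma> t \<in> M) \<and> \<sigma> 0 = Z \<and> has_Omega_derivative r U \<sigma> V 0}"

definition unfolding_of ::
    "nat \<Rightarrow> plane set \<Rightarrow> pwfield \<Rightarrow> real \<Rightarrow> (real \<Rightarrow> pwfield) \<Rightarrow> bool" where
  "unfolding_of r U Z \<delta>\<^sub>0 \<gamma> \<longleftrightarrow>
     0 < \<delta>\<^sub>0 \<and> smooth_curve r U {-\<delta>\<^sub>0<..<\<delta>\<^sub>0} \<gamma> \<and> \<gamma> 0 = Z"

definition transverse_at ::
    "nat \<Rightarrow> plane set \<Rightarrow> (real \<Rightarrow> pwfield) \<Rightarrow> pwfield set \<Rightarrow> pwfield \<Rightarrow> bool" where
  "transverse_at r U \<gamma> M Z \<longleftrightarrow>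
     (\<exists>V \<in> Omega r U. has_Omega_derivative r U \<gamma> V 0 \<and> V \<notin> tangent_space r U M Z)"

text \<open>The regions and the trajectories are defined for the restriction of a field to an open
  neighbourhood W of the origin; W is the domain U or the domain of a local equivalence.\<close>

definition pos_part :: "plane set \<Rightarrow> plane set" where
  "pos_part W = {x \<in> W. x $ 1 * x $ 2 > 0}"

definition neg_part :: "plane set \<Rightarrow> plane set" where
  "neg_part W = {x \<in> W. x $ 1 * x $ 2 < 0}"

definition Sigma_set :: "plane set \<Rightarrow> plane set" where
  "Sigma_set W = {x \<in> W. x $ 1 * x $ 2 = 0}"

definition Sigma_comp :: "plane set \<Rightarrow> 2 \<Rightarrow> plane set" where
  "Sigma_comp W i = {x \<in> W. x $ i = 0}"

definition Sigma_plus :: "plane set \<Rightarrow> 2 \<Rightarrow> plane set" where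
  "Sigma_plus W i = {x \<in> Sigma_comp W i. x $ other i > 0}"

definition Sigma_minus :: "plane set \<Rightarrow> 2 \<Rightarrow> plane set" where
  "Sigma_minus W i = {x \<in> Sigma_comp W i. x $ other i < 0}"

definition crossing :: "plane set \<Rightarrow> pwfield \<Rightarrow> 2 \<Rightarrow> plane set" where
  "crossing W Z i = {p \<in> Sigma_comp W i. fst Z p $ i * snd Z p $ i > 0}"

definition sliding :: "plane set \<Rightarrow> pwfield \<Rightarrow> 2 \<Rightarrow> plane set" where
  "sliding W Z i =
     {p \<in> Sigma_plus W i. fst Z p $ i < 0 \<and> snd Z p $ i > 0} \<union>
     {p \<in> Sigma_minus W i. fst Z p $ i > 0 \<and> snd Z p $ i < 0}"

definition escaping :: "plane set \<Rightarrow> pwfield \<Rightarrow> 2 \<Rightarrow> plane set" where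
  "escaping W Z i =
     {p \<in> Sigma_plus W i. fst Z p $ i > 0 \<and> snd Z p $ i < 0} \<union>
     {p \<in> Sigma_minus W i. fst Z p $ i < 0 \<and> snd Z p $ i > 0}"

text \<open>The one-dimensional sliding field on the i-th axis set, as a planar field tangent to it.\<close>

definition sliding_field :: "pwfield \<Rightarrow> 2 \<Rightarrow> vfield" where
  "sliding_field Z i p =
     (let X = fst Z p; Y = snd Z p; j = other i
      in axis j ((Y $ i * X $ j - X $ i * Y $ j) / (Y $ i - X $ i)))"

definition solves_at :: "vfield \<Rightarrow> (real \<Rightarrow> plane) \<Rightarrow> real \<Rightarrow> bool" where
  "solves_at F c t \<longleftrightarrow> (c has_vector_derivative F (c t)) (at t)"

text \<open>The predicates in this block say that the germ at time 0 of the curve c is the germ of the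
  trajectory through c 0. A curve is then a trajectory if it has the prescribed germ at each of its
  times; in particular a trajectory of X or Y arriving at a sliding or escaping point does not
  contain that point, because the trajectory through that point is the one of the sliding field.\<close>

definition regular_germ :: "plane set \<Rightarrow> pwfield \<Rightarrow> (real \<Rightarrow> plane) \<Rightarrow> bool" where
  "regular_germ W Z c \<longleftrightarrow>
     (\<forall>\<^sub>F s in nhds 0. c s \<in> pos_part W \<and> solves_at (fst Z) c s) \<or>
     (\<forall>\<^sub>F s in nhds 0. c s \<in> neg_part W \<and> solves_at (snd Z) c s) \<or>
     (\<exists>i. c 0 \<in> crossing W Z i - {0} \<and> isCont c 0 \<and>
        ((\<forall>\<^sub>F s in at_left 0. c s \<in> pos_part W \<and> solves_at (fst Z) c s) \<and>
         (\<forall>\<^sub>F s in at_right 0. c s \<in> neg_part W \<and> solves_at (snd Z) c s) \<or>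
         (\<forall>\<^sub>F s in at_left 0. c s \<in> neg_part W \<and> solves_at (snd Z) c s) \<and>
         (\<forall>\<^sub>F s in at_right 0. c s \<in> pos_part W \<and> solves_at (fst Z) c s))) \<or>
     (\<exists>i. \<forall>\<^sub>F s in nhds 0. c s \<in> sliding W Z i \<union> escaping W Z i \<and>
        solves_at (sliding_field Z i) c s)"

text \<open>Boundary points p = c 0 other than the origin: c is the limit of the trajectories of q as q
  tends to p along the axis; the two one-sided limits exist and coincide iff this two-sided limit
  exists. The trajectory \<phi> q of q may itself reach p (sliding motion through p), where it has to
  continue along c.\<close>

definition boundary_germ :: "plane set \<Rightarrow> pwfield \<Rightarrow> (real \<Rightarrow> plane) \<Rightarrow> bool" where
  "boundary_germ W Z c \<longleftrightarrow>
     (\<exists>i. c 0 \<noteq> 0 \<and>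
        c 0 \<in> top_of_set (Sigma_comp W i) frontier_of crossing W Z i \<union>
              top_of_set (Sigma_comp W i) frontier_of sliding W Z i \<union>
              top_of_set (Sigma_comp W i) frontier_of escaping W Z i \<and>
        (\<exists>e>0. \<exists>\<phi>.
           (\<forall>\<^sub>F q in at (c 0) within Sigma_comp W i.
              \<phi> q 0 = q \<and>
              (\<forall>t\<in>{-e<..<e}. regular_germ W Z (\<lambda>s. \<phi> q (t + s)) \<or>
                 \<phi> q t = c 0 \<and> (\<forall>\<^sub>F s in nhds 0. \<phi> q (t + s) = c s))) \<and>
           (\<forall>t\<in>{-e<..<e}. ((\<lambda>q. \<phi> q t) \<longlongrightarrow> c t) (at (c 0) within Sigma_comp W i))))"

text \<open>The origin. If it lies in the closure of the sliding or escaping regions of both axes, its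
  trajectory is constant, and this takes precedence over the rule for a single axis. When all of
  the switching set is crossing, the trajectory is the one of X or Y through the origin that runs in
  the quadrants where that field is active.\<close>

definition origin_germ :: "plane set \<Rightarrow> pwfield \<Rightarrow> (real \<Rightarrow> plane) \<Rightarrow> bool" where
  "origin_germ W Z c \<longleftrightarrow> c 0 = 0 \<and>
     (let S = (\<lambda>i. closure (escaping W Z i \<union> sliding W Z i)) in
      (\<forall>i. 0 \<in> S i) \<and> (\<forall>\<^sub>F s in nhds 0. c s = 0) \<or>
      \<not> (\<forall>i. 0 \<in> S i) \<and>
        (\<exists>i. 0 \<in> S i \<inter> closure (crossing W Z (other i)) \<and>
           (\<forall>\<^sub>F s in nhds 0. c s \<in> insert 0 (sliding W Z i \<union> escaping W Z i) \<and>
              solves_at (sliding_field Z i) c s)) \<or>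
      Sigma_set W \<subseteq> closure (\<Union>i. crossing W Z i) \<and>
        ((\<forall>\<^sub>F s in at 0. c s \<in> pos_part W) \<and> (\<forall>\<^sub>F s in nhds 0. solves_at (fst Z) c s) \<or>
         (\<forall>\<^sub>F s in at 0. c s \<in> neg_part W) \<and> (\<forall>\<^sub>F s in nhds 0. solves_at (snd Z) c s)))"

definition assigned_germ :: "plane set \<Rightarrow> pwfield \<Rightarrow> (real \<Rightarrow> plane) \<Rightarrow> bool" where
  "assigned_germ W Z c \<longleftrightarrow> regular_germ W Z c \<or> boundary_germ W Z c \<or> origin_germ W Z c"

text \<open>A point to which none of the rules above assigns a trajectory is a trajectory by itself.\<close>

definition trajectory_germ :: "plane set \<Rightarrow> pwfield \<Rightarrow> (real \<Rightarrow> plane) \<Rightarrow> bool" where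
  "trajectory_germ W Z c \<longleftrightarrow> assigned_germ W Z c \<or>
     (\<nexists>d. d 0 = c 0 \<and> assigned_germ W Z d) \<and> (\<forall>\<^sub>F s in nhds 0. c s = c 0)"

definition trajectory_piece ::
    "plane set \<Rightarrow> pwfield \<Rightarrow> real set \<Rightarrow> (real \<Rightarrow> plane) \<Rightarrow> bool" where
  "trajectory_piece W Z I c \<longleftrightarrow>
     open I \<and> is_interval I \<and> I \<noteq> {} \<and> continuous_on I c \<and> c ` I \<subseteq> W \<and>
     (\<forall>t\<in>I. trajectory_germ W Z (\<lambda>s. c (t + s)))"

definition trajectory :: "plane set \<Rightarrow> pwfield \<Rightarrow> real set \<Rightarrow> (real \<Rightarrow> plane) \<Rightarrow> bool" where
  "trajectory W Z I c \<longleftrightarrow> trajectory_piece W Z I c \<and>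
     (\<forall>J d. trajectory_piece W Z J d \<and> I \<subseteq> J \<and> (\<forall>t\<in>I. d t = c t) \<longrightarrow> J = I)"

definition to_complex :: "plane \<Rightarrow> complex" where
  "to_complex v = Complex (v $ 1) (v $ 2)"

text \<open>A homeomorphism between planar open sets preserves orientation iff its local degree is 1,
  i.e. the image of a small positively oriented circle about p winds once around the image of p.\<close>

definition orientation_preserving :: "plane set \<Rightarrow> vfield \<Rightarrow> bool" where
  "orientation_preserving W h \<longleftrightarrow>
     (\<forall>p\<in>W. \<forall>e>0. cball p e \<subseteq> W \<longrightarrow>
        winding_number
          (\<lambda>t. to_complex (h (p + e *\<^sub>R vector [cos (2 * pi * t), sin (2 * pi * t)])))
          (to_complex (h p)) = 1)"

text \<open>Trajectories are oriented by time: the reparametrisation \<tau> is increasing.\<close>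

definition maps_trajectories ::
    "plane set \<Rightarrow> pwfield \<Rightarrow> plane set \<Rightarrow> pwfield \<Rightarrow> vfield \<Rightarrow> bool" where
  "maps_trajectories W Z W' Z' h \<longleftrightarrow>
     (\<forall>I c. trajectory W Z I c \<longrightarrow>
        (\<exists>J d \<tau>. trajectory W' Z' J d \<and> strict_mono_on I \<tau> \<and> \<tau> ` I = J \<and>
           (\<forall>t\<in>I. h (c t) = d (\<tau> t))))"

text \<open>The neighbourhoods W and W' belong to the pair of fields; in a family they may depend on the
  parameter.\<close>

definition locally_equivalent :: "plane set \<Rightarrow> pwfield \<Rightarrow> pwfield \<Rightarrow> bool" where
  "locally_equivalent U Z Z' \<longleftrightarrow>
     (\<exists>W W' h k. open W \<and> 0 \<in> W \<and> W \<subseteq> U \<and> open W' \<and> 0 \<in> W' \<and> W' \<subseteq> U \<and>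
        homeomorphism W W' h k \<and> orientation_preserving W h \<and>
        h ` Sigma_set W = Sigma_set W' \<and> maps_trajectories W Z W' Z' h)"

definition locally_weak_equivalent ::
    "plane set \<Rightarrow> real set \<Rightarrow> (real \<Rightarrow> pwfield) \<Rightarrow> real set \<Rightarrow> (real \<Rightarrow> pwfield) \<Rightarrow> bool" where
  "locally_weak_equivalent U I \<gamma> J \<gamma>' \<longleftrightarrow>
     (\<exists>A B \<mu> \<nu>. open A \<and> 0 \<in> A \<and> A \<subseteq> I \<and> open B \<and> 0 \<in> B \<and> B \<subseteq> J \<and>
        homeomorphism A B \<mu> \<nu> \<and> \<mu> 0 = 0 \<and>
        (\<forall>\<delta>\<in>A. locally_equivalent U (\<gamma> \<delta>) (\<gamma>' (\<mu> \<delta>))))"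

definition detZ :: "pwfield \<Rightarrow> plane \<Rightarrow> real" where
  "detZ Z x = fst Z x $ 1 * snd Z x $ 2 - fst Z x $ 2 * snd Z x $ 1"

definition Xi11 :: "nat \<Rightarrow> plane set \<Rightarrow> pwfield set" where
  "Xi11 r U = {Z \<in> Omega r U.
     (\<forall>i. fst Z 0 $ i * snd Z 0 $ i < 0) \<and> detZ Z 0 = 0 \<and> (\<forall>i. pd i (detZ Z) 0 \<noteq> 0)}"

definition restrict_field :: "plane set \<Rightarrow> vfield \<Rightarrow> vfield" where
  "restrict_field U f x = (if x \<in> closure U then f x else 0)"

definition normal_family ::
    "plane set \<Rightarrow> real \<Rightarrow> real \<Rightarrow> real \<Rightarrow> real \<Rightarrow> real \<Rightarrow> pwfield" where
  "normal_family U a b c\<^sub>1 c\<^sub>2 \<alpha> =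
     (restrict_field U (\<lambda>x. vector [a - b * c\<^sub>2 * x $ 1, b + a * \<alpha>]),
      restrict_field U (\<lambda>x. vector [- a, - b + a * c\<^sub>1 * x $ 2]))"

end

theory Submission imports Defs begin

text \<open>Every neighbourhood in a local equivalence may depend on the parameter, so for each parameter only
the germ of the field at the origin counts. As X and Y have components of opposite signs at the
origin, near the origin both axes consist of sliding and escaping points. No trajectory crosses an
axis there: the trajectories are the orbits of X in two quadrants, those of Y in the other two,
the orbits of the sliding fields on the four half axes, and the constant one at the origin. All
that can distinguish two such germs are the signs of X and Y at the origin and the directions of
sliding on the half axes, and the latter are given by the sign of det Z on the half axes. That
these data determine the germ is the content of locally_equivalent_if_same_local_type.

To prove this, the field is straightened. In a quadrant whose orbits run from one bounding half
axis to the other, a point is scaled radially so that the orbits become segments of slope 1 or -1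
(cut_chart); in a quadrant each of whose orbits meets at most one of the two half axes, the same
is achieved by the point in which an orbit meets the boundary together with the function x_1 x_2
(corner_chart). The charts of the four quadrants are scaled so that they agree on the half axes,
and together they form a continuous injective map straighten of the plane into itself, which is
open by invariance of domain. Two fields with the same data are straightened to the same picture,
so one straightening followed by the inverse of the other takes trajectories to trajectories. It
maps each quadrant to itself, hence it preserves the orientation.

It remains to compare the data along the two families. If the derivative of det Z_\<delta>(0) at
\<delta> = 0 were 0, a curve of degree 2 in the set of degenerate fields would have the velocity
of the unfolding, against transversality (det_velocity_nonzero). So up to the orientation of the
parameter det Z_\<delta>(0) has the sign of \<delta>, just as the determinant of the normal family
has the value \<alpha> at the origin. For a nonzero parameter this sign is the sign of the
determinant on all four half axes close to the origin; at \<delta> = 0 the determinant vanishes at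
the origin and its partial derivatives determine the signs.\<close>

no_notation fps_nth (infixl "$" 75)

section \<open>The flow of a bounded Lipschitz field\<close>

text \<open>Both directions of time are handled by one estimate, because the bound depends on
the distance to time 0 only.\<close>

lemma differentiable_bound_abs:
  fixes G :: "real \<Rightarrow> 'a::real_normed_vector" and \<phi> \<phi>' :: "real \<Rightarrow> real"
  assumes G: "\<And>t. (G has_vector_derivative g t) (at t)"
    and \<phi>: "\<And>t. (\<phi> has_vector_derivative \<phi>' t) (at t)"
    and le: "\<And>t. norm (g t) \<le> \<phi>' \<bar>t\<bar>"
  shows "norm (G t - G 0) \<le> \<phi> \<bar>t\<bar> - \<phi> 0"
proof -
  have cG: "continuous_on S G" and c\<phi>: "continuous_on S \<phi>" for S
    using G \<phi> by (meson continuous_at_imp_continuous_on has_vector_derivative_continuous)+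
  consider "t = 0" | "t > 0" | "t < 0" by linarith
  then show ?thesis
  proof cases
    case 2
    have "norm (G t - G 0) \<le> \<phi> t - \<phi> 0"
      by (rule differentiable_bound_general[where f'=g and \<phi>'=\<phi>'])
        (use 2 cG c\<phi> G \<phi> in \<open>auto intro: order_trans[OF le]\<close>)
    then show ?thesis using 2 by simp
  next
    case 3
    have "(uminus has_vector_derivative - (1::real)) (at s)" for s :: real
      unfolding has_real_derivative_iff_has_vector_derivative[symmetric]
      by (auto intro!: derivative_eq_intros)
    then have "((\<lambda>s. G (- s)) has_vector_derivative - g (- s)) (at s)" for s
      using vector_diff_chain_at[OF _ G, of uminus "-1" s] by (simp add: o_def)
    then have "norm (G (- (- t)) - G (- 0)) \<le> \<phi> (- t) - \<phi> 0"
      by (intro differentiable_bound_general[where f'="\<lambda>s. - g (- s)" and \<phi>'=\<phi>' and f="\<lambda>s. G (- s)"])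
        (use 3 c\<phi> \<phi> in \<open>auto intro!: continuous_on_compose2[OF cG[of UNIV]] continuous_intros intro: order_trans[OF le]\<close>)
    then show ?thesis using 3 by simp
  qed simp
qed

locale lipschitz_field =
  fixes F :: "'a::euclidean_space \<Rightarrow> 'a" and K M :: real
  assumes K_pos: "0 < K"
    and lipschitz: "norm (F x - F y) \<le> K * norm (x - y)"
    and norm_bound: "norm (F x) \<le> M"
begin

lemma continuous_field: "continuous_on S F"
proof (rule continuous_on_subset)
  show "continuous_on UNIV F"
    unfolding continuous_on_iff
  proof (intro ballI allI impI)
    fix x :: 'a and e :: real assume "e > 0"
    then have "dist y x < e / K \<Longrightarrow> dist (F y) (F x) < e" for y
      using lipschitz[of y x] K_pos
      by (simp add: dist_norm less_divide_eq mult.commute le_less_trans)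
    then show "\<exists>d>0. \<forall>x'\<in>UNIV. dist x' x < d \<longrightarrow> dist (F x') (F x) < e"
      using \<open>e > 0\<close> K_pos by (intro exI[of _ "e / K"]) auto
  qed
qed simp

lemma M_nonneg: "0 \<le> M"
  using norm_bound norm_ge_zero order_trans by blast

lemma exists_antiderivative:
  fixes f :: "real \<Rightarrow> 'a"
  assumes "continuous_on UNIV f"
  shows "\<exists>G. G 0 = 0 \<and> (\<forall>t. (G has_vector_derivative f t) (at t))"
proof -
  obtain G where G: "\<And>t. (G has_vector_derivative f t) (at t)"
    using einterval_antiderivative[of "-\<infinity>" "\<infinity>" f] assms
    by (auto simp: continuous_on_eq_continuous_at)
  have "((\<lambda>t. G t - G 0) has_vector_derivative f t) (at t)" for t
    using G[of t] by (auto intro!: derivative_eq_intros)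
  then show ?thesis by (intro exI[of _ "\<lambda>t. G t - G 0"]) auto
qed

text \<open>Picard iteration converges on the whole time axis at once if deviations are measured
relative to exp (2 K |t|): for solutions written as p + exp (2 K |t|) w(t) with w bounded and
continuous, the integral operator halves distances, since the integral of K exp (2 K |s|) over
[0, t] is less than half of exp (2 K |t|).\<close>

lemma global_solution_exists:
  "\<exists>c. c 0 = p \<and> (\<forall>t. (c has_vector_derivative F (c t)) (at t))"
proof -
  \<comment> \<open>The factor 2 in the exponent is what turns the Lipschitz constant of the operator into 1/2.\<close>
  define wt where "wt t = exp (2 * K * \<bar>t\<bar>)" for t :: real
  have wt_pos: "wt t > 0" and wt_ge: "wt t \<ge> 1" for t
    using K_pos by (auto simp: wt_def)
  have cwt: "continuous_on S wt" for S
    unfolding wt_def by (intro continuous_intros)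
  have ex: "\<exists>G. G 0 = 0 \<and>
      (\<forall>t. (G has_vector_derivative F (p + wt t *\<^sub>R apply_bcontfun w t)) (at t))" for w
    by (intro exists_antiderivative continuous_on_compose2[OF continuous_field[of UNIV]]
        continuous_intros cwt) auto
  then obtain G where G0: "\<And>w. G w 0 = 0"
    and G: "\<And>w t. (G w has_vector_derivative F (p + wt t *\<^sub>R apply_bcontfun w t)) (at t)"
    by metis
  have cG: "continuous_on S (G w)" for S w
    by (meson G continuous_at_imp_continuous_on has_vector_derivative_continuous)
  have bG: "norm (G w t) \<le> M * \<bar>t\<bar>" for w t
  proof -
    have "((*) M has_vector_derivative M) (at t)" for t
      unfolding has_real_derivative_iff_has_vector_derivative[symmetric]
      by (auto intro!: derivative_eq_intros)
    then show ?thesis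
      using differentiable_bound_abs[OF G[of w], of "\<lambda>t. M * t" "\<lambda>_. M" t] norm_bound
      by (simp add: G0)
  qed
  have abs_le: "\<bar>t\<bar> \<le> wt t / (2 * K)" for t
  proof -
    have "2 * K * \<bar>t\<bar> \<le> wt t"
      using exp_ge_add_one_self[of "2 * K * \<bar>t\<bar>"] unfolding wt_def by linarith
    then show ?thesis using K_pos by (simp add: field_simps)
  qed
  then have bw: "norm ((1 / wt t) *\<^sub>R G w t) \<le> M / (2 * K)" for w t
  proof -
    have "norm (G w t) \<le> M * (wt t / (2 * K))"
      using bG[of w t] abs_le[of t] M_nonneg by (meson mult_left_mono order_trans)
    then show ?thesis
      using wt_pos[of t] K_pos by (simp add: field_simps)
  qed
  have bc: "(\<lambda>t. (1 / wt t) *\<^sub>R G w t) \<in> bcontfun" for w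
    using bw wt_pos unfolding bcontfun_def
    by (auto intro!: continuous_intros cwt cG boundedI simp: less_imp_neq[THEN not_sym])
  define T where "T w = Bcontfun (\<lambda>t. (1 / wt t) *\<^sub>R G w t)" for w
  have T: "apply_bcontfun (T w) t = (1 / wt t) *\<^sub>R G w t" for w t
    by (simp add: T_def Bcontfun_inverse[OF bc])
  have "dist (T w) (T v) \<le> 1/2 * dist w v" for w v
  proof (rule dist_bound)
    fix t
    let ?\<phi> = "\<lambda>t. dist w v / 2 * exp (2 * K * t)"
    have "norm ((G w t - G v t) - (G w 0 - G v 0)) \<le> ?\<phi> \<bar>t\<bar> - ?\<phi> 0"
    proof (rule differentiable_bound_abs)
      show "((\<lambda>t. G w t - G v t) has_vector_derivative
          F (p + wt t *\<^sub>R w t) - F (p + wt t *\<^sub>R v t)) (at t)" for t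
        by (intro has_vector_derivative_diff G)
      show "(?\<phi> has_vector_derivative K * dist w v * exp (2 * K * t)) (at t)" for t
        unfolding has_real_derivative_iff_has_vector_derivative[symmetric]
        by (auto intro!: derivative_eq_intros)
      fix t
      have "norm (F (p + wt t *\<^sub>R w t) - F (p + wt t *\<^sub>R v t)) \<le> K * (wt t * dist (w t) (v t))"
        using lipschitz[of "p + wt t *\<^sub>R w t" "p + wt t *\<^sub>R v t"] wt_pos[of t]
        by (simp add: dist_norm flip: scaleR_diff_right)
      also have "\<dots> \<le> K * (wt t * dist w v)"
        using K_pos wt_pos[of t] by (simp add: dist_bounded)
      finally show "norm (F (p + wt t *\<^sub>R w t) - F (p + wt t *\<^sub>R v t))
          \<le> K * dist w v * exp (2 * K * \<bar>t\<bar>)"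
        by (simp add: wt_def algebra_simps)
    qed
    then have "norm (G w t - G v t) \<le> dist w v / 2 * wt t"
      using zero_le_dist[of w v] by (simp add: G0 wt_def del: zero_le_dist)
    moreover have "dist (T w t) (T v t) = norm (G w t - G v t) / wt t"
      using wt_pos[of t] by (simp add: T dist_norm flip: scaleR_diff_right)
    ultimately show "dist (T w t) (T v t) \<le> 1/2 * dist w v"
      using divide_right_mono[of "norm (G w t - G v t)" "dist w v / 2 * wt t" "wt t"] wt_pos[of t]
      by simp
  qed
  then obtain w where w: "T w = w"
    using banach_fix_type[of "1/2" T] by auto
  let ?c = "\<lambda>t. p + G w t"
  have fp: "wt t *\<^sub>R apply_bcontfun w t = G w t" for t
    using T[of w t] w wt_pos[of t] by simp
  have "(?c has_vector_derivative F (?c t)) (at t)" for t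
    using has_vector_derivative_add[OF has_vector_derivative_const G[of w t], of p]
    by (simp add: fp)
  then show ?thesis using G0 by (intro exI[of _ ?c]) auto
qed

text \<open>The squared distance u satisfies |u'| \<le> 2 K u, so exp (- 2 K t) u decreases and
exp (2 K t) u increases; one of these gives the estimate forward, the other backward in time.\<close>

lemma gronwall:
  assumes I: "is_interval I" "s \<in> I" "t \<in> I"
    and c: "\<And>t. t \<in> I \<Longrightarrow> (c has_vector_derivative F (c t)) (at t)"
    and d: "\<And>t. t \<in> I \<Longrightarrow> (d has_vector_derivative F (d t)) (at t)"
  shows "norm (c t - d t) \<le> exp (K * \<bar>t - s\<bar>) * norm (c s - d s)"
proof -
  define u where "u t = (c t - d t) \<bullet> (c t - d t)" for t
  define u' where "u' t = 2 * ((c t - d t) \<bullet> (F (c t) - F (d t)))" for t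
  have u: "(u has_real_derivative u' t) (at t)" if "t \<in> I" for t
    unfolding u_def u'_def has_real_derivative_iff_has_vector_derivative
    by (rule has_vector_derivative_eq_rhs,
        rule bounded_bilinear.has_vector_derivative[OF bounded_bilinear_inner],
        (rule has_vector_derivative_diff c d that)+) (simp add: inner_commute)
  have u'_le: "\<bar>u' t\<bar> \<le> 2 * K * u t" for t
  proof -
    have "\<bar>(c t - d t) \<bullet> (F (c t) - F (d t))\<bar> \<le> norm (c t - d t) * (K * norm (c t - d t))"
      by (rule order_trans[OF Cauchy_Schwarz_ineq2] mult_left_mono lipschitz norm_ge_zero)+
    then show ?thesis
      by (simp add: u'_def u_def power2_norm_eq_inner[symmetric] power2_eq_square algebra_simps)
  qed
  have der: "((\<lambda>t. exp (k * t) * u t) has_real_derivative exp (k * t) * (k * u t + u' t)) (at t)"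
    if "t \<in> I" for t k
    by (rule derivative_eq_intros u[OF that] refl | simp add: algebra_simps)+
  have mem: "x \<in> I" if "a \<in> I" "b \<in> I" "a \<le> x" "x \<le> b" for a b x
    using I(1) that unfolding is_interval_1 by blast
  have dec: "exp (- (2 * K) * b) * u b \<le> exp (- (2 * K) * a) * u a" if "a \<in> I" "b \<in> I" "a \<le> b" for a b
  proof (rule DERIV_nonpos_imp_nonincreasing[OF that(3)])
    fix x assume "a \<le> x" "x \<le> b"
    then show "\<exists>y. ((\<lambda>t. exp (- (2 * K) * t) * u t) has_real_derivative y) (at x) \<and> y \<le> 0"
      using u'_le[of x]
      by (intro exI[of _ "exp (- (2 * K) * x) * (- (2 * K) * u x + u' x)"] conjI
          der mem[OF that(1,2)]) (auto simp: mult_le_0_iff not_le)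
  qed
  have inc: "exp (2 * K * a) * u a \<le> exp (2 * K * b) * u b" if "a \<in> I" "b \<in> I" "a \<le> b" for a b
  proof (rule DERIV_nonneg_imp_nondecreasing[OF that(3)])
    fix x assume "a \<le> x" "x \<le> b"
    then show "\<exists>y. ((\<lambda>t. exp (2 * K * t) * u t) has_real_derivative y) (at x) \<and> y \<ge> 0"
      using u'_le[of x]
      by (intro exI[of _ "exp (2 * K * x) * (2 * K * u x + u' x)"] conjI
          der mem[OF that(1,2)]) (auto simp: zero_le_mult_iff)
  qed
  have "u t \<le> exp (2 * K * \<bar>t - s\<bar>) * u s"
  proof (cases "s \<le> t")
    case True
    have "u t = exp (2 * K * t) * (exp (- (2 * K) * t) * u t)"
      by (simp add: mult.assoc[symmetric] exp_add[symmetric])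
    also have "\<dots> \<le> exp (2 * K * t) * (exp (- (2 * K) * s) * u s)"
      by (intro mult_left_mono dec I True) auto
    also have "\<dots> = exp (2 * K * t + - (2 * K) * s) * u s"
      unfolding mult.assoc[symmetric] exp_add[symmetric] by (rule refl)
    finally show ?thesis using True by (simp add: right_diff_distrib)
  next
    case False
    have "u t = exp (- (2 * K) * t) * (exp (2 * K * t) * u t)"
      by (simp add: mult.assoc[symmetric] exp_add[symmetric])
    also have "\<dots> \<le> exp (- (2 * K) * t) * (exp (2 * K * s) * u s)"
      using False by (intro mult_left_mono inc I) auto
    also have "\<dots> = exp (- (2 * K) * t + 2 * K * s) * u s"
      unfolding mult.assoc[symmetric] exp_add[symmetric] by (rule refl)
    finally show ?thesis using False by (simp add: right_diff_distrib)
  qed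
  moreover have "exp (2 * K * \<bar>t - s\<bar>) = (exp (K * \<bar>t - s\<bar>))\<^sup>2"
    by (simp add: exp_double[symmetric] mult.assoc)
  ultimately have "(norm (c t - d t))\<^sup>2 \<le> (exp (K * \<bar>t - s\<bar>) * norm (c s - d s))\<^sup>2"
    by (simp add: u_def power2_norm_eq_inner power_mult_distrib)
  then show ?thesis by (rule power2_le_imp_le) simp
qed

definition flow :: "real \<Rightarrow> 'a \<Rightarrow> 'a" where
  "flow t p = (SOME c. c 0 = p \<and> (\<forall>t. (c has_vector_derivative F (c t)) (at t))) t"

lemma flow_0 [simp]: "flow 0 p = p"
  and flow_has_vector_derivative: "((\<lambda>t. flow t p) has_vector_derivative F (flow t p)) (at t)"
  using someI_ex[OF global_solution_exists, of p] by (auto simp: flow_def)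

lemma flow_shift_has_vector_derivative:
  "((\<lambda>t. flow (t + k) p) has_vector_derivative F (flow (t + k) p)) (at t)"
proof -
  have "((\<lambda>t. t + k) has_vector_derivative 1) (at t)"
    unfolding has_real_derivative_iff_has_vector_derivative[symmetric]
    by (auto intro!: derivative_eq_intros)
  then show ?thesis
    using vector_diff_chain_at[of "\<lambda>t. t + k" 1 t "\<lambda>t. flow t p"]
      flow_has_vector_derivative[of p "t + k"] by (simp add: o_def)
qed

lemma solution_eq_flow:
  assumes "is_interval I" "s \<in> I" "t \<in> I"
    and "\<And>t. t \<in> I \<Longrightarrow> (c has_vector_derivative F (c t)) (at t)"
  shows "c t = flow (t - s) (c s)"
proof -
  have "norm (c t - flow (t + - s) (c s)) \<le> exp (K * \<bar>t - s\<bar>) * norm (c s - flow (s + - s) (c s))"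
    by (rule gronwall[OF assms]) (auto intro: flow_shift_has_vector_derivative[of "- s", simplified])
  then show ?thesis by simp
qed

lemma flow_add: "flow (s + t) p = flow s (flow t p)"
  using solution_eq_flow[of UNIV t "s + t" "\<lambda>t. flow t p"] flow_has_vector_derivative by simp

lemma flow_minus [simp]: "flow (- t) (flow t p) = p" "flow t (flow (- t) p) = p"
  by (simp_all flip: flow_add)

lemma norm_flow_diff: "norm (flow t p - flow t q) \<le> exp (K * \<bar>t\<bar>) * norm (p - q)"
  using gronwall[of UNIV 0 t "\<lambda>t. flow t p" "\<lambda>t. flow t q"] flow_has_vector_derivative by simp

lemma continuous_flow_time: "continuous_on S (\<lambda>t. flow t p)"
  using flow_has_vector_derivative has_vector_derivative_continuous
  by (intro continuous_at_imp_continuous_on) blast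

text \<open>The starting point can be moved at the cost of the Gronwall factor, which stays
bounded as the time converges.\<close>

lemma tendsto_flow:
  assumes "(\<tau> \<longlongrightarrow> t) G" "(x \<longlongrightarrow> p) G"
  shows "((\<lambda>z. flow (\<tau> z) (x z)) \<longlongrightarrow> flow t p) G"
proof -
  have "((\<lambda>z. flow (\<tau> z) p) \<longlongrightarrow> flow t p) G"
    using isCont_tendsto_compose[OF _ assms(1)] continuous_flow_time[of UNIV p]
    by (auto simp: continuous_on_eq_continuous_at)
  moreover have "((\<lambda>z. flow (\<tau> z) (x z) - flow (\<tau> z) p) \<longlongrightarrow> 0) G"
  proof (rule Lim_null_comparison)
    show "\<forall>\<^sub>F z in G. norm (flow (\<tau> z) (x z) - flow (\<tau> z) p) \<le> exp (K * \<bar>\<tau> z\<bar>) * norm (x z - p)"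
      by (simp add: norm_flow_diff)
    have "((\<lambda>z. exp (K * \<bar>\<tau> z\<bar>) * norm (x z - p)) \<longlongrightarrow> exp (K * \<bar>t\<bar>) * norm (p - p)) G"
      by (intro tendsto_intros assms)
    then show "((\<lambda>z. exp (K * \<bar>\<tau> z\<bar>) * norm (x z - p)) \<longlongrightarrow> 0) G" by simp
  qed
  ultimately show ?thesis using tendsto_add by fastforce
qed

lemma continuous_on_flow [continuous_intros]:
  "continuous_on S \<tau> \<Longrightarrow> continuous_on S x \<Longrightarrow> continuous_on S (\<lambda>z. flow (\<tau> z) (x z))"
  by (auto simp: continuous_on_def intro: tendsto_flow)

end

section \<open>Charts of a quadrant for a field transversal to both axes\<close>

lemma forall_plane: "(\<forall>i::2. P i) \<longleftrightarrow> P 1 \<and> P 2"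
  by (metis exhaust_2)

lemma other_simps [simp]: "other 1 = 2" "other 2 = 1" "other (other i) = i" "other i \<noteq> i" "i \<noteq> other i"
  for i :: 2
  using exhaust_2[of i] by (auto simp: other_def)

lemma plane_eqI: "x $ 1 = y $ 1 \<Longrightarrow> x $ 2 = y $ 2 \<Longrightarrow> x = (y::plane)"
  by (simp add: vec_eq_iff forall_plane)

lemma plane_eq_iff: "x = (y::plane) \<longleftrightarrow> x $ 1 = y $ 1 \<and> x $ 2 = y $ 2"
  by (simp add: vec_eq_iff forall_plane)

lemma plane_eqI_other:
  fixes x y :: plane and i :: 2
  shows "x $ i = y $ i \<Longrightarrow> x $ other i = y $ other i \<Longrightarrow> x = y"
  using exhaust_2[of i] by (auto intro: plane_eqI)

lemma continuous_on_plane: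
  fixes f g :: "'a::topological_space \<Rightarrow> real"
  assumes "continuous_on S f" "continuous_on S g"
  shows "continuous_on S (\<lambda>x. vector [f x, g x] :: plane)"
proof -
  have "(\<lambda>x. vector [f x, g x] :: plane) = (\<lambda>x. f x *\<^sub>R axis 1 1 + g x *\<^sub>R axis 2 1)"
    by (rule ext) (simp add: plane_eq_iff axis_def)
  then show ?thesis by (simp only:) (intro continuous_intros assms)
qed

definition open_quadrant :: "plane set" where
  "open_quadrant = {x. 0 < x $ 1 \<and> 0 < x $ 2}"

definition closed_quadrant :: "plane set" where
  "closed_quadrant = {x. 0 \<le> x $ 1 \<and> 0 \<le> x $ 2}"

text \<open>The entry sg $ i is the sign of the i-th component of the field. The uniform lower
bound on the speeds makes every orbit meet each axis exactly once.\<close>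

locale transversal_field = lipschitz_field F K M
  for F :: "plane \<Rightarrow> plane" and K M :: real +
  fixes \<kappa> :: real and sg :: plane
  assumes speed_pos: "0 < \<kappa>"
    and sg: "sg $ i = 1 \<or> sg $ i = -1"
    and speed: "\<kappa> \<le> sg $ i * F x $ i"
begin

lemma sg_mult_self [simp]: "sg $ i * sg $ i = 1" "sg $ i * (sg $ i * x) = x"
  using sg[of i] by auto

lemma flow_coordinate_increase:
  assumes "s \<le> t"
  shows "\<kappa> * (t - s) \<le> sg $ i * (flow t p $ i - flow s p $ i)"
proof -
  have "((\<lambda>t. sg $ i * flow t p $ i - \<kappa> * t) has_real_derivative sg $ i * F (flow t p) $ i - \<kappa>) (at t)" for t
    using bounded_linear.has_vector_derivative[OF bounded_linear_vec_nth[of i] flow_has_vector_derivative[of p t]]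
    unfolding has_real_derivative_iff_has_vector_derivative[symmetric]
    by (auto intro!: derivative_eq_intros)
  then have "sg $ i * flow s p $ i - \<kappa> * s \<le> sg $ i * flow t p $ i - \<kappa> * t"
    using speed by (intro DERIV_nonneg_imp_nondecreasing[OF assms]) fastforce
  then show ?thesis by (simp add: algebra_simps)
qed

lemma flow_coordinate_pos_iff: "0 < sg $ i * (flow t p $ i - p $ i) \<longleftrightarrow> 0 < t"
proof
  assume "0 < t"
  then have "0 < \<kappa> * (t - 0)" using speed_pos by simp
  also have "\<dots> \<le> sg $ i * (flow t p $ i - flow 0 p $ i)"
    using \<open>0 < t\<close> by (intro flow_coordinate_increase) simp
  finally show "0 < sg $ i * (flow t p $ i - p $ i)" by simp
next
  assume "0 < sg $ i * (flow t p $ i - p $ i)"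
  moreover have "\<kappa> * (0 - t) \<le> sg $ i * (flow 0 p $ i - flow t p $ i)" if "t \<le> 0"
    using that by (intro flow_coordinate_increase) simp
  moreover have "\<kappa> * (0 - t) \<ge> 0" if "t \<le> 0"
    using that speed_pos by (simp add: mult_le_0_iff)
  ultimately show "0 < t" by (fastforce simp: algebra_simps not_less)
qed

lemma flow_coordinate_neg_iff: "sg $ i * (flow t p $ i - p $ i) < 0 \<longleftrightarrow> t < 0"
  using flow_coordinate_pos_iff[of i "- t" "flow t p"] by (simp add: algebra_simps)

lemma flow_coordinate_inj: "flow s p $ i = flow t p $ i \<longleftrightarrow> s = t"
proof
  assume eq: "flow s p $ i = flow t p $ i"
  have "flow (s - t) (flow t p) = flow s p" by (simp flip: flow_add)
  then show "s = t"
    using flow_coordinate_pos_iff[of i "s - t" "flow t p"]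
      flow_coordinate_neg_iff[of i "s - t" "flow t p"] eq by fastforce
qed simp

lemma flow_eq_self_iff: "flow t p = p \<longleftrightarrow> t = 0"
  using flow_coordinate_inj[of t p 1 0] by auto

definition hit :: "2 \<Rightarrow> plane \<Rightarrow> real" where
  "hit i p = (THE t. flow t p $ i = 0)"

lemma flow_hit [simp]: "flow (hit i p) p $ i = 0"
proof -
  \<comment> \<open>Within this time, in one direction or the other, the i-th coordinate has covered the distance to 0.\<close>
  let ?T = "\<bar>p $ i\<bar> / \<kappa>"
  have T: "0 \<le> ?T" "\<kappa> * ?T = \<bar>p $ i\<bar>" using speed_pos by auto
  have c: "continuous_on {- ?T..?T} (\<lambda>t. sg $ i * flow t p $ i)"
    by (intro continuous_intros)
  have "\<bar>p $ i\<bar> \<le> sg $ i * (flow ?T p $ i - p $ i)"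
    using flow_coordinate_increase[of 0 ?T i p] T by simp
  moreover have "\<bar>p $ i\<bar> \<le> sg $ i * (p $ i - flow (- ?T) p $ i)"
    using flow_coordinate_increase[of "- ?T" 0 i p] T by simp
  ultimately have "sg $ i * flow (- ?T) p $ i \<le> 0" "0 \<le> sg $ i * flow ?T p $ i"
    using sg[of i] by auto
  then obtain t where "sg $ i * flow t p $ i = 0"
    using IVT'[OF _ _ _ c, of 0] T(1) by force
  then have "flow t p $ i = 0" using sg[of i] by auto
  then show ?thesis
    unfolding hit_def by (rule theI) (metis \<open>flow t p $ i = 0\<close> flow_coordinate_inj)
qed

lemma hit_eq: "flow t p $ i = 0 \<Longrightarrow> hit i p = t"
  by (metis flow_hit flow_coordinate_inj)

text \<open>At the time when p hits the axis, the point q is off the axis by at most the Gronwall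
bound, and it closes this gap with speed at least \<kappa>.\<close>

lemma hit_diff: "\<kappa> * \<bar>hit i q - hit i p\<bar> \<le> exp (K * \<bar>hit i p\<bar>) * norm (q - p)"
proof -
  have "\<kappa> * \<bar>hit i q - hit i p\<bar> \<le> \<bar>flow (hit i p) q $ i\<bar>"
    using flow_coordinate_increase[of "hit i p" "hit i q" i q] flow_coordinate_increase[of "hit i q" "hit i p" i q]
      sg[of i] by (cases "hit i p \<le> hit i q") auto
  also have "\<dots> \<le> norm (flow (hit i p) q - flow (hit i p) p)"
    using component_le_norm_cart[of "flow (hit i p) q - flow (hit i p) p" i] by simp
  also have "\<dots> \<le> exp (K * \<bar>hit i p\<bar>) * norm (q - p)" by (rule norm_flow_diff)
  finally show ?thesis .
qed

lemma continuous_on_hit: "continuous_on S (hit i)"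
  unfolding continuous_on_def
proof
  fix p
  have "((\<lambda>q. hit i q - hit i p) \<longlongrightarrow> 0) (at p within S)"
  proof (rule Lim_null_comparison)
    show "\<forall>\<^sub>F q in at p within S. norm (hit i q - hit i p) \<le> exp (K * \<bar>hit i p\<bar>) / \<kappa> * norm (q - p)"
      using hit_diff[of i _ p] speed_pos
      by (intro always_eventually allI) (simp add: field_simps)
    have "((\<lambda>q. exp (K * \<bar>hit i p\<bar>) / \<kappa> * norm (q - p)) \<longlongrightarrow> exp (K * \<bar>hit i p\<bar>) / \<kappa> * norm (p - p)) (at p within S)"
      by (intro tendsto_intros)
    then show "((\<lambda>q. exp (K * \<bar>hit i p\<bar>) / \<kappa> * norm (q - p)) \<longlongrightarrow> 0) (at p within S)" by simp
  qed
  then show "(hit i \<longlongrightarrow> hit i p) (at p within S)" by (simp add: LIM_zero_iff)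
qed

text \<open>The position on the line x_i = 0 at which the orbit meets it: a global first integral
whose level sets are the orbits.\<close>

definition intercept :: "2 \<Rightarrow> plane \<Rightarrow> real" where
  "intercept i p = flow (hit i p) p $ other i"

lemma continuous_on_intercept [continuous_intros]:
  "continuous_on S f \<Longrightarrow> continuous_on S (\<lambda>x. intercept i (f x))"
  unfolding intercept_def
  by (intro continuous_intros continuous_on_compose2[OF continuous_on_hit[of UNIV]]) auto

lemma intercept_flow [simp]: "intercept i (flow t p) = intercept i p"
proof -
  have eq: "flow (hit i p - t) (flow t p) = flow (hit i p) p" by (simp flip: flow_add)
  then have "hit i (flow t p) = hit i p - t" by (intro hit_eq) simp
  then show ?thesis by (simp add: intercept_def eq)
qed

lemma intercept_on_axis: "p $ i = 0 \<Longrightarrow> intercept i p = p $ other i"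
  by (simp add: intercept_def hit_eq[of 0])

lemma intercept_eq_iff: "intercept i p = intercept i q \<longleftrightarrow> (\<exists>t. q = flow t p)"
proof
  assume "intercept i p = intercept i q"
  then have "flow (hit i p) p = flow (hit i q) q"
    by (intro plane_eqI_other[of _ i]) (auto simp: intercept_def)
  then have "q = flow (- hit i q) (flow (hit i p) p)" by simp
  then show "\<exists>t. q = flow t p" by (metis flow_add)
qed auto

text \<open>On the way from p to the axis the i-th coordinate changes by - p_i and the other one by
the difference of the intercept and its value at p; relative to sg both changes have the sign of the
time needed.\<close>

lemma intercept_sign:
  fixes p :: plane and i :: 2
  assumes "p $ i \<noteq> 0"
  shows "sg $ 1 * sg $ 2 * (intercept i p - p $ other i) * p $ i < 0"
proof -
  let ?t = "hit i p"
  have "?t \<noteq> 0" using assms flow_hit[of i p] by fastforce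
  then consider "?t > 0" | "?t < 0" by linarith
  then have "sg $ other i * (intercept i p - p $ other i) * (sg $ i * (0 - p $ i)) > 0"
  proof cases
    case 1
    then have "0 < sg $ other i * (intercept i p - p $ other i)" "0 < sg $ i * (0 - p $ i)"
      using flow_coordinate_pos_iff[of i ?t p] flow_coordinate_pos_iff[of "other i" ?t p]
      by (auto simp: intercept_def)
    then show ?thesis by (rule mult_pos_pos)
  next
    case 2
    then have "sg $ other i * (intercept i p - p $ other i) < 0" "sg $ i * (0 - p $ i) < 0"
      using flow_coordinate_neg_iff[of i ?t p] flow_coordinate_neg_iff[of "other i" ?t p]
      by (auto simp: intercept_def)
    then show ?thesis by (rule mult_neg_neg)
  qed
  moreover have eq: "sg $ 1 * sg $ 2 = sg $ other i * sg $ i"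
    using exhaust_2[of i] by auto
  then have "sg $ 1 * sg $ 2 * (intercept i p - p $ other i) * p $ i
      = - (sg $ other i * (intercept i p - p $ other i) * (sg $ i * (0 - p $ i)))"
    unfolding eq by algebra
  ultimately show ?thesis by linarith
qed

lemma intercepts_sign:
  "intercept 1 p = 0 \<and> intercept 2 p = 0 \<or> sg $ 1 * sg $ 2 * intercept 1 p * intercept 2 p < 0"
proof -
  \<comment> \<open>The point on the first axis of the same orbit, where both intercepts are visible at once.\<close>
  define q where "q = flow (hit 2 p) p"
  have q: "q $ 2 = 0" "q $ 1 = intercept 2 p" "intercept 1 q = intercept 1 p"
    by (auto simp: q_def intercept_def[of 2])
  show ?thesis
  proof (cases "q $ 1 = 0")
    case True
    then have "intercept 1 q = 0" using intercept_on_axis[of q 1] q by simp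
    then show ?thesis using q True by simp
  next
    case False
    then show ?thesis using intercept_sign[of q 1] q by simp
  qed
qed

text \<open>A chart f for which sg_1 f_2 - sg_2 f_1 labels the orbits and whose first coordinate progresses with time takes the orbits, with their direction, to half lines in
the direction sg.\<close>

lemma chart_orbit_iff:
  assumes label: "\<And>p q. p \<in> open_quadrant \<Longrightarrow> q \<in> open_quadrant \<Longrightarrow>
      (\<exists>t. q = flow t p) \<longleftrightarrow> sg $ 2 * (f q $ 1 - f p $ 1) = sg $ 1 * (f q $ 2 - f p $ 2)"
    and mono: "\<And>p t. p \<in> open_quadrant \<Longrightarrow> flow t p \<in> open_quadrant \<Longrightarrow> 0 < t \<Longrightarrow>
      0 < sg $ 1 * (f (flow t p) $ 1 - f p $ 1)"
    and p: "p \<in> open_quadrant" and q: "q \<in> open_quadrant"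
  shows "(\<exists>t\<ge>0. q = flow t p) \<longleftrightarrow> (\<exists>r\<ge>0. f q = f p + r *\<^sub>R (sg :: plane))"
proof
  assume "\<exists>t\<ge>0. q = flow t p"
  then obtain t where t: "t \<ge> 0" "q = flow t p" by blast
  let ?r = "sg $ 1 * (f q $ 1 - f p $ 1)"
  have "0 \<le> ?r"
    using mono[OF p, of t] t q by (cases "t = 0") auto
  moreover have "sg $ 2 * (f q $ 1 - f p $ 1) = sg $ 1 * (f q $ 2 - f p $ 2)"
    using label[OF p q] t by blast
  then have "f q = f p + ?r *\<^sub>R sg"
    using sg[of 1] sg[of 2] by (auto simp: plane_eq_iff)
  ultimately show "\<exists>r\<ge>0. f q = f p + r *\<^sub>R (sg :: plane)" by blast
next
  assume "\<exists>r\<ge>0. f q = f p + r *\<^sub>R sg"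
  then obtain r where r: "r \<ge> 0" "f q = f p + r *\<^sub>R sg" by blast
  then have "sg $ 2 * (f q $ 1 - f p $ 1) = sg $ 1 * (f q $ 2 - f p $ 2)"
    by (simp add: algebra_simps)
  then obtain t where t: "q = flow t p" using label[OF p q] by blast
  have "t \<ge> 0"
  proof (rule ccontr)
    assume "\<not> t \<ge> 0"
    moreover have "p = flow (- t) q" using t by simp
    ultimately have "0 < sg $ 1 * (f p $ 1 - f q $ 1)" using mono[OF q, of "- t"] p by simp
    then show False using r by (auto simp: algebra_simps)
  qed
  then show "\<exists>t\<ge>0. q = flow t p" using t by blast
qed

text \<open>For sg $ 2 = - sg $ 1 the orbits cut off the corner of the quadrant. Each is moved
radially to the segment x_1 + x_2 = c, where c is its intercept on the second axis; the ratio of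
the coordinates, which is kept, is strictly monotone along the orbit.\<close>

definition cut_chart :: "plane \<Rightarrow> plane" where
  "cut_chart x = (intercept 1 x / (x $ 1 + x $ 2)) *\<^sub>R x"

text \<open>For sg $ 2 = sg $ 1 an orbit in the quadrant comes from, or runs into, one boundary
point: the one of its two intercepts that is positive, or the corner. The product x_1 x_2 vanishes
there and is strictly monotone along the orbit, so it serves as the parameter on the line of slope
1 through the image of that boundary point. The function g leaves room for matching the chart of the quadrant on
the other side of the first axis.\<close>

definition corner_chart :: "(real \<Rightarrow> real) \<Rightarrow> plane \<Rightarrow> plane" where
  "corner_chart g x =
     vector [g (max 0 (intercept 2 x)) + x $ 1 * x $ 2, max 0 (intercept 1 x) + x $ 1 * x $ 2]"

lemma intercept_zero [simp]: "intercept i 0 = 0"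
  by (simp add: intercept_on_axis)

context
  assumes cut: "sg $ 2 = - sg $ 1"
begin

lemma cut_sign: "sg $ 1 * sg $ 2 = -1"
  using sg[of 1] cut by auto

lemma intercept_ge_cut:
  assumes "x \<in> closed_quadrant"
  shows "x $ 2 \<le> intercept 1 x" "x $ 1 \<noteq> 0 \<Longrightarrow> x $ 2 < intercept 1 x"
proof -
  show *: "x $ 2 < intercept 1 x" if "x $ 1 \<noteq> 0"
    using intercept_sign[OF that] assms that
    by (auto simp: cut_sign closed_quadrant_def mult_less_0_iff)
  show "x $ 2 \<le> intercept 1 x"
    using * intercept_on_axis[of x 1] by fastforce
qed

lemma cut_chart_axis_2: "x $ 1 = 0 \<Longrightarrow> cut_chart x = x"
  by (cases "x $ 2 = 0") (auto simp: cut_chart_def intercept_on_axis plane_eq_iff)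

lemma cut_chart_axis_1: "x $ 2 = 0 \<Longrightarrow> cut_chart x = vector [intercept 1 x, 0]"
  by (cases "x $ 1 = 0") (auto simp: cut_chart_def plane_eq_iff intercept_on_axis)

lemma cut_chart_open_quadrant: "x \<in> open_quadrant \<Longrightarrow> cut_chart x \<in> open_quadrant"
  using intercept_ge_cut(1)[of x]
  by (auto simp: cut_chart_def open_quadrant_def closed_quadrant_def)

lemma continuous_cut_chart: "continuous_on closed_quadrant cut_chart"
  unfolding continuous_on_def
proof
  fix x :: plane assume x: "x \<in> closed_quadrant"
  show "(cut_chart \<longlongrightarrow> cut_chart x) (at x within closed_quadrant)"
  proof (cases "x = 0")
    case False
    then have "x $ 1 + x $ 2 \<noteq> 0"
      using x by (auto simp: closed_quadrant_def plane_eq_iff)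
    moreover have "(intercept 1 \<longlongrightarrow> intercept 1 x) (at x within closed_quadrant)"
      using continuous_on_intercept[OF continuous_on_id] x by (auto simp: continuous_on_def)
    ultimately show ?thesis
      unfolding cut_chart_def by (intro tendsto_intros)
  next
    case True
    have "((\<lambda>y. intercept 1 y) \<longlongrightarrow> 0) (at x within closed_quadrant)"
      using continuous_on_intercept[OF continuous_on_id, of closed_quadrant 1] x True
      by (auto simp: continuous_on_def dest!: bspec[of _ _ 0])
    then have "((\<lambda>y. \<bar>intercept 1 y\<bar>) \<longlongrightarrow> 0) (at x within closed_quadrant)"
      using tendsto_mult_right_zero tendsto_rabs_zero by blast
    moreover have "norm (cut_chart y) \<le> \<bar>intercept 1 y\<bar>" if y: "y \<in> closed_quadrant" for y
    proof -
      have "norm y \<le> y $ 1 + y $ 2"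
        using norm_le_l1_cart[of y] y by (simp add: sum_2 closed_quadrant_def)
      then have "\<bar>intercept 1 y\<bar> * norm y \<le> \<bar>intercept 1 y\<bar> * (y $ 1 + y $ 2)"
        by (rule mult_left_mono) simp
      then show ?thesis
        using y abs_ge_zero[of "intercept 1 y"] by (cases "y $ 1 + y $ 2 = 0")
          (simp_all add: cut_chart_def closed_quadrant_def divide_le_eq)
    qed
    ultimately have "(cut_chart \<longlongrightarrow> 0) (at x within closed_quadrant)"
      by (intro Lim_null_comparison[of cut_chart]) (auto simp: eventually_at_filter)
    then show ?thesis using True by (simp add: cut_chart_def)
  qed
qed

lemma cut_chart_orbit_iff:
  assumes "p \<in> open_quadrant" "q \<in> open_quadrant"
  shows "(\<exists>t\<ge>0. q = flow t p) \<longleftrightarrow> (\<exists>r\<ge>0. cut_chart q = cut_chart p + r *\<^sub>R (sg :: plane))"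
proof (rule chart_orbit_iff[OF _ _ assms])
  have sum: "cut_chart x $ 1 + cut_chart x $ 2 = intercept 1 x" if "x \<in> open_quadrant" for x
  proof -
    have "x $ 1 + x $ 2 \<noteq> 0" using that by (auto simp: open_quadrant_def)
    then show ?thesis by (simp add: cut_chart_def flip: distrib_left add_divide_distrib)
  qed
  show "(\<exists>t. q = flow t p) \<longleftrightarrow>
      sg $ 2 * (cut_chart q $ 1 - cut_chart p $ 1) = sg $ 1 * (cut_chart q $ 2 - cut_chart p $ 2)"
    if "p \<in> open_quadrant" "q \<in> open_quadrant" for p q
    using sum[OF that(1)] sum[OF that(2)] sg[of 1]
    by (auto simp: cut intercept_eq_iff[of 1, symmetric])
  show "0 < sg $ 1 * (cut_chart (flow t p) $ 1 - cut_chart p $ 1)"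
    if p: "p \<in> open_quadrant" and q: "flow t p \<in> open_quadrant" and "0 < t" for p t
  proof -
    define q where "q = flow t p"
    let ?l = "intercept 1 p"
    have q: "intercept 1 q = ?l" "q \<in> open_quadrant" using q by (auto simp: q_def)
    have l: "0 < ?l"
      using intercept_ge_cut(1)[of p] p by (auto simp: open_quadrant_def closed_quadrant_def)
    have *: "0 < sg $ 1 * (q $ 1 - p $ 1)" "0 < sg $ 2 * (q $ 2 - p $ 2)"
      using \<open>0 < t\<close> flow_coordinate_pos_iff[of _ t p] by (auto simp: q_def)
    have "cut_chart q $ 1 - cut_chart p $ 1 =
        ?l * (q $ 1 * (p $ 1 + p $ 2) - p $ 1 * (q $ 1 + q $ 2)) / ((q $ 1 + q $ 2) * (p $ 1 + p $ 2))"
      using p q by (simp add: cut_chart_def open_quadrant_def field_simps)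
    also have "q $ 1 * (p $ 1 + p $ 2) - p $ 1 * (q $ 1 + q $ 2)
        = (q $ 1 - p $ 1) * p $ 2 - p $ 1 * (q $ 2 - p $ 2)"
      by (simp add: algebra_simps)
    finally have eq: "sg $ 1 * (cut_chart q $ 1 - cut_chart p $ 1) =
        ?l * (sg $ 1 * (q $ 1 - p $ 1) * p $ 2 + p $ 1 * (sg $ 2 * (q $ 2 - p $ 2)))
          / ((q $ 1 + q $ 2) * (p $ 1 + p $ 2))"
      by (simp add: cut algebra_simps)
    have "0 < sg $ 1 * (q $ 1 - p $ 1) * p $ 2 + p $ 1 * (sg $ 2 * (q $ 2 - p $ 2))"
      using p by (intro add_pos_pos mult_pos_pos *) (auto simp: open_quadrant_def)
    then show ?thesis
      unfolding q_def[symmetric] eq using l p q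
      by (intro divide_pos_pos mult_pos_pos) (auto simp: open_quadrant_def)
  qed
qed

text \<open>An orbit meets the first axis only once, so the intercept is injective along the
axis; being continuous, 0 at the corner and positive elsewhere, it increases.\<close>

lemma intercept_strict_mono_axis:
  assumes "0 \<le> x" "x < y"
  shows "intercept 1 (vector [x, 0]) < intercept 1 (vector [y, 0])"
proof -
  let ?f = "\<lambda>x. intercept 1 (vector [x, 0])"
  have inj: "inj_on ?f {0..}"
  proof (rule inj_onI)
    fix u v assume "?f u = ?f v"
    then obtain t where t: "(vector [v, 0] :: plane) = flow t (vector [u, 0])"
      using intercept_eq_iff by blast
    then have "flow t (vector [u, 0]) $ 2 = flow 0 (vector [u, 0]) $ 2"
      by (metis flow_0 vector_2(2))
    then have "t = 0" by (simp only: flow_coordinate_inj)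
    then have "(vector [v, 0] :: plane) = vector [u, 0]" using t by simp
    then show "u = v" by (metis vector_2(1))
  qed
  have "continuous_on {0..} (\<lambda>x. vector [x, 0] :: plane)"
    by (intro continuous_on_plane continuous_intros)
  then have cont: "continuous_on {0..} ?f" by (rule continuous_on_intercept)
  have pos: "?f y > 0"
    using intercept_ge_cut(2)[of "vector [y, 0]"] assms by (simp add: closed_quadrant_def)
  have "?f 0 = 0" by (simp add: intercept_on_axis)
  show ?thesis
  proof (cases "x = 0")
    case True then show ?thesis using pos \<open>?f 0 = 0\<close> by simp
  next
    case False
    show ?thesis
    proof (rule ccontr)
      assume "\<not> ?thesis"
      then have "?f 0 \<le> ?f y" "?f y \<le> ?f x" using pos \<open>?f 0 = 0\<close> by auto
      then obtain z where "0 \<le> z" "z \<le> x" "?f z = ?f y"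
        using IVT'[of ?f 0 "?f y" x] assms continuous_on_subset[OF cont, of "{0..x}"] by auto
      then show False using inj_onD[OF inj, of z y] assms by auto
    qed
  qed
qed

end

context
  fixes g :: "real \<Rightarrow> real"
  assumes corner: "sg $ 2 = sg $ 1"
    and g_cont: "continuous_on {0..} g" and g_0: "g 0 = 0"
    and g_mono: "\<And>x y. 0 \<le> x \<Longrightarrow> x < y \<Longrightarrow> g x < g y"
begin

lemma corner_sign: "sg $ 1 * sg $ 2 = 1"
  using sg[of 1] corner by auto

lemma corner_chart_axis_2:
  assumes "x $ 1 = 0" "0 \<le> x $ 2"
  shows "corner_chart g x = x"
proof -
  have "intercept 2 x \<le> 0"
    using intercepts_sign[of x] assms intercept_on_axis[of x 1]
    by (auto simp: corner_sign mult_less_0_iff)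
  then show ?thesis
    using assms by (simp add: corner_chart_def plane_eq_iff intercept_on_axis g_0)
qed

lemma corner_chart_axis_1:
  assumes "x $ 2 = 0" "0 \<le> x $ 1"
  shows "corner_chart g x = vector [g (x $ 1), 0]"
proof -
  have "intercept 1 x \<le> 0"
    using intercepts_sign[of x] assms intercept_on_axis[of x 2]
    by (auto simp: corner_sign mult_less_0_iff)
  then show ?thesis
    using assms by (simp add: corner_chart_def plane_eq_iff intercept_on_axis)
qed

lemma axis_map_nonneg: "0 \<le> x \<Longrightarrow> 0 \<le> g x"
  using g_mono[of 0 x] g_0 by (cases "x = 0") auto

lemma corner_chart_open_quadrant: "x \<in> open_quadrant \<Longrightarrow> corner_chart g x \<in> open_quadrant"
  using axis_map_nonneg[of "max 0 (intercept 2 x)"]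
  by (auto simp: corner_chart_def open_quadrant_def intro: add_nonneg_pos)

lemma continuous_corner_chart: "continuous_on S (corner_chart g)"
  unfolding corner_chart_def
  by (intro continuous_on_plane continuous_intros continuous_on_compose2[OF g_cont]) auto

lemma corner_chart_orbit_iff:
  assumes "p \<in> open_quadrant" "q \<in> open_quadrant"
  shows "(\<exists>t\<ge>0. q = flow t p) \<longleftrightarrow> (\<exists>r\<ge>0. corner_chart g q = corner_chart g p + r *\<^sub>R (sg :: plane))"
proof (rule chart_orbit_iff[OF _ _ assms])
  let ?l = "\<lambda>x. max 0 (intercept 1 x) - g (max 0 (intercept 2 x))"
  have diff: "corner_chart g x $ 2 - corner_chart g x $ 1 = ?l x" for x
    by (simp add: corner_chart_def)
  have g_inj: "g x = g y \<Longrightarrow> 0 \<le> x \<Longrightarrow> 0 \<le> y \<Longrightarrow> x = y" for x y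
    using g_mono[of x y] g_mono[of y x] by fastforce
  \<comment> \<open>At most one intercept is positive, and the sign of the difference tells which one.\<close>
  have cases: "intercept 1 x = 0 \<and> intercept 2 x = 0 \<and> ?l x = 0
      \<or> intercept 1 x > 0 \<and> intercept 2 x < 0 \<and> ?l x = intercept 1 x
      \<or> intercept 1 x < 0 \<and> intercept 2 x > 0 \<and> ?l x = - g (intercept 2 x)" for x
    using intercepts_sign[of x] by (auto simp: corner_sign mult_less_0_iff g_0)
  show "(\<exists>t. q = flow t p) \<longleftrightarrow>
      sg $ 2 * (corner_chart g q $ 1 - corner_chart g p $ 1) = sg $ 1 * (corner_chart g q $ 2 - corner_chart g p $ 2)"
    (is "_ \<longleftrightarrow> ?R") if "p \<in> open_quadrant" "q \<in> open_quadrant" for p q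
  proof -
    have "?R \<longleftrightarrow> ?l p = ?l q"
      using diff[of p] diff[of q] sg[of 1] by (auto simp: corner)
    also have "\<dots> \<longleftrightarrow> (\<exists>t. q = flow t p)"
    proof
      assume eq: "?l p = ?l q"
      have "intercept 1 p = intercept 1 q \<or> intercept 2 p = intercept 2 q"
        using cases[of p] cases[of q] eq g_inj[of "intercept 2 p" "intercept 2 q"]
          g_mono[of 0 "intercept 2 p"] g_mono[of 0 "intercept 2 q"] g_0 by auto
      then show "\<exists>t. q = flow t p" using intercept_eq_iff by blast
    qed auto
    finally show ?thesis by blast
  qed
  show "0 < sg $ 1 * (corner_chart g (flow t p) $ 1 - corner_chart g p $ 1)"
    if p: "p \<in> open_quadrant" and q: "flow t p \<in> open_quadrant" and "0 < t" for p t
  proof -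
    define q where "q = flow t p"
    have q: "q \<in> open_quadrant" using q by (auto simp: q_def)
    have *: "0 < sg $ 1 * (q $ 1 - p $ 1)" "0 < sg $ 1 * (q $ 2 - p $ 2)"
      using \<open>0 < t\<close> flow_coordinate_pos_iff[of _ t p] corner by (auto simp: q_def) metis
    have "sg $ 1 * (corner_chart g q $ 1 - corner_chart g p $ 1) = sg $ 1 * (q $ 1 * q $ 2 - p $ 1 * p $ 2)"
      by (simp add: corner_chart_def q_def)
    also have "\<dots> = sg $ 1 * (q $ 1 - p $ 1) * q $ 2 + p $ 1 * (sg $ 1 * (q $ 2 - p $ 2))"
      by (simp add: algebra_simps)
    also have "\<dots> > 0"
      using p q by (intro add_pos_pos mult_pos_pos *) (auto simp: open_quadrant_def)
    finally show ?thesis by (simp add: q_def)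
  qed
qed

end

end

section \<open>Gluing the charts of the four quadrants\<close>

definition signs :: "plane set" where
  "signs = {s. \<forall>i. s $ i = 1 \<or> s $ i = -1}"

definition reflect :: "plane \<Rightarrow> plane \<Rightarrow> plane" where
  "reflect s x = (\<chi> i. s $ i * x $ i)"

text \<open>The reflection that moves x into the closed first quadrant. For points on the axes
there are several such reflections; the sign of 0 is taken to be 1.\<close>

definition sign_vector :: "plane \<Rightarrow> plane" where
  "sign_vector x = (\<chi> i. if 0 \<le> x $ i then 1 else - 1)"

definition same_cell :: "plane \<Rightarrow> plane \<Rightarrow> bool" where
  "same_cell p q \<longleftrightarrow> (\<forall>i. sgn (p $ i) = sgn (q $ i))"

lemma reflect_nth [simp]: "reflect s x $ i = s $ i * x $ i"
  by (simp add: reflect_def)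

lemma sign_vector_nth: "sign_vector x $ i = (if 0 \<le> x $ i then 1 else - 1)"
  by (simp add: sign_vector_def)

lemma signs_cases: "s \<in> signs \<Longrightarrow> s $ i = 1 \<or> s $ i = -1"
  by (simp add: signs_def)

lemma signs_mult_self: "s \<in> signs \<Longrightarrow> s $ i * s $ i = 1" "s \<in> signs \<Longrightarrow> s $ i * (s $ i * x) = x"
  using signs_cases[of s i] by auto

lemma sign_vector_in_signs [simp]: "sign_vector x \<in> signs"
  by (simp add: signs_def sign_vector_nth)

lemma reflect_reflect [simp]: "s \<in> signs \<Longrightarrow> reflect s (reflect s x) = x"
  by (simp add: vec_eq_iff signs_mult_self)

lemma reflect_eq_iff: "s \<in> signs \<Longrightarrow> reflect s x = y \<longleftrightarrow> x = reflect s y"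
  by auto

lemma reflect_diff: "reflect s (x - y) = reflect s x - reflect s y"
  by (simp add: vec_eq_iff algebra_simps)

lemma norm_reflect: "s \<in> signs \<Longrightarrow> norm (reflect s x) = norm x"
proof -
  assume s: "s \<in> signs"
  have "(s $ i * x $ i)\<^sup>2 = (x $ i)\<^sup>2" for i
    using signs_cases[OF s, of i] by auto
  then show ?thesis by (simp add: norm_vec_def L2_set_def)
qed

lemma bounded_linear_reflect: "bounded_linear (reflect s)"
  by (rule linear_conv_bounded_linear[THEN iffD1], rule linearI) (auto simp: vec_eq_iff algebra_simps)

lemma same_cell_sign_vector: "same_cell x y \<Longrightarrow> sign_vector x = sign_vector y"
proof -
  assume "same_cell x y"
  then have "0 \<le> x $ i \<longleftrightarrow> 0 \<le> y $ i" for i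
    unfolding same_cell_def by (smt (verit) sgn_if)
  then show ?thesis by (simp add: vec_eq_iff sign_vector_nth)
qed

lemma finite_signs: "finite signs"
proof -
  have "signs \<subseteq> {vector [1, 1], vector [1, -1], vector [-1, 1], vector [-1, -1]}"
    by (auto simp: signs_def forall_plane plane_eq_iff)
  then show ?thesis by (rule finite_subset) simp
qed

lemma reflect_sign_vector: "reflect (sign_vector x) x \<in> closed_quadrant"
  by (simp add: closed_quadrant_def sign_vector_nth)

text \<open>The field in reflected coordinates, through which charts of the first quadrant give
charts of the others.\<close>

definition conjugate :: "plane \<Rightarrow> vfield \<Rightarrow> vfield" where
  "conjugate s F x = reflect s (F (reflect s x))"

lemma lipschitz_field_conjugate:
  assumes "lipschitz_field F K M" "s \<in> signs"
  shows "lipschitz_field (conjugate s F) K M"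
proof -
  interpret lipschitz_field F K M by fact
  show ?thesis
    using K_pos lipschitz norm_bound
    by unfold_locales
      (auto simp: conjugate_def norm_reflect assms simp flip: reflect_diff intro: order_trans[OF lipschitz])
qed

lemma transversal_field_conjugate:
  assumes "transversal_field F K M \<kappa> sg" "s \<in> signs"
  shows "transversal_field (conjugate s F) K M \<kappa> (reflect s sg)"
proof -
  interpret transversal_field F K M \<kappa> sg by fact
  interpret C: lipschitz_field "conjugate s F" K M
    by (rule lipschitz_field_conjugate[OF lipschitz_field_axioms assms(2)])
  have *: "s $ i * y * (s $ i * z) = y * z" for i y z
    using signs_cases[OF assms(2), of i] by auto
  show ?thesis
  proof unfold_locales
    fix i x
    show "reflect s sg $ i = 1 \<or> reflect s sg $ i = -1"
      using sg[of i] signs_cases[OF assms(2), of i] by auto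
    show "\<kappa> \<le> reflect s sg $ i * conjugate s F x $ i"
      using speed by (simp add: conjugate_def *)
  qed (rule speed_pos)
qed

lemma flow_conjugate:
  assumes "lipschitz_field F K M" "s \<in> signs"
  shows "lipschitz_field.flow (conjugate s F) t (reflect s p) = reflect s (lipschitz_field.flow F t p)"
proof -
  interpret lipschitz_field F K M by fact
  interpret C: lipschitz_field "conjugate s F" K M
    by (rule lipschitz_field_conjugate[OF assms])
  have "((\<lambda>t. reflect s (flow t p)) has_vector_derivative conjugate s F (reflect s (flow t p))) (at t)" for t
    using bounded_linear.has_vector_derivative[OF bounded_linear_reflect flow_has_vector_derivative]
    by (simp add: conjugate_def assms)
  then show ?thesis using C.solution_eq_flow[of UNIV 0 t "\<lambda>t. reflect s (flow t p)"] by simp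
qed

definition glue :: "(plane \<Rightarrow> vfield) \<Rightarrow> vfield" where
  "glue f x = reflect (sign_vector x) (f (sign_vector x) (reflect (sign_vector x) x))"

context
  fixes f :: "plane \<Rightarrow> vfield" and g :: "real \<Rightarrow> real \<Rightarrow> real"
  assumes f_cont: "\<And>s. s \<in> signs \<Longrightarrow> continuous_on closed_quadrant (f s)"
    and f_open: "\<And>s x. s \<in> signs \<Longrightarrow> x \<in> open_quadrant \<Longrightarrow> f s x \<in> open_quadrant"
    and f_axis_2: "\<And>s x. s \<in> signs \<Longrightarrow> x $ 1 = 0 \<Longrightarrow> 0 \<le> x $ 2 \<Longrightarrow> f s x = x"
    and f_axis_1: "\<And>s x. s \<in> signs \<Longrightarrow> x $ 2 = 0 \<Longrightarrow> 0 \<le> x $ 1 \<Longrightarrow> f s x = vector [g (s $ 1) (x $ 1), 0]"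
    and f_inj: "\<And>s. s \<in> signs \<Longrightarrow> inj_on (f s) open_quadrant"
    and g_mono: "\<And>s x y. s = 1 \<or> s = -1 \<Longrightarrow> 0 \<le> x \<Longrightarrow> x < y \<Longrightarrow> g s x < g s y"
begin

lemma axis_map_0: "s = 1 \<or> s = -1 \<Longrightarrow> g s 0 = 0"
proof -
  assume "s = 1 \<or> s = -1"
  then have "vector [s, 1] \<in> signs" by (simp add: signs_def forall_plane)
  from f_axis_1[OF this, of 0] f_axis_2[OF this, of 0] show ?thesis
    by (simp add: plane_eq_iff)
qed

lemma axis_map_pos: "s = 1 \<or> s = -1 \<Longrightarrow> 0 < x \<Longrightarrow> 0 < g s x"
  using g_mono[of s 0 x] axis_map_0 by auto

text \<open>Two closed quadrants overlap in a half axis, where the chart is the identity or is given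
by a function of the half axis alone; so it does not matter which of the two charts is used.\<close>

lemma glue_eq:
  assumes s: "s \<in> signs" and x: "reflect s x \<in> closed_quadrant"
  shows "glue f x = reflect s (f s (reflect s x))"
proof (cases "x $ 1 = 0")
  case True
  have "reflect r (f r (reflect r x)) = x" if "r \<in> signs" "reflect r x \<in> closed_quadrant" for r
    using that True by (subst f_axis_2) (auto simp: closed_quadrant_def)
  then show ?thesis
    unfolding glue_def using s x reflect_sign_vector by simp
next
  case x1: False
  then have s1: "s $ 1 = sign_vector x $ 1"
    using signs_cases[OF s, of 1] x by (auto simp: sign_vector_nth closed_quadrant_def)
  show ?thesis
  proof (cases "x $ 2 = 0")
    case True
    have "reflect r (f r (reflect r x)) = vector [r $ 1 * g (r $ 1) (r $ 1 * x $ 1), 0]"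
      if "r \<in> signs" "reflect r x \<in> closed_quadrant" for r
      using that True by (subst f_axis_1) (auto simp: closed_quadrant_def plane_eq_iff)
    then show ?thesis
      unfolding glue_def using s x reflect_sign_vector s1 by simp
  next
    case False
    then have "s $ 2 = sign_vector x $ 2"
      using signs_cases[OF s, of 2] x by (auto simp: sign_vector_nth closed_quadrant_def)
    then have "s = sign_vector x" using s1 by (simp add: plane_eq_iff)
    then show ?thesis by (simp add: glue_def)
  qed
qed

lemma sgn_glue: "sgn (glue f x $ i) = sgn (x $ i)"
proof -
  define s where "s = sign_vector x"
  have s: "s \<in> signs" "reflect s x \<in> closed_quadrant"
    using reflect_sign_vector by (auto simp: s_def)
  have "sgn (f s (reflect s x) $ i) = sgn (reflect s x $ i)"
  proof -
    have "x \<in> open_quadrant \<or> x $ 1 = 0 \<or> x $ 2 = 0" if "x \<in> closed_quadrant" for x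
      using that unfolding closed_quadrant_def open_quadrant_def by auto
    from this[OF s(2)]
    consider "reflect s x $ 1 = 0" | "reflect s x $ 2 = 0" "reflect s x $ 1 \<noteq> 0" | "reflect s x \<in> open_quadrant"
      by blast
    then show ?thesis
    proof cases
      case 1
      then show ?thesis using s by (simp add: f_axis_2 closed_quadrant_def)
    next
      case 2
      then have "0 < reflect s x $ 1"
        using s(2) unfolding closed_quadrant_def by (metis (no_types, lifting) less_le mem_Collect_eq)
      then show ?thesis
        using exhaust_2[of i] 2 s axis_map_pos[OF signs_cases[OF s(1), of 1], of "reflect s x $ 1"]
        by (auto simp: f_axis_1)
    next
      case 3
      then show ?thesis
        using f_open[OF s(1) 3] exhaust_2[of i] by (auto simp: open_quadrant_def)
    qed
  qed
  then have "s $ i * sgn (f s (reflect s x) $ i) = s $ i * (s $ i * sgn (x $ i))"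
    using signs_cases[OF s(1), of i] by (auto simp: sgn_mult)
  then show ?thesis
    using glue_eq[OF s] signs_cases[OF s(1), of i] by (auto simp: sgn_mult)
qed

lemma continuous_glue: "continuous_on UNIV (glue f)"
proof -
  have "continuous_on {x. reflect s x \<in> closed_quadrant} (glue f)" if s: "s \<in> signs" for s
  proof (rule continuous_on_eq)
    show "continuous_on {x. reflect s x \<in> closed_quadrant} (\<lambda>x. reflect s (f s (reflect s x)))"
      by (intro linear_continuous_on[OF bounded_linear_reflect, THEN continuous_on_compose2]
          continuous_on_compose2[OF f_cont[OF s]] linear_continuous_on[OF bounded_linear_reflect]) auto
  qed (use glue_eq[OF s] in auto)
  moreover have "closed {x. reflect s x \<in> closed_quadrant}" for s
  proof -
    have "closed {x. 0 \<le> s $ 1 * x $ 1} \<and> closed {x. 0 \<le> s $ 2 * x $ 2}"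
      by (intro conjI closed_Collect_le continuous_intros)
    then show ?thesis by (auto simp: closed_quadrant_def Collect_conj_eq)
  qed
  ultimately have "continuous_on (\<Union>s\<in>signs. {x. reflect s x \<in> closed_quadrant}) (glue f)"
    by (intro continuous_on_closed_Union finite_signs)
  moreover have "(\<Union>s\<in>signs. {x. reflect s x \<in> closed_quadrant}) = UNIV"
    using reflect_sign_vector sign_vector_in_signs by blast
  ultimately show ?thesis by simp
qed

text \<open>The signs of the coordinates survive gluing, so two points with the same image lie in a
common closed quadrant.\<close>

lemma inj_glue: "inj (glue f)"
proof (rule injI)
  fix x y assume eq: "glue f x = glue f y"
  then have sgn_eq: "sgn (x $ i) = sgn (y $ i)" for i by (metis sgn_glue)
  define s where "s = sign_vector x"
  have "s = sign_vector y"
    using sgn_eq by (auto simp: s_def same_cell_def intro: same_cell_sign_vector)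
  then have s: "s \<in> signs" and x: "reflect s x \<in> closed_quadrant" and y: "reflect s y \<in> closed_quadrant"
    using reflect_sign_vector[of x] reflect_sign_vector[of y] sign_vector_in_signs[of x]
    unfolding s_def by simp_all
  have feq: "f s (reflect s x) = f s (reflect s y)"
    using eq glue_eq[OF s x] glue_eq[OF s y] s by (metis reflect_reflect)
  have zero_iff: "x $ i = 0 \<longleftrightarrow> y $ i = 0" for i
    using sgn_eq[of i] by (metis sgn_eq_0_iff)
  consider "x $ 1 = 0" | "x $ 2 = 0" | "x $ 1 \<noteq> 0" "x $ 2 \<noteq> 0" by blast
  then have "reflect s x = reflect s y"
  proof cases
    case 1
    then show ?thesis using x y feq s zero_iff[of 1] by (simp add: f_axis_2 closed_quadrant_def)
  next
    case 2
    then have "g (s $ 1) (s $ 1 * x $ 1) = g (s $ 1) (s $ 1 * y $ 1)"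
      using x y feq s zero_iff[of 2] by (simp add: f_axis_1 closed_quadrant_def plane_eq_iff)
    moreover have "0 \<le> s $ 1 * x $ 1" "0 \<le> s $ 1 * y $ 1"
      using x y by (auto simp: closed_quadrant_def)
    ultimately have "s $ 1 * x $ 1 = s $ 1 * y $ 1"
      using g_mono[OF signs_cases[OF s, of 1]] by (metis less_irrefl less_linear)
    then show ?thesis using 2 zero_iff[of 2] by (simp add: plane_eq_iff)
  next
    case 3
    then have "s $ i * x $ i \<noteq> 0" "s $ i * y $ i \<noteq> 0" for i
      using zero_iff[of i] signs_cases[OF s, of i] exhaust_2[of i] by auto
    then have "reflect s x \<in> open_quadrant" "reflect s y \<in> open_quadrant"
      using x y by (auto simp: closed_quadrant_def open_quadrant_def less_le)
    then show ?thesis using f_inj[OF s] feq by (auto dest: inj_onD)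
  qed
  then show "x = y" using s by (metis reflect_reflect)
qed

end

text \<open>Both fields are defined on the whole plane here, although each is active in two
quadrants only.\<close>

locale transversal_pair =
  X: transversal_field X K M \<kappa> "vector [a, b]" + Y: transversal_field Y K M \<kappa> "vector [- a, - b]"
  for X Y :: vfield and K M \<kappa> a b :: real
begin

lemma a_b: "a = 1 \<or> a = -1" "b = 1 \<or> b = -1"
  using X.sg[of 1] X.sg[of 2] by auto

definition quadrant_field :: "plane \<Rightarrow> vfield" where
  "quadrant_field s = (if s $ 1 * s $ 2 = 1 then X else Y)"

definition quadrant_direction :: "plane \<Rightarrow> plane" where
  "quadrant_direction s = (if s $ 1 * s $ 2 = 1 then vector [a, b] else vector [- a, - b])"

text \<open>Of the two quadrants adjacent to the half axis of sign \<sigma> on the first axis exactly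
one, that of the signs (\<sigma>, - a b \<sigma>), is of the corner-cutting kind. Its chart prescribes the scale of
the half axis, to which the chart of the other quadrant is adapted.\<close>

definition axis_scale :: "real \<Rightarrow> real \<Rightarrow> real" where
  "axis_scale \<sigma> x = (let s = vector [\<sigma>, - a * b * \<sigma>] in
     transversal_field.intercept (conjugate s (quadrant_field s)) 1 (vector [x, 0]))"

text \<open>In reflected coordinates the two components of the active field have opposite signs
exactly in the quadrants with s $ 2 = - a b s $ 1: for ab = 1 these are the two in which Y is
active, for ab = -1 those in which X is active.\<close>

definition quadrant_chart :: "plane \<Rightarrow> vfield" where
  "quadrant_chart s =
     (let F = conjugate s (quadrant_field s) in
      if s $ 2 = - a * b * s $ 1 then transversal_field.cut_chart F
      else transversal_field.corner_chart F (axis_scale (s $ 1)))"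

lemma quadrant_transversal:
  assumes "s \<in> signs"
  shows "transversal_field (conjugate s (quadrant_field s)) K M \<kappa> (reflect s (quadrant_direction s))"
  by (intro transversal_field_conjugate assms)
    (auto simp: quadrant_field_def quadrant_direction_def X.transversal_field_axioms Y.transversal_field_axioms)

lemma sign_relation:
  assumes "s \<in> signs"
  shows "reflect s (quadrant_direction s) $ 2 =
    (if s $ 2 = - a * b * s $ 1 then - reflect s (quadrant_direction s) $ 1 else reflect s (quadrant_direction s) $ 1)"
  using signs_cases[OF assms, of 1] signs_cases[OF assms, of 2] a_b
  by (auto simp: quadrant_direction_def)

lemma cut_signs: "\<sigma> = 1 \<or> \<sigma> = -1 \<Longrightarrow> vector [\<sigma>, - a * b * \<sigma>] \<in> signs"
  using a_b by (auto simp: signs_def forall_plane)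

lemma axis_scale:
  assumes \<sigma>: "\<sigma> = 1 \<or> \<sigma> = -1"
  shows "continuous_on {0..} (axis_scale \<sigma>)" "axis_scale \<sigma> 0 = 0"
    "0 \<le> x \<Longrightarrow> x < y \<Longrightarrow> axis_scale \<sigma> x < axis_scale \<sigma> y"
proof -
  define s :: plane where "s = vector [\<sigma>, - a * b * \<sigma>]"
  have s: "s \<in> signs" unfolding s_def by (rule cut_signs[OF \<sigma>])
  interpret Q: transversal_field "conjugate s (quadrant_field s)" K M \<kappa> "reflect s (quadrant_direction s)"
    by (rule quadrant_transversal[OF s])
  have eq: "axis_scale \<sigma> = (\<lambda>x. Q.intercept 1 (vector [x, 0]))"
    by (rule ext) (simp add: axis_scale_def s_def Let_def)
  have cut: "reflect s (quadrant_direction s) $ 2 = - reflect s (quadrant_direction s) $ 1"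
    using sign_relation[OF s] by (simp add: s_def)
  show "continuous_on {0..} (axis_scale \<sigma>)"
    unfolding eq by (intro Q.continuous_on_intercept continuous_on_plane continuous_intros)
  show "axis_scale \<sigma> 0 = 0"
    by (simp add: eq Q.intercept_on_axis)
  show "axis_scale \<sigma> x < axis_scale \<sigma> y" if "0 \<le> x" "x < y"
    unfolding eq by (rule Q.intercept_strict_mono_axis[OF cut that])
qed

lemma quadrant_chart:
  assumes s: "s \<in> signs"
  shows "continuous_on closed_quadrant (quadrant_chart s)"
    and "x \<in> open_quadrant \<Longrightarrow> quadrant_chart s x \<in> open_quadrant"
    and "x $ 1 = 0 \<Longrightarrow> 0 \<le> x $ 2 \<Longrightarrow> quadrant_chart s x = x"
    and "x $ 2 = 0 \<Longrightarrow> 0 \<le> x $ 1 \<Longrightarrow> quadrant_chart s x = vector [axis_scale (s $ 1) (x $ 1), 0]"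
    and "p \<in> open_quadrant \<Longrightarrow> q \<in> open_quadrant \<Longrightarrow>
      (\<exists>t\<ge>0. q = lipschitz_field.flow (conjugate s (quadrant_field s)) t p) \<longleftrightarrow>
      (\<exists>r\<ge>0. quadrant_chart s q = quadrant_chart s p + r *\<^sub>R reflect s (quadrant_direction s))"
proof -
  interpret Q: transversal_field "conjugate s (quadrant_field s)" K M \<kappa> "reflect s (quadrant_direction s)"
    by (rule quadrant_transversal[OF s])
  have "continuous_on closed_quadrant (quadrant_chart s) \<and>
    (x \<in> open_quadrant \<longrightarrow> quadrant_chart s x \<in> open_quadrant) \<and>
    (x $ 1 = 0 \<longrightarrow> 0 \<le> x $ 2 \<longrightarrow> quadrant_chart s x = x) \<and>
    (x $ 2 = 0 \<longrightarrow> 0 \<le> x $ 1 \<longrightarrow> quadrant_chart s x = vector [axis_scale (s $ 1) (x $ 1), 0]) \<and>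
    (p \<in> open_quadrant \<longrightarrow> q \<in> open_quadrant \<longrightarrow>
      (\<exists>t\<ge>0. q = Q.flow t p) \<longleftrightarrow>
      (\<exists>r\<ge>0. quadrant_chart s q = quadrant_chart s p + r *\<^sub>R reflect s (quadrant_direction s)))"
  proof (cases "s $ 2 = - a * b * s $ 1")
    case True
    then have eq: "quadrant_chart s = Q.cut_chart" by (simp add: quadrant_chart_def)
    have cut: "reflect s (quadrant_direction s) $ 2 = - reflect s (quadrant_direction s) $ 1"
      using sign_relation[OF s] True by simp
    have s_eq: "vector [s $ 1, - a * b * s $ 1] = s"
      using True by (simp add: plane_eq_iff)
    have scale: "axis_scale (s $ 1) (x $ 1) = Q.intercept 1 x" if "x $ 2 = 0"
    proof -
      have "vector [x $ 1, 0] = x" using that by (simp add: plane_eq_iff)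
      then show ?thesis unfolding axis_scale_def s_eq by (simp add: Let_def)
    qed
    show ?thesis
      unfolding eq
      by (intro conjI impI Q.continuous_cut_chart[OF cut] Q.cut_chart_open_quadrant[OF cut]
          Q.cut_chart_axis_2[OF cut] Q.cut_chart_orbit_iff[OF cut])
        (auto simp: Q.cut_chart_axis_1[OF cut] scale)
  next
    case False
    then have eq: "quadrant_chart s = Q.corner_chart (axis_scale (s $ 1))"
      by (simp add: quadrant_chart_def)
    have corner: "reflect s (quadrant_direction s) $ 2 = reflect s (quadrant_direction s) $ 1"
      using sign_relation[OF s] False by simp
    note g = axis_scale[OF signs_cases[OF s, of 1]]
    show ?thesis
      unfolding eq
      by (intro conjI impI Q.continuous_corner_chart[OF corner g] Q.corner_chart_open_quadrant[OF corner g]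
          Q.corner_chart_axis_2[OF corner g] Q.corner_chart_axis_1[OF corner g] Q.corner_chart_orbit_iff[OF corner g])
  qed
  then show "continuous_on closed_quadrant (quadrant_chart s)"
    and "x \<in> open_quadrant \<Longrightarrow> quadrant_chart s x \<in> open_quadrant"
    and "x $ 1 = 0 \<Longrightarrow> 0 \<le> x $ 2 \<Longrightarrow> quadrant_chart s x = x"
    and "x $ 2 = 0 \<Longrightarrow> 0 \<le> x $ 1 \<Longrightarrow> quadrant_chart s x = vector [axis_scale (s $ 1) (x $ 1), 0]"
    and "p \<in> open_quadrant \<Longrightarrow> q \<in> open_quadrant \<Longrightarrow>
      (\<exists>t\<ge>0. q = lipschitz_field.flow (conjugate s (quadrant_field s)) t p) \<longleftrightarrow>
      (\<exists>r\<ge>0. quadrant_chart s q = quadrant_chart s p + r *\<^sub>R reflect s (quadrant_direction s))"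
    by blast+
qed

lemma inj_quadrant_chart:
  assumes s: "s \<in> signs"
  shows "inj_on (quadrant_chart s) open_quadrant"
proof (rule inj_onI)
  interpret Q: transversal_field "conjugate s (quadrant_field s)" K M \<kappa> "reflect s (quadrant_direction s)"
    by (rule quadrant_transversal[OF s])
  fix p q assume pq: "p \<in> open_quadrant" "q \<in> open_quadrant" "quadrant_chart s p = quadrant_chart s q"
  then have "\<exists>r\<ge>0. quadrant_chart s q = quadrant_chart s p + r *\<^sub>R reflect s (quadrant_direction s)"
    "\<exists>r\<ge>0. quadrant_chart s p = quadrant_chart s q + r *\<^sub>R reflect s (quadrant_direction s)"
    by (auto intro!: exI[of _ 0])
  then obtain t u where t: "0 \<le> t" "q = Q.flow t p" and u: "0 \<le> u" "p = Q.flow u q"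
    using quadrant_chart(5)[OF s] pq by meson
  then have "Q.flow (u + t) p = p" by (metis Q.flow_add)
  then have "u + t = 0" unfolding Q.flow_eq_self_iff .
  then have "t = 0" using t(1) u(1) by linarith
  then show "p = q" using t(2) by simp
qed

definition straighten :: vfield where
  "straighten = glue quadrant_chart"

lemmas glue_rules = quadrant_chart(1-4) inj_quadrant_chart axis_scale(3)

lemma continuous_straighten: "continuous_on UNIV straighten"
  unfolding straighten_def by (rule continuous_glue[of quadrant_chart axis_scale, OF glue_rules])

lemma inj_straighten: "inj straighten"
  unfolding straighten_def by (rule inj_glue[of quadrant_chart axis_scale, OF glue_rules])

lemma sgn_straighten: "sgn (straighten x $ i) = sgn (x $ i)"
  unfolding straighten_def by (rule sgn_glue[of quadrant_chart axis_scale, OF glue_rules])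

lemma straighten_closed_quadrant:
  "s \<in> signs \<Longrightarrow> reflect s x \<in> closed_quadrant \<Longrightarrow>
    straighten x = reflect s (quadrant_chart s (reflect s x))"
  unfolding straighten_def by (rule glue_eq[of quadrant_chart axis_scale, OF glue_rules])

lemma straighten_axis_mono:
  assumes "x $ i = 0" "y $ i = 0" "same_cell x y" "x $ other i < y $ other i"
  shows "straighten x $ other i < straighten y $ other i"
proof -
  define s where "s = sign_vector x"
  have s: "s \<in> signs" by (simp add: s_def)
  have x: "reflect s x \<in> closed_quadrant" unfolding s_def by (rule reflect_sign_vector)
  have y: "reflect s y \<in> closed_quadrant"
    using reflect_sign_vector[of y] same_cell_sign_vector[OF assms(3)] by (simp add: s_def)
  note eqs = straighten_closed_quadrant[OF s x] straighten_closed_quadrant[OF s y]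
  consider "i = 1" | "i = 2" using exhaust_2 by blast
  then show ?thesis
  proof cases
    case 1
    then have "straighten x = x" "straighten y = y"
      using eqs x y assms(1,2) s by (simp_all add: quadrant_chart(3) closed_quadrant_def)
    then show ?thesis using assms by simp
  next
    case 2
    have eq: "straighten x $ 1 = s $ 1 * axis_scale (s $ 1) (s $ 1 * x $ 1)"
      "straighten y $ 1 = s $ 1 * axis_scale (s $ 1) (s $ 1 * y $ 1)"
      using eqs x y assms(1,2) s 2 by (simp_all add: quadrant_chart(4) closed_quadrant_def)
    have "0 \<le> s $ 1 * x $ 1" "0 \<le> s $ 1 * y $ 1" using x y by (simp_all add: closed_quadrant_def)
    then show ?thesis
      using signs_cases[OF s, of 1] 2 assms(4) axis_scale(3)[of 1 "x $ 1" "y $ 1"]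
        axis_scale(3)[of "-1" "- y $ 1" "- x $ 1"]
      by (auto simp: eq)
  qed
qed

lemma straighten_quadrant:
  assumes "p $ 1 \<noteq> 0" "p $ 2 \<noteq> 0"
  defines "s \<equiv> sign_vector p"
  assumes "same_cell p q"
  shows "(\<exists>t\<ge>0. q = lipschitz_field.flow (quadrant_field s) t p) \<longleftrightarrow>
    (\<exists>r\<ge>0. straighten q = straighten p + r *\<^sub>R quadrant_direction s)"
proof -
  have s: "s \<in> signs" by (simp add: s_def)
  have pq: "reflect s p \<in> open_quadrant" "reflect s q \<in> open_quadrant"
  proof -
    have "0 < s $ i * p $ i \<and> 0 < s $ i * q $ i" for i
    proof -
      have "p $ i \<noteq> 0" "sgn (p $ i) = sgn (q $ i)"
        using assms(1,2,4) exhaust_2[of i] by (auto simp: same_cell_def)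
      then show ?thesis by (auto simp: s_def sign_vector_nth sgn_if split: if_splits)
    qed
    then show "reflect s p \<in> open_quadrant" "reflect s q \<in> open_quadrant"
      by (auto simp: open_quadrant_def)
  qed
  then have cl: "reflect s p \<in> closed_quadrant" "reflect s q \<in> closed_quadrant"
    by (auto simp: open_quadrant_def closed_quadrant_def)
  note glue = straighten_closed_quadrant[OF s]
  have lf: "lipschitz_field (quadrant_field s) K M"
    by (simp add: quadrant_field_def X.lipschitz_field_axioms Y.lipschitz_field_axioms)
  have "(\<exists>t\<ge>0. q = lipschitz_field.flow (quadrant_field s) t p) \<longleftrightarrow>
    (\<exists>t\<ge>0. reflect s q = lipschitz_field.flow (conjugate s (quadrant_field s)) t (reflect s p))"
    using s by (metis flow_conjugate[OF lf s] reflect_reflect)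
  also have "\<dots> \<longleftrightarrow> (\<exists>r\<ge>0. quadrant_chart s (reflect s q) = quadrant_chart s (reflect s p) + r *\<^sub>R reflect s (quadrant_direction s))"
    by (rule quadrant_chart(5)[OF s pq])
  also have "\<dots> \<longleftrightarrow> (\<exists>r\<ge>0. straighten q = straighten p + r *\<^sub>R quadrant_direction s)"
  proof -
    have "u = v + r *\<^sub>R reflect s (quadrant_direction s) \<longleftrightarrow>
        reflect s u = reflect s v + r *\<^sub>R quadrant_direction s" for u v r
      using s by (subst reflect_eq_iff[OF s])
        (simp add: linear_add[OF bounded_linear.linear[OF bounded_linear_reflect]]
          linear_cmul[OF bounded_linear.linear[OF bounded_linear_reflect]])
    then show ?thesis by (simp only: glue[OF cl(1)] glue[OF cl(2)])
  qed
  finally show ?thesis .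
qed

lemma straighten_orbit_pos:
  assumes "0 < p $ 1 * p $ 2" "same_cell p q"
  shows "(\<exists>t\<ge>0. q = X.flow t p) \<longleftrightarrow> (\<exists>r\<ge>0. straighten q = straighten p + r *\<^sub>R vector [a, b])"
proof -
  have "p $ 1 \<noteq> 0" "p $ 2 \<noteq> 0" "sign_vector p $ 1 * sign_vector p $ 2 = 1"
    using assms(1) by (auto simp: sign_vector_nth zero_less_mult_iff)
  then show ?thesis
    using straighten_quadrant[OF _ _ assms(2)] by (simp add: quadrant_field_def quadrant_direction_def)
qed

lemma straighten_orbit_neg:
  assumes "p $ 1 * p $ 2 < 0" "same_cell p q"
  shows "(\<exists>t\<ge>0. q = Y.flow t p) \<longleftrightarrow> (\<exists>r\<ge>0. straighten q = straighten p + r *\<^sub>R vector [- a, - b])"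
proof -
  have "p $ 1 \<noteq> 0" "p $ 2 \<noteq> 0" "sign_vector p $ 1 * sign_vector p $ 2 \<noteq> 1"
    using assms(1) by (auto simp: sign_vector_nth mult_less_0_iff)
  then show ?thesis
    using straighten_quadrant[OF _ _ assms(2)] by (simp add: quadrant_field_def quadrant_direction_def)
qed

lemma straighten_0 [simp]: "straighten 0 = 0"
  using sgn_straighten[of 0] by (simp add: plane_eq_iff sgn_eq_0_iff)

lemma straighten_homeomorphism:
  obtains \<Psi> where "homeomorphism UNIV (range straighten) straighten \<Psi>" "open (range straighten)"
  using invariance_of_domain_homeomorphism[OF _ continuous_straighten _ inj_straighten]
    invariance_of_domain[OF continuous_straighten open_UNIV inj_straighten] by auto

end

section \<open>Trajectories as oriented leaves\<close>

text \<open>T is the time along the leaf L and d the motion on L. By the last clause every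
trajectory piece that meets L is a time shift of d, so d is a maximal trajectory, and up to a
shift it is the only one that meets L.\<close>

definition flow_leaf :: "plane set \<Rightarrow> pwfield \<Rightarrow> plane set \<Rightarrow> (plane \<Rightarrow> real) \<Rightarrow> (real \<Rightarrow> plane) \<Rightarrow> bool" where
  "flow_leaf W Z L T d \<longleftrightarrow> trajectory_piece W Z (T ` L) d \<and> (\<forall>x\<in>L. d (T x) = x) \<and>
     (\<forall>I c t\<^sub>0. trajectory_piece W Z I c \<longrightarrow> t\<^sub>0 \<in> I \<longrightarrow> c t\<^sub>0 \<in> L \<longrightarrow>
        (\<forall>t\<in>I. c t \<in> L \<and> T (c t) - T (c t\<^sub>0) = t - t\<^sub>0))"

lemma trajectory_piece_shift:
  assumes "trajectory_piece W Z J d"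
  shows "trajectory_piece W Z ((\<lambda>t. t - k) ` J) (\<lambda>t. d (t + k))"
proof -
  have J: "open J" "is_interval J" "J \<noteq> {}" "continuous_on J d" "d ` J \<subseteq> W"
    and germ: "\<And>t. t \<in> J \<Longrightarrow> trajectory_germ W Z (\<lambda>s. d (t + s))"
    using assms by (auto simp: trajectory_piece_def)
  have "trajectory_germ W Z (\<lambda>s. d (t + s + k))" if "t \<in> (\<lambda>t. t - k) ` J" for t
    using germ[of "t + k"] that by (auto simp: add_ac)
  moreover have "continuous_on ((\<lambda>t. t - k) ` J) (\<lambda>t. d (t + k))"
    by (rule continuous_on_compose2[OF J(4)]) (auto intro!: continuous_intros)
  moreover have "open ((\<lambda>t. t - k) ` J)"
    using open_translation_subtract[OF J(1)] by simp
  moreover have "is_interval ((\<lambda>t. t - k) ` J)"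
    using J(2) by simp
  ultimately show ?thesis
    using J(3,5) unfolding trajectory_piece_def by (intro conjI ballI) (simp_all, force)
qed

lemma trajectory_flow_leaf:
  assumes leaf: "flow_leaf W Z L T d" and "x \<in> L"
  shows "trajectory W Z (T ` L) d"
  unfolding trajectory_def
proof (intro conjI allI impI)
  show "trajectory_piece W Z (T ` L) d" using leaf by (simp add: flow_leaf_def)
  fix J e
  assume J: "trajectory_piece W Z J e \<and> T ` L \<subseteq> J \<and> (\<forall>t\<in>T ` L. e t = d t)"
  have "e (T x) = x" using leaf J \<open>x \<in> L\<close> by (auto simp: flow_leaf_def)
  then have "\<forall>t\<in>J. e t \<in> L \<and> T (e t) - T x = t - T x"
    using leaf conjunct1[OF J] subsetD[OF conjunct1[OF conjunct2[OF J]] imageI[OF \<open>x \<in> L\<close>]] \<open>x \<in> L\<close>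
    unfolding flow_leaf_def by metis
  then have "t = T (e t) \<and> e t \<in> L" if "t \<in> J" for t using that by simp
  then have "J \<subseteq> T ` L" by blast
  then show "J = T ` L" using J by blast
qed

lemma trajectory_in_flow_leaf:
  assumes leaf: "flow_leaf W Z L T d" and traj: "trajectory W Z I c" and "t\<^sub>0 \<in> I" "c t\<^sub>0 \<in> L"
  shows "\<And>t. t \<in> I \<Longrightarrow> c t \<in> L" "\<And>t. t \<in> I \<Longrightarrow> T (c t) - T (c t\<^sub>0) = t - t\<^sub>0" "c ` I = L"
proof -
  have piece: "trajectory_piece W Z I c" using traj by (simp add: trajectory_def)
  then have c: "\<And>t. t \<in> I \<Longrightarrow> c t \<in> L \<and> T (c t) - T (c t\<^sub>0) = t - t\<^sub>0"
    using leaf assms(3,4) unfolding flow_leaf_def by blast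
  \<comment> \<open>The shift between the time along c and the time of the leaf.\<close>
  define k where "k = T (c t\<^sub>0) - t\<^sub>0"
  have T: "T (c t) = t + k" if "t \<in> I" for t
    using c[OF that] by (simp add: k_def)
  have d: "d (t + k) = c t" if "t \<in> I" for t
    using T[OF that] c[OF that] leaf by (metis flow_leaf_def)
  have "I \<subseteq> (\<lambda>t. t - k) ` T ` L"
  proof
    fix t assume "t \<in> I"
    then show "t \<in> (\<lambda>t. t - k) ` T ` L"
      using T c by (intro image_eqI[of _ _ "t + k"] image_eqI[of _ _ "c t"]) auto
  qed
  moreover have "trajectory_piece W Z ((\<lambda>t. t - k) ` T ` L) (\<lambda>t. d (t + k))"
    using leaf by (intro trajectory_piece_shift) (simp add: flow_leaf_def)
  ultimately have I: "(\<lambda>t. t - k) ` T ` L = I"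
    using traj d unfolding trajectory_def by blast
  show "c ` I = L"
  proof
    show "L \<subseteq> c ` I"
    proof
      fix x assume "x \<in> L"
      then have "T x - k \<in> I" using I by blast
      moreover from d[OF this] have "c (T x - k) = x"
        using leaf \<open>x \<in> L\<close> by (simp add: flow_leaf_def)
      ultimately show "x \<in> c ` I" by (metis imageI)
    qed
  qed (use c in blast)
  show "\<And>t. t \<in> I \<Longrightarrow> c t \<in> L" "\<And>t. t \<in> I \<Longrightarrow> T (c t) - T (c t\<^sub>0) = t - t\<^sub>0"
    using c by blast+
qed

definition stationary_origin :: "plane set \<Rightarrow> pwfield \<Rightarrow> bool" where
  "stationary_origin W Z \<longleftrightarrow> trajectory_piece W Z UNIV (\<lambda>_. 0) \<and>
     (\<forall>I c t\<^sub>0. trajectory_piece W Z I c \<longrightarrow> t\<^sub>0 \<in> I \<longrightarrow> c t\<^sub>0 = 0 \<longrightarrow> (\<forall>t\<in>I. c t = 0))"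

text \<open>The time change is the time of the image leaf, read along h \<circ> c. It increases because h
preserves the order in time along the leaves.\<close>

lemma maps_trajectories_if_leaves:
  assumes origin: "stationary_origin W Z" "stationary_origin W' Z'" "h 0 = 0"
    and leaves: "\<And>x. x \<in> W \<Longrightarrow> x \<noteq> 0 \<Longrightarrow> \<exists>L T d T' d'. x \<in> L \<and> flow_leaf W Z L T d \<and>
      flow_leaf W' Z' (h ` L) T' d' \<and> (\<forall>y\<in>L. \<forall>z\<in>L. T y \<le> T z \<longleftrightarrow> T' (h y) \<le> T' (h z))"
  shows "maps_trajectories W Z W' Z' h"
  unfolding maps_trajectories_def
proof (intro allI impI)
  fix I c assume traj: "trajectory W Z I c"
  then have piece: "trajectory_piece W Z I c" by (simp add: trajectory_def)
  then obtain t\<^sub>0 where t\<^sub>0: "t\<^sub>0 \<in> I" "c t\<^sub>0 \<in> W" by (auto simp: trajectory_piece_def)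
  show "\<exists>J d \<tau>. trajectory W' Z' J d \<and> strict_mono_on I \<tau> \<and> \<tau> ` I = J \<and> (\<forall>t\<in>I. h (c t) = d (\<tau> t))"
  proof (cases "c t\<^sub>0 = 0")
    case True
    then have c: "\<forall>t\<in>I. c t = 0" using origin(1) piece t\<^sub>0 unfolding stationary_origin_def by blast
    then have "I = UNIV"
      using traj origin(1) unfolding trajectory_def stationary_origin_def by (metis subset_UNIV)
    moreover have "trajectory W' Z' UNIV (\<lambda>_. 0)"
      using origin(2) by (auto simp: trajectory_def stationary_origin_def)
    ultimately show ?thesis
      using c origin(3) by (intro exI[of _ UNIV] exI[of _ "\<lambda>_. 0"] exI[of _ id]) (auto simp: strict_mono_on_def)
  next
    case False
    obtain L T d T' d' where L: "c t\<^sub>0 \<in> L" "flow_leaf W Z L T d" "flow_leaf W' Z' (h ` L) T' d'"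
      and ord: "\<And>y z. y \<in> L \<Longrightarrow> z \<in> L \<Longrightarrow> T y \<le> T z \<longleftrightarrow> T' (h y) \<le> T' (h z)"
      using leaves[OF t\<^sub>0(2) False] by blast
    note c = trajectory_in_flow_leaf[OF L(2) traj t\<^sub>0(1) L(1)]
    have "strict_mono_on I (\<lambda>t. T' (h (c t)))"
    proof (rule strict_mono_onI)
      fix r s assume "r \<in> I" "s \<in> I" "r < s"
      then have "\<not> T (c s) \<le> T (c r)" using c(2)[of r] c(2)[of s] by linarith
      then show "T' (h (c r)) < T' (h (c s))"
        using ord[of "c s" "c r"] c(1) \<open>r \<in> I\<close> \<open>s \<in> I\<close> by force
    qed
    moreover have "(\<lambda>t. T' (h (c t))) ` I = T' ` h ` L"
      using c(3) by (auto simp: image_image)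
    moreover have "h (c t) = d' (T' (h (c t)))" if "t \<in> I" for t
      using L(3) c(1)[OF that] unfolding flow_leaf_def by auto
    moreover have "trajectory W' Z' (T' ` h ` L) d'"
      using trajectory_flow_leaf[OF L(3)] L(1) by blast
    ultimately show ?thesis by blast
  qed
qed

lemma eventually_nhds_shift: "(\<forall>\<^sub>F s in nhds 0. P (t + s)) \<longleftrightarrow> (\<forall>\<^sub>F s in nhds t. P s)" for t :: real
proof -
  have "nhds t = filtermap (\<lambda>s. s + t) (nhds 0)"
    using filtermap_nhds_shift[of "- t" 0] by simp
  then show ?thesis by (simp add: eventually_filtermap add.commute)
qed

lemma solves_at_shift: "solves_at F (\<lambda>s. c (t + s)) s \<longleftrightarrow> solves_at F c (t + s)"
proof -
  have sh: "((\<lambda>s. c (k + s)) has_vector_derivative D) (at s)"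
    if "(c has_vector_derivative D) (at (k + s))" for c k s and D :: plane
  proof -
    have "((+) k has_vector_derivative 1) (at s)"
      unfolding has_real_derivative_iff_has_vector_derivative[symmetric]
      by (auto intro!: derivative_eq_intros)
    from vector_diff_chain_at[OF this that] show ?thesis by (simp add: o_def)
  qed
  show ?thesis
    unfolding solves_at_def using sh[where k=t] sh[where k="- t" and s="t + s" and c="\<lambda>s. c (t + s)"] by auto
qed

text \<open>The time along an orbit of a scalar field S is an antiderivative of 1 / S. The interval
V is open because the sliding fields vanish at the origin in the degenerate case, where the time
becomes infinite.\<close>

lemma scalar_time_function:
  fixes S :: "real \<Rightarrow> real" and V :: "real set"
  assumes V: "open V" "is_interval V" "bounded V" and cont: "continuous_on V S"
    and \<sigma>: "\<sigma> = 1 \<or> \<sigma> = -1" and pos: "\<And>y. y \<in> V \<Longrightarrow> 0 < \<sigma> * S y"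
  obtains T d where "\<And>y. y \<in> V \<Longrightarrow> (T has_real_derivative 1 / S y) (at y)"
    "\<And>y. y \<in> V \<Longrightarrow> d (T y) = y"
    "\<And>y. y \<in> V \<Longrightarrow> (d has_real_derivative S y) (at (T y))"
    "\<And>x y. x \<in> V \<Longrightarrow> y \<in> V \<Longrightarrow> T x \<le> T y \<longleftrightarrow> \<sigma> * x \<le> \<sigma> * y"
    "open (T ` V)" "is_interval (T ` V)"
proof (cases "V = {}")
  case True
  then show ?thesis using that by simp
next
  case False
  define p q where "p = Inf V" and "q = Sup V"
  have bdd: "bdd_above V" "bdd_below V" using V(3) by (simp_all add: bounded_imp_bdd_above bounded_imp_bdd_below)
  have in_O: "y \<in> V" if "p < y" "y < q" for y
  proof -
    have "\<exists>x\<in>V. x < y" "\<exists>z\<in>V. y < z"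
      using that False bdd cInf_less_iff[of V y] less_cSup_iff[of V y] unfolding p_def q_def by auto
    then obtain x z where "x \<in> V" "x < y" "z \<in> V" "y < z" by blast
    then show ?thesis using V(2) unfolding is_interval_1 by (meson less_imp_le)
  qed
  have O_in: "p < y \<and> y < q" if "y \<in> V" for y
  proof -
    obtain e where "e > 0" "ball y e \<subseteq> V" using openE[OF V(1) \<open>y \<in> V\<close>] by metis
    then have "y - e/2 \<in> ball y e" "y + e/2 \<in> ball y e" by (simp_all add: dist_real_def)
    then have "y - e/2 \<in> V" "y + e/2 \<in> V" using \<open>ball y e \<subseteq> V\<close> by blast+
    then have "p \<le> y - e/2" "y + e/2 \<le> q"
      unfolding p_def q_def using bdd by (simp_all only: cInf_lower cSup_upper)
    then show ?thesis using \<open>e > 0\<close> by linarith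
  qed
  have nz: "S y \<noteq> 0" if "y \<in> V" for y using pos[OF that] by auto
  have "p < q" using False O_in by fastforce
  then have "\<exists>T. \<forall>x. ereal p < ereal x \<longrightarrow> ereal x < ereal q \<longrightarrow> (T has_vector_derivative 1 / S x) (at x)"
    using in_O cont V(1) nz
    by (intro einterval_antiderivative) (auto simp: continuous_on_eq_continuous_at intro!: continuous_intros)
  then obtain T where T: "\<And>y. y \<in> V \<Longrightarrow> (T has_real_derivative 1 / S y) (at y)"
    using O_in by (auto simp: has_real_derivative_iff_has_vector_derivative)
  have less: "\<sigma> * T x < \<sigma> * T y" if "x \<in> V" "y \<in> V" "x < y" for x y
  proof (rule DERIV_pos_imp_increasing[OF that(3)])
    fix z assume "x \<le> z" "z \<le> y"
    then have z: "z \<in> V" using V(2) that unfolding is_interval_1 by blast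
    have "0 < \<sigma> * (1 / S z)" using pos[OF z] \<sigma> by (auto simp: zero_less_mult_iff)
    then show "\<exists>D. ((\<lambda>z. \<sigma> * T z) has_real_derivative D) (at z) \<and> 0 < D"
      using T[OF z] by (intro exI[of _ "\<sigma> * (1 / S z)"] conjI DERIV_cmult)
  qed
  have le: "T x \<le> T y \<longleftrightarrow> \<sigma> * x \<le> \<sigma> * y" if "x \<in> V" "y \<in> V" for x y
    using less[OF that] less[OF that(2,1)] \<sigma> by (cases x y rule: linorder_cases) auto
  have inj: "inj_on T V"
  proof (rule inj_onI)
    fix x y assume "x \<in> V" "y \<in> V" "T x = T y"
    then show "x = y" using le[of x y] le[of y x] \<sigma> by auto
  qed
  define d where "d = inv_into V T"
  have d: "d (T y) = y" if "y \<in> V" for y using inj that by (simp add: d_def)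
  have cT: "continuous_on V T"
    using T by (auto intro!: continuous_at_imp_continuous_on DERIV_isCont)
  have "(d has_real_derivative S y) (at (T y))" if "y \<in> V" for y
    using has_field_derivative_inverse_strong[OF T[OF that] _ V(1) that cT d] nz[OF that] by simp
  moreover have "open (T ` V)" by (rule invariance_of_domain[OF cT V(1) inj])
  moreover have "is_interval (T ` V)"
    using connected_continuous_image[OF cT] V(2) by (simp add: is_interval_connected_1)
  ultimately show ?thesis using that T d le by blast
qed

section \<open>Germs of trajectories near the origin\<close>

lemma bounded_linear_axis: "bounded_linear (\<lambda>y. axis j y :: plane)"
  by (rule linear_conv_bounded_linear[THEN iffD1], rule linearI) (auto simp: vec_eq_iff axis_def)

lemma norm_axis: "norm (axis j y :: plane) = \<bar>y\<bar>"
proof -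
  have "(axis j y :: plane) = y *\<^sub>R axis j 1" by (simp add: vec_eq_iff axis_def)
  then show ?thesis by simp
qed

lemma axis_other_eq: "x $ i = 0 \<Longrightarrow> axis (other i) (x $ other i) = (x::plane)"
  by (rule plane_eqI_other[of _ i]) (auto simp: axis_def)

lemma same_cell_refl [simp]: "same_cell x x"
  and same_cell_sym: "same_cell x y \<Longrightarrow> same_cell y x"
  and same_cell_trans: "same_cell x y \<Longrightarrow> same_cell y z \<Longrightarrow> same_cell x z"
  by (auto simp: same_cell_def)

lemma same_cell_zero_iff: "same_cell x y \<Longrightarrow> x $ i = 0 \<longleftrightarrow> y $ i = 0"
  unfolding same_cell_def by (metis sgn_eq_0_iff)

lemma same_cell_eq_0_iff: "same_cell x y \<Longrightarrow> x = 0 \<longleftrightarrow> y = 0"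
  using same_cell_zero_iff[of x y 1] same_cell_zero_iff[of x y 2] by (simp add: plane_eq_iff)

lemma same_cell_sgn_mult: "same_cell x y \<Longrightarrow> sgn (x $ 1 * x $ 2) = sgn (y $ 1 * y $ 2)"
  by (simp add: same_cell_def sgn_mult)

lemma same_cell_mult_pos_iff:
  assumes "same_cell x y"
  shows "0 < x $ 1 * x $ 2 \<longleftrightarrow> 0 < y $ 1 * y $ 2" "x $ 1 * x $ 2 < 0 \<longleftrightarrow> y $ 1 * y $ 2 < 0"
  using same_cell_sgn_mult[OF assms] by (metis sgn_greater sgn_less)+

lemma sgn_convex_combination:
  fixes x y z :: real
  assumes "sgn x = z" "sgn y = z" "0 \<le> \<alpha>" "0 \<le> \<beta>" "\<alpha> + \<beta> = 1"
  shows "sgn (\<alpha> * x + \<beta> * y) = z"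
proof -
  have pos: "0 < \<alpha> * x + \<beta> * y" if "0 < x" "0 < y" for x y
  proof -
    have "\<alpha> * min x y + \<beta> * min x y \<le> \<alpha> * x + \<beta> * y"
      using assms by (intro add_mono mult_left_mono) auto
    moreover have "\<alpha> * min x y + \<beta> * min x y = min x y"
      using assms(5) by (simp flip: distrib_right)
    ultimately show ?thesis using that by linarith
  qed
  have "0 < x \<and> 0 < y \<or> x = 0 \<and> y = 0 \<or> x < 0 \<and> y < 0"
    using assms(1,2) by (auto simp: sgn_if split: if_splits)
  then show ?thesis
    using pos[of x y] pos[of "- x" "- y"] assms(1) by (auto simp: sgn_if)
qed

lemma convex_cell: "convex {x. same_cell u x}"
  by (rule convexI) (auto simp: same_cell_def intro!: sgn_convex_combination[symmetric])

lemma same_cell_between: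
  assumes x: "same_cell u x" and z: "same_cell u z" and s: "s \<in> signs"
    and "\<And>i. s $ i * x $ i \<le> s $ i * y $ i" "\<And>i. s $ i * y $ i \<le> s $ i * z $ i"
  shows "same_cell u y"
proof -
  have "sgn (y $ i) = sgn (u $ i)" for i
  proof -
    have "x $ i \<le> y $ i \<and> y $ i \<le> z $ i \<or> z $ i \<le> y $ i \<and> y $ i \<le> x $ i"
      using assms(4,5)[of i] signs_cases[OF s, of i] by auto
    moreover have "sgn (x $ i) = sgn (u $ i)" "sgn (z $ i) = sgn (u $ i)"
      using x z by (auto simp: same_cell_def)
    ultimately show ?thesis
      by (cases "u $ i" "0::real" rule: linorder_cases) (auto simp: sgn_1_pos sgn_1_neg sgn_0_0)
  qed
  then show ?thesis by (simp add: same_cell_def)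
qed

lemma eventually_sgn_eq:
  fixes f :: "'a::t2_space \<Rightarrow> real"
  assumes "isCont f x" "f x \<noteq> 0"
  shows "\<forall>\<^sub>F y in nhds x. sgn (f y) = sgn (f x)"
proof -
  have lim: "(f \<longlongrightarrow> f x) (nhds x)"
    using assms(1) by (simp add: continuous_at tendsto_at_iff_tendsto_nhds)
  show ?thesis
  proof (cases "0 < f x")
    case True
    then show ?thesis using order_tendstoD(1)[OF lim, of 0] by (auto elim: eventually_mono)
  next
    case False
    then show ?thesis using order_tendstoD(2)[OF lim, of 0] assms(2) by (auto elim!: eventually_mono)
  qed
qed

text \<open>The direction of the straightened trajectories in the cell of u, which is an open
quadrant or an open half axis; e is the sign of det Z on the half axes.\<close>

definition cell_direction :: "real \<Rightarrow> real \<Rightarrow> (plane \<Rightarrow> real) \<Rightarrow> plane \<Rightarrow> plane" where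
  "cell_direction a b e u =
     (if 0 < u $ 1 * u $ 2 then vector [a, b]
      else if u $ 1 * u $ 2 < 0 then vector [- a, - b]
      else if u $ 1 = 0 then vector [0, a * e u]
      else vector [- b * e u, 0])"

text \<open>The fields X and Y extend the two parts of Z from a ball to the whole plane. The signs a,
b and the function e are the data that determine the germ of Z up to local equivalence.\<close>

locale local_type = transversal_pair X Y K M \<kappa> a b
  for X Y :: vfield and K M \<kappa> a b :: real +
  fixes Z :: pwfield and \<rho> :: real and e :: "plane \<Rightarrow> real"
  assumes radius_pos: "0 < \<rho>"
    and field_eq: "p \<in> ball 0 \<rho> \<Longrightarrow> fst Z p = X p" "p \<in> ball 0 \<rho> \<Longrightarrow> snd Z p = Y p"
    and det_sign: "p \<in> ball 0 \<rho> \<Longrightarrow> p $ i = 0 \<Longrightarrow> p \<noteq> 0 \<Longrightarrow> 0 < e p * detZ Z p"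
    and e_sign: "p $ i = 0 \<Longrightarrow> p \<noteq> 0 \<Longrightarrow> e p = 1 \<or> e p = -1"
    and e_cell: "same_cell p q \<Longrightarrow> e p = e q"
begin

lemma field_signs:
  shows "0 < a * X p $ 1" "0 < b * X p $ 2" "a * Y p $ 1 < 0" "b * Y p $ 2 < 0"
  using X.speed[of 1 p] X.speed[of 2 p] Y.speed[of 1 p] Y.speed[of 2 p] X.speed_pos by auto

text \<open>The sliding field is det Z divided by X_1 - Y_1 on the line x_1 = 0 and by Y_2 - X_2 on
the line x_2 = 0; these denominators have the signs a and - b.\<close>

lemma sliding_component_sign:
  assumes p: "p \<in> ball 0 \<rho>" "p $ i = 0" "p \<noteq> 0"
  shows "0 < cell_direction a b e p $ other i * sliding_field Z i p $ other i"
proof -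
  note det = det_sign[OF p] and f = field_eq[OF p(1)] and s = field_signs[of p]
  have z: "p $ 1 * p $ 2 = 0" using p(2) exhaust_2[of i] by auto
  consider "i = 1" | "i = 2" using exhaust_2 by blast
  then show ?thesis
  proof cases
    case 1
    have "sliding_field Z i p $ 2 = detZ Z p / (X p $ 1 - Y p $ 1)"
    proof -
      have "(Y p $ 1 * X p $ 2 - X p $ 1 * Y p $ 2) / (Y p $ 1 - X p $ 1) =
          (X p $ 1 * Y p $ 2 - X p $ 2 * Y p $ 1) / (X p $ 1 - Y p $ 1)"
        by (subst minus_divide_divide[symmetric]) (simp add: algebra_simps)
      then show ?thesis
        using f 1 by (simp add: sliding_field_def detZ_def Let_def axis_def)
    qed
    moreover have "0 < a * (X p $ 1 - Y p $ 1)" using s by (simp add: algebra_simps)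
    then have "0 < a / (X p $ 1 - Y p $ 1)" by (simp add: zero_less_mult_iff zero_less_divide_iff)
    then have "0 < (e p * detZ Z p) * (a / (X p $ 1 - Y p $ 1))"
      by (rule mult_pos_pos[OF det])
    ultimately show ?thesis
      using 1 z p(2) by (simp add: cell_direction_def mult_ac)
  next
    case 2
    then have "p $ 1 \<noteq> 0" using p by (auto simp: plane_eq_iff)
    have "sliding_field Z i p $ 1 = detZ Z p / (Y p $ 2 - X p $ 2)"
      using f 2 by (simp add: sliding_field_def detZ_def Let_def axis_def mult.commute)
    moreover have "0 < (- b) * (Y p $ 2 - X p $ 2)" using s by (simp add: algebra_simps)
    then have "0 < - b / (Y p $ 2 - X p $ 2)" unfolding zero_less_mult_iff zero_less_divide_iff .
    then have "0 < (e p * detZ Z p) * (- b / (Y p $ 2 - X p $ 2))"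
      by (rule mult_pos_pos[OF det])
    ultimately show ?thesis
      using 2 z \<open>p $ 1 \<noteq> 0\<close> by (simp add: cell_direction_def mult_ac)
  qed
qed

lemma cell_direction_axis:
  assumes "p $ i = 0" "p \<noteq> 0"
  shows "cell_direction a b e p $ i = 0"
    "cell_direction a b e p $ other i = 1 \<or> cell_direction a b e p $ other i = -1"
proof -
  have z: "p $ 1 * p $ 2 = 0" using assms exhaust_2[of i] by auto
  have "p $ 1 \<noteq> 0 \<or> i = 1" using assms exhaust_2[of i] by (auto simp: plane_eq_iff)
  then show "cell_direction a b e p $ i = 0"
    "cell_direction a b e p $ other i = 1 \<or> cell_direction a b e p $ other i = -1"
    using z assms exhaust_2[of i] e_sign[OF assms] a_b by (auto simp: cell_direction_def)
qed

lemma cell_direction_cong: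
  assumes "same_cell u x"
  shows "cell_direction a b e u = cell_direction a b e x"
  using same_cell_mult_pos_iff[OF assms] same_cell_zero_iff[OF assms, of 1] e_cell[OF assms]
  by (simp add: cell_direction_def)

end

text \<open>The neighbourhood W of the origin is chosen through its straightened image, a ball.
As the ball and the cells are convex, W contains a connected part of each cell and of each orbit
in it.\<close>

locale straightened = local_type +
  fixes \<epsilon> :: real
  assumes eps_pos: "0 < \<epsilon>" and ball_subset: "ball 0 \<epsilon> \<subseteq> straighten ` ball 0 \<rho>"
begin

definition W :: "plane set" where
  "W = {x. straighten x \<in> ball 0 \<epsilon>}"

definition unstraighten :: vfield where
  "unstraighten = inv straighten"

lemma unstraighten_straighten [simp]: "unstraighten (straighten x) = x"
  by (simp add: unstraighten_def inv_f_f[OF inj_straighten])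

lemma straighten_unstraighten [simp]: "u \<in> ball 0 \<epsilon> \<Longrightarrow> straighten (unstraighten u) = u"
  unfolding unstraighten_def using ball_subset by (intro f_inv_into_f) blast

lemma W_subset: "W \<subseteq> ball 0 \<rho>"
proof
  fix x assume "x \<in> W"
  then obtain y where "y \<in> ball 0 \<rho>" "straighten x = straighten y"
    using ball_subset unfolding W_def by blast
  then show "x \<in> ball 0 \<rho>" by (metis unstraighten_straighten)
qed

lemma open_W: "open W"
  using open_vimage[OF open_ball continuous_straighten, of 0 \<epsilon>] by (simp add: W_def vimage_def)

lemma zero_in_W: "0 \<in> W"
  using eps_pos by (simp add: W_def)

lemma unstraighten_in_W: "u \<in> ball 0 \<epsilon> \<Longrightarrow> unstraighten u \<in> W"
  by (simp add: W_def)

lemma continuous_unstraighten: "continuous_on (ball 0 \<epsilon>) unstraighten"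
proof -
  obtain \<Psi> where h: "homeomorphism UNIV (range straighten) straighten \<Psi>"
    using straighten_homeomorphism by blast
  have sub: "ball 0 \<epsilon> \<subseteq> range straighten" using ball_subset by blast
  show ?thesis
  proof (rule continuous_on_eq)
    show "continuous_on (ball 0 \<epsilon>) \<Psi>"
      using h sub by (meson continuous_on_subset homeomorphism_def)
    show "\<Psi> u = unstraighten u" if u: "u \<in> ball 0 \<epsilon>" for u
    proof -
      have "\<Psi> (straighten (unstraighten u)) = unstraighten u"
        using h unfolding homeomorphism_def by blast
      then show ?thesis by (simp only: straighten_unstraighten[OF u])
    qed
  qed
qed

lemma homeomorphism_straighten: "homeomorphism W (ball 0 \<epsilon>) straighten unstraighten"
  unfolding homeomorphism_def
proof (intro conjI ballI)
  show "straighten ` W = ball 0 \<epsilon>"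
  proof
    show "ball 0 \<epsilon> \<subseteq> straighten ` W"
    proof
      fix u :: plane assume u: "u \<in> ball 0 \<epsilon>"
      show "u \<in> straighten ` W"
        by (rule image_eqI[where f=straighten, OF straighten_unstraighten[OF u, symmetric] unstraighten_in_W[OF u]])
    qed
  qed (auto simp: W_def)
  show "unstraighten ` ball 0 \<epsilon> = W"
  proof
    show "W \<subseteq> unstraighten ` ball 0 \<epsilon>"
    proof
      fix x assume "x \<in> W"
      then have "unstraighten (straighten x) \<in> unstraighten ` ball 0 \<epsilon>"
        unfolding W_def by blast
      then show "x \<in> unstraighten ` ball 0 \<epsilon>" by simp
    qed
  qed (use unstraighten_in_W in blast)
qed (simp_all add: continuous_on_subset[OF continuous_straighten] continuous_unstraighten)

lemma same_cell_straighten: "same_cell x (straighten x)"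
  by (simp add: same_cell_def sgn_straighten)

lemma same_cell_unstraighten: "u \<in> ball 0 \<epsilon> \<Longrightarrow> same_cell u (unstraighten u)"
  using same_cell_straighten[of "unstraighten u"] same_cell_sym by simp

lemma Z_on_W: "p \<in> W \<Longrightarrow> fst Z p = X p" "p \<in> W \<Longrightarrow> snd Z p = Y p"
  using W_subset field_eq by blast+

lemma component_signs:
  obtains s where "s = 1 \<or> s = -1" "\<And>p. p \<in> W \<Longrightarrow> 0 < s * fst Z p $ i" "\<And>p. p \<in> W \<Longrightarrow> s * snd Z p $ i < 0"
proof -
  consider "i = 1" | "i = 2" using exhaust_2 by blast
  then show ?thesis
    by cases (rule that[of a] that[of b]; use field_signs a_b Z_on_W in simp)+
qed

lemma crossing_empty: "crossing W Z i = {}"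
proof -
  obtain s where "s = 1 \<or> s = -1" "\<And>p. p \<in> W \<Longrightarrow> 0 < s * fst Z p $ i" "\<And>p. p \<in> W \<Longrightarrow> s * snd Z p $ i < 0"
    using component_signs by blast
  then have "fst Z p $ i * snd Z p $ i < 0" if "p \<in> W" for p
    using that by (fastforce simp: mult_less_0_iff)
  then show ?thesis
    by (auto simp: crossing_def Sigma_comp_def dest: less_asym)
qed

lemma sliding_escaping_halves:
  "sliding W Z i = Sigma_plus W i \<and> escaping W Z i = Sigma_minus W i \<or>
   sliding W Z i = Sigma_minus W i \<and> escaping W Z i = Sigma_plus W i"
proof -
  obtain s where "s = 1 \<or> s = -1" and s: "\<And>p. p \<in> W \<Longrightarrow> 0 < s * fst Z p $ i" "\<And>p. p \<in> W \<Longrightarrow> s * snd Z p $ i < 0"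
    using component_signs by blast
  then consider "\<And>p. p \<in> W \<Longrightarrow> 0 < fst Z p $ i \<and> snd Z p $ i < 0" | "\<And>p. p \<in> W \<Longrightarrow> fst Z p $ i < 0 \<and> 0 < snd Z p $ i"
    by fastforce
  then show ?thesis
  proof cases
    case 1
    then show ?thesis
      by (intro disjI2) (fastforce simp: sliding_def escaping_def Sigma_plus_def Sigma_minus_def Sigma_comp_def)
  next
    case 2
    then show ?thesis
      by (intro disjI1) (fastforce simp: sliding_def escaping_def Sigma_plus_def Sigma_minus_def Sigma_comp_def)
  qed
qed

lemma sliding_Un_escaping: "sliding W Z i \<union> escaping W Z i = {p \<in> W. p $ i = 0 \<and> p \<noteq> 0}"
proof -
  have "sliding W Z i \<union> escaping W Z i = Sigma_plus W i \<union> Sigma_minus W i"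
    using sliding_escaping_halves[of i] by blast
  also have "\<dots> = {p \<in> W. p $ i = 0 \<and> p \<noteq> 0}"
    using plane_eqI_other[of _ i 0]
    by (fastforce simp: Sigma_plus_def Sigma_minus_def Sigma_comp_def)
  finally show ?thesis .
qed

text \<open>The two open halves of an axis are disjoint and open in it, so only the origin can be
a frontier point of one of them.\<close>

lemma frontier_halves:
  assumes "p \<in> top_of_set (Sigma_comp W i) frontier_of S" "S = Sigma_plus W i \<or> S = Sigma_minus W i"
  shows "p = 0"
proof (rule ccontr)
  assume "p \<noteq> 0"
  let ?T = "top_of_set (Sigma_comp W i)"
  have p: "p \<in> Sigma_comp W i"
    using assms(1) frontier_of_subset_topspace[of ?T S] by auto
  then have "p $ other i \<noteq> 0"
    using \<open>p \<noteq> 0\<close> plane_eqI_other[of p i 0] by (auto simp: Sigma_comp_def)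
  then have mem: "p \<in> Sigma_plus W i \<or> p \<in> Sigma_minus W i"
    using p by (auto simp: Sigma_plus_def Sigma_minus_def)
  have eqs: "Sigma_plus W i = Sigma_comp W i \<inter> {x. 0 < x $ other i}"
    "Sigma_minus W i = Sigma_comp W i \<inter> {x. x $ other i < 0}"
    by (auto simp: Sigma_plus_def Sigma_minus_def)
  have "open {x::plane. 0 < x $ other i}" "open {x::plane. x $ other i < 0}"
    by (intro open_Collect_less continuous_intros)+
  then have op: "openin ?T (Sigma_plus W i)" "openin ?T (Sigma_minus W i)"
    unfolding eqs by (simp_all add: openin_open_Int)
  have disj: "Sigma_plus W i \<inter> Sigma_minus W i = {}"
    by (auto simp: Sigma_plus_def Sigma_minus_def)
  have notin: "p \<notin> ?T frontier_of S" if "openin ?T A" "openin ?T S" "p \<in> A" "A \<inter> S = {} \<or> A = S" for A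
  proof (cases "A = S")
    case True
    then show ?thesis using that by (simp add: frontier_of_def interior_of_openin)
  next
    case False
    then have "\<not> p \<in> ?T closure_of S" using that unfolding in_closure_of by blast
    then show ?thesis by (simp add: frontier_of_def)
  qed
  show False using assms mem op disj notin by blast
qed

lemma not_boundary_germ: "\<not> boundary_germ W Z c"
proof
  assume "boundary_germ W Z c"
  then obtain i where "c 0 \<noteq> 0" "c 0 \<in> top_of_set (Sigma_comp W i) frontier_of crossing W Z i \<union>
              top_of_set (Sigma_comp W i) frontier_of sliding W Z i \<union>
              top_of_set (Sigma_comp W i) frontier_of escaping W Z i"
    unfolding boundary_germ_def by blast
  then show False
    using frontier_halves[of "c 0" i] sliding_escaping_halves[of i] by (auto simp: crossing_empty)
qed

text \<open>The germs of trajectories in W, where the crossing region is empty and the sliding and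
escaping regions make up the axes without the origin.\<close>

definition simple_germ :: "(real \<Rightarrow> plane) \<Rightarrow> bool" where
  "simple_germ c \<longleftrightarrow>
     (\<forall>\<^sub>F s in nhds 0. c s \<in> W \<and> 0 < c s $ 1 * c s $ 2 \<and> solves_at X c s) \<or>
     (\<forall>\<^sub>F s in nhds 0. c s \<in> W \<and> c s $ 1 * c s $ 2 < 0 \<and> solves_at Y c s) \<or>
     (\<exists>i. \<forall>\<^sub>F s in nhds 0. c s \<in> W \<and> c s $ i = 0 \<and> c s \<noteq> 0 \<and> solves_at (sliding_field Z i) c s) \<or>
     (\<forall>\<^sub>F s in nhds 0. c s = 0)"

lemma zero_in_closure_sliding: "0 \<in> closure (escaping W Z i \<union> sliding W Z i)"
  unfolding closure_approachable
proof (intro allI impI)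
  fix r :: real assume "0 < r"
  obtain r' where r': "0 < r'" "ball 0 r' \<subseteq> W" using open_W zero_in_W openE by metis
  define p :: plane where "p = axis (other i) (min r r' / 2)"
  have "norm p = min r r' / 2" using \<open>0 < r\<close> r' by (simp add: p_def norm_axis)
  then have "p \<in> ball 0 r'" "dist p 0 < r" "p \<noteq> 0" "p $ i = 0"
    using \<open>0 < r\<close> r' by (auto simp: p_def axis_def)
  then show "\<exists>y\<in>escaping W Z i \<union> sliding W Z i. dist y 0 < r"
    using r' sliding_Un_escaping[of i] by (intro bexI[of _ p]) auto
qed

lemma assigned_germ_iff: "assigned_germ W Z c \<longleftrightarrow> simple_germ c"
proof -
  have pos: "c s \<in> pos_part W \<and> solves_at (fst Z) c s \<longleftrightarrow> c s \<in> W \<and> 0 < c s $ 1 * c s $ 2 \<and> solves_at X c s" for s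
    by (auto simp: pos_part_def solves_at_def Z_on_W)
  have neg: "c s \<in> neg_part W \<and> solves_at (snd Z) c s \<longleftrightarrow> c s \<in> W \<and> c s $ 1 * c s $ 2 < 0 \<and> solves_at Y c s" for s
    by (auto simp: neg_part_def solves_at_def Z_on_W)
  have "regular_germ W Z c \<longleftrightarrow>
     (\<forall>\<^sub>F s in nhds 0. c s \<in> W \<and> 0 < c s $ 1 * c s $ 2 \<and> solves_at X c s) \<or>
     (\<forall>\<^sub>F s in nhds 0. c s \<in> W \<and> c s $ 1 * c s $ 2 < 0 \<and> solves_at Y c s) \<or>
     (\<exists>i. \<forall>\<^sub>F s in nhds 0. c s \<in> W \<and> c s $ i = 0 \<and> c s \<noteq> 0 \<and> solves_at (sliding_field Z i) c s)"
    unfolding regular_germ_def pos neg crossing_empty sliding_Un_escaping by (simp add: conj_assoc)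
  moreover have "origin_germ W Z c \<longleftrightarrow> (\<forall>\<^sub>F s in nhds 0. c s = 0)"
  proof -
    have "0 \<in> Sigma_set W" using zero_in_W by (simp add: Sigma_set_def)
    then have "\<not> Sigma_set W \<subseteq> closure (\<Union>i. crossing W Z i)"
      by (auto simp: crossing_empty)
    moreover have "c 0 = 0" if "\<forall>\<^sub>F s in nhds 0. c s = 0"
      using eventually_nhds_x_imp_x[OF that] .
    ultimately show ?thesis
      unfolding origin_germ_def Let_def using zero_in_closure_sliding by blast
  qed
  ultimately show ?thesis
    unfolding assigned_germ_def simple_germ_def using not_boundary_germ by blast
qed

definition half_axis :: "2 \<Rightarrow> plane \<Rightarrow> real set" where
  "half_axis i u = {y. axis (other i) y \<in> W \<and> same_cell u (axis (other i) y)}"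

lemma half_axis_topology:
  assumes u: "u $ i = 0" "u \<noteq> 0"
  shows "open (half_axis i u)" "is_interval (half_axis i u)" "bounded (half_axis i u)"
proof -
  have lin: "continuous_on UNIV (\<lambda>y. axis (other i) y :: plane)"
    by (rule linear_continuous_on[OF bounded_linear_axis])
  have uj: "u $ other i \<noteq> 0" using u plane_eqI_other[of u i 0] by auto
  have cell: "same_cell u (axis (other i) y) \<longleftrightarrow> sgn y = sgn (u $ other i)" for y
    using u(1) exhaust_2[of i] by (auto simp: same_cell_def forall_plane axis_def)
  have "half_axis i u = (\<lambda>y. axis (other i) y) -` W \<inter> {y. sgn y = sgn (u $ other i)}"
    by (auto simp: half_axis_def cell)
  moreover have "open {y::real. sgn y = sgn (u $ other i)}"
  proof (cases "0 < u $ other i")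
    case True
    then have "{y::real. sgn y = sgn (u $ other i)} = {0<..}" by (auto simp: sgn_1_pos)
    then show ?thesis by simp
  next
    case False
    then have "{y::real. sgn y = sgn (u $ other i)} = {..<0}" using uj by (auto simp: sgn_1_neg)
    then show ?thesis by simp
  qed
  ultimately show "open (half_axis i u)"
    using open_vimage[OF open_W lin] by auto
  have "norm y \<le> \<rho>" if "y \<in> half_axis i u" for y
  proof -
    have "axis (other i) y \<in> ball 0 \<rho>" using that W_subset by (auto simp: half_axis_def)
    then show ?thesis by (simp add: norm_axis)
  qed
  then show "bounded (half_axis i u)" by (rule boundedI)
  have "half_axis i u = (\<lambda>x. x $ other i) ` unstraighten ` (ball 0 \<epsilon> \<inter> {w. same_cell u w})"
  proof (intro equalityI subsetI)
    fix y assume y: "y \<in> half_axis i u"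
    let ?x = "axis (other i) y :: plane"
    have "straighten ?x \<in> ball 0 \<epsilon> \<inter> {w. same_cell u w}"
      using y same_cell_straighten same_cell_trans by (auto simp: half_axis_def W_def)
    then show "y \<in> (\<lambda>x. x $ other i) ` unstraighten ` (ball 0 \<epsilon> \<inter> {w. same_cell u w})"
      by (intro image_eqI[of _ _ ?x] image_eqI[of _ _ "straighten ?x"]) simp_all
  next
    fix y assume "y \<in> (\<lambda>x. x $ other i) ` unstraighten ` (ball 0 \<epsilon> \<inter> {w. same_cell u w})"
    then obtain w where w: "w \<in> ball 0 \<epsilon>" "same_cell u w" "y = unstraighten w $ other i" by auto
    have sc: "same_cell u (unstraighten w)"
      using same_cell_trans[OF w(2) same_cell_unstraighten[OF w(1)]] .
    then have "unstraighten w $ i = 0" using same_cell_zero_iff u(1) by blast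
    then have "axis (other i) y = unstraighten w" unfolding w(3) by (rule axis_other_eq)
    then show "y \<in> half_axis i u" using sc unstraighten_in_W[OF w(1)] by (simp add: half_axis_def)
  qed
  moreover have "connected ((\<lambda>x. x $ other i) ` unstraighten ` (ball 0 \<epsilon> \<inter> {w. same_cell u w}))"
    by (intro connected_continuous_image continuous_intros continuous_on_subset[OF continuous_unstraighten]
        convex_connected convex_Int convex_ball convex_cell) auto
  ultimately show "is_interval (half_axis i u)" by (simp add: is_interval_connected_1)
qed

lemma sliding_time_function:
  assumes u: "u $ i = 0" "u \<noteq> 0"
  defines "S \<equiv> \<lambda>y. sliding_field Z i (axis (other i) y) $ other i"
    and "\<sigma> \<equiv> cell_direction a b e u $ other i"
  obtains T d where "\<And>y. y \<in> half_axis i u \<Longrightarrow> (T has_real_derivative 1 / S y) (at y)"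
    "\<And>y. y \<in> half_axis i u \<Longrightarrow> S y \<noteq> 0"
    "\<And>y. y \<in> half_axis i u \<Longrightarrow> d (T y) = y"
    "continuous_on (T ` half_axis i u) (\<lambda>t. axis (other i) (d t) :: plane)"
    "\<And>t. t \<in> T ` half_axis i u \<Longrightarrow> simple_germ (\<lambda>s. axis (other i) (d (t + s)))"
    "\<And>x y. x \<in> half_axis i u \<Longrightarrow> y \<in> half_axis i u \<Longrightarrow> T x \<le> T y \<longleftrightarrow> \<sigma> * x \<le> \<sigma> * y"
    "open (T ` half_axis i u)" "is_interval (T ` half_axis i u)"
proof -
  let ?V = "half_axis i u" and ?ax = "\<lambda>y. axis (other i) y :: plane"
  have pos: "0 < \<sigma> * S y" if "y \<in> ?V" for y
  proof -
    let ?p = "axis (other i) y :: plane"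
    have p: "?p \<in> W" "same_cell u ?p" using that by (auto simp: half_axis_def)
    moreover have "?p $ i = 0" by (simp add: axis_def)
    moreover have "?p \<noteq> 0" using same_cell_eq_0_iff[OF p(2)] u(2) by simp
    ultimately have "0 < cell_direction a b e ?p $ other i * sliding_field Z i ?p $ other i"
      using W_subset by (intro sliding_component_sign) auto
    then show ?thesis using cell_direction_cong[OF p(2)] by (simp add: \<sigma>_def S_def)
  qed
  have S_eq: "S y = (Y (axis (other i) y) $ i * X (axis (other i) y) $ other i -
      X (axis (other i) y) $ i * Y (axis (other i) y) $ other i) /
      (Y (axis (other i) y) $ i - X (axis (other i) y) $ i)" if "y \<in> ?V" for y
    using that Z_on_W by (simp add: S_def sliding_field_def Let_def half_axis_def)
  have "Y p $ i - X p $ i \<noteq> 0" for p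
    using field_signs[of p] exhaust_2[of i] by auto
  then have cont: "continuous_on ?V S"
    by (subst continuous_on_cong[OF refl S_eq])
      (auto intro!: continuous_intros linear_continuous_on[OF bounded_linear_axis]
        continuous_on_compose2[OF X.continuous_field[of UNIV]] continuous_on_compose2[OF Y.continuous_field[of UNIV]])
  have \<sigma>: "\<sigma> = 1 \<or> \<sigma> = -1" using cell_direction_axis(2)[OF u] by (simp add: \<sigma>_def)
  obtain T d where T: "\<And>y. y \<in> ?V \<Longrightarrow> (T has_real_derivative 1 / S y) (at y)"
    "\<And>y. y \<in> ?V \<Longrightarrow> d (T y) = y"
    "\<And>y. y \<in> ?V \<Longrightarrow> (d has_real_derivative S y) (at (T y))"
    "\<And>x y. x \<in> ?V \<Longrightarrow> y \<in> ?V \<Longrightarrow> T x \<le> T y \<longleftrightarrow> \<sigma> * x \<le> \<sigma> * y"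
    "open (T ` ?V)" "is_interval (T ` ?V)"
    using scalar_time_function[OF half_axis_topology[OF u] cont \<sigma> pos, of thesis] by blast
  have "sliding_field Z i p = axis (other i) (sliding_field Z i p $ other i)" for p
    by (simp add: sliding_field_def Let_def)
  then have d_der: "((\<lambda>t. ?ax (d t)) has_vector_derivative sliding_field Z i (?ax y)) (at (T y))"
    if "y \<in> ?V" for y
    using bounded_linear.has_vector_derivative[OF bounded_linear_axis T(3)[OF that, unfolded has_real_derivative_iff_has_vector_derivative]]
    by (metis S_def)
  then have "continuous_on (T ` ?V) (\<lambda>t. ?ax (d t))"
    using has_vector_derivative_continuous by (intro continuous_at_imp_continuous_on) blast
  moreover have "simple_germ (\<lambda>s. ?ax (d (t + s)))" if t: "t \<in> T ` ?V" for t
  proof -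
    have "\<forall>\<^sub>F s in nhds t. s \<in> T ` ?V" using T(5) t by (rule eventually_nhds_in_open)
    then have "\<forall>\<^sub>F s in nhds 0. t + s \<in> T ` ?V" by (rule eventually_nhds_shift[THEN iffD2])
    then have "\<forall>\<^sub>F s in nhds 0. ?ax (d (t + s)) \<in> W \<and> ?ax (d (t + s)) $ i = 0 \<and> ?ax (d (t + s)) \<noteq> 0 \<and>
        solves_at (sliding_field Z i) (\<lambda>s. ?ax (d (t + s))) s"
    proof eventually_elim
      case (elim s)
      then obtain z where z: "z \<in> ?V" "t + s = T z" by auto
      have "solves_at (sliding_field Z i) (\<lambda>t. ?ax (d t)) (t + s)"
        using d_der[OF z(1)] T(2)[OF z(1)] by (simp add: solves_at_def z(2))
      then have "solves_at (sliding_field Z i) (\<lambda>s. ?ax (d (t + s))) s"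
        by (subst solves_at_shift)
      moreover have "same_cell u (?ax z)" "?ax z \<in> W" using z(1) by (auto simp: half_axis_def)
      ultimately show ?case
        using T(2)[OF z(1)] z(2) same_cell_zero_iff[of u "?ax z" i] same_cell_eq_0_iff[of u "?ax z"] u by simp
    qed
    then show ?thesis unfolding simple_germ_def by blast
  qed
  moreover have "S y \<noteq> 0" if "y \<in> ?V" for y using pos[OF that] by auto
  ultimately show ?thesis using that T by blast
qed

end

section \<open>Leaves of the straightened neighbourhood\<close>

context straightened
begin

lemma off_axes: "p $ 1 * p $ 2 \<noteq> 0 \<Longrightarrow> p $ i \<noteq> 0" for p :: plane
  using exhaust_2[of i] by auto

lemma eventually_cell:
  assumes c: "isCont c 0" and "c 0 \<in> W" and nz: "\<And>i. c 0 $ i \<noteq> 0"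
  shows "\<forall>\<^sub>F s in nhds (0::real). c s \<in> W \<and> same_cell (c 0) (c s)"
proof -
  have "\<forall>\<^sub>F s in nhds 0. \<forall>i. sgn (c s $ i) = sgn (c 0 $ i)"
    using c nz by (intro eventually_all_finite eventually_sgn_eq) (auto intro!: continuous_intros)
  moreover have "\<forall>\<^sub>F s in nhds 0. c s \<in> W"
    using c open_W \<open>c 0 \<in> W\<close>
    by (auto simp: continuous_at tendsto_at_iff_tendsto_nhds elim: topological_tendstoD)
  ultimately show ?thesis by eventually_elim (simp add: same_cell_def)
qed

lemma half_axis_mem:
  assumes "x \<in> W" "x $ i = 0" "same_cell u x"
  shows "x $ other i \<in> half_axis i u"
  using assms axis_other_eq[OF assms(2)] by (simp add: half_axis_def)

lemma simple_germ_quadrant: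
  "0 < u $ 1 * u $ 2 \<Longrightarrow> \<forall>\<^sub>F s in nhds 0. c s \<in> W \<and> same_cell u (c s) \<and> solves_at X c s \<Longrightarrow> simple_germ c"
  "u $ 1 * u $ 2 < 0 \<Longrightarrow> \<forall>\<^sub>F s in nhds 0. c s \<in> W \<and> same_cell u (c s) \<and> solves_at Y c s \<Longrightarrow> simple_germ c"
  unfolding simple_germ_def
  by (rule disjI1, erule eventually_mono, use same_cell_mult_pos_iff in blast,
      rule disjI2, rule disjI1, erule eventually_mono, use same_cell_mult_pos_iff in blast)

text \<open>Through every point there is an assigned germ, so the rule that makes other points
trajectories by themselves never applies in W.\<close>

lemma simple_germ_exists:
  assumes p: "p \<in> W"
  shows "\<exists>d. d 0 = p \<and> simple_germ d"
proof -
  have flow_germ: "\<forall>\<^sub>F s in nhds 0. d s \<in> W \<and> same_cell p (d s) \<and> solves_at F d s"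
    if "\<And>s. solves_at F d s" "d 0 = p" "\<And>i. p $ i \<noteq> 0" for F and d :: "real \<Rightarrow> plane"
  proof -
    have "isCont d 0" using that(1)[of 0] has_vector_derivative_continuous by (auto simp: solves_at_def)
    then show ?thesis using eventually_cell[of d] p that by (auto elim: eventually_mono)
  qed
  consider "p = 0" | "0 < p $ 1 * p $ 2" | "p $ 1 * p $ 2 < 0" | i where "p $ i = 0" "p \<noteq> 0"
    by (metis linorder_neqE_linordered_idom mult_eq_0_iff)
  then show ?thesis
  proof cases
    case 1
    then show ?thesis by (intro exI[of _ "\<lambda>_. 0"]) (simp add: simple_germ_def)
  next
    case 2
    then have "\<And>i. p $ i \<noteq> 0" by (intro off_axes) auto
    then have "\<forall>\<^sub>F s in nhds 0. X.flow s p \<in> W \<and> same_cell p (X.flow s p) \<and> solves_at X (\<lambda>s. X.flow s p) s"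
      by (intro flow_germ) (simp_all add: solves_at_def X.flow_has_vector_derivative)
    from simple_germ_quadrant(1)[OF 2 this] show ?thesis by (intro exI[of _ "\<lambda>s. X.flow s p"]) simp
  next
    case 3
    then have "\<And>i. p $ i \<noteq> 0" by (intro off_axes) auto
    then have "\<forall>\<^sub>F s in nhds 0. Y.flow s p \<in> W \<and> same_cell p (Y.flow s p) \<and> solves_at Y (\<lambda>s. Y.flow s p) s"
      by (intro flow_germ) (simp_all add: solves_at_def Y.flow_has_vector_derivative)
    from simple_germ_quadrant(2)[OF 3 this] show ?thesis by (intro exI[of _ "\<lambda>s. Y.flow s p"]) simp
  next
    case 4
    let ?V = "half_axis i p"
    obtain T d where d: "\<And>y. y \<in> ?V \<Longrightarrow> d (T y) = y"
      "\<And>t. t \<in> T ` ?V \<Longrightarrow> simple_germ (\<lambda>s. axis (other i) (d (t + s)))"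
      using sliding_time_function[OF 4] by metis
    define y where "y = p $ other i"
    have y: "y \<in> ?V" unfolding y_def by (rule half_axis_mem[OF p 4(1)]) simp
    have "axis (other i) (d (T y + 0)) = p" using axis_other_eq[OF 4(1)] d(1)[OF y] by (simp add: y_def)
    with d(2)[OF imageI[OF y]] show ?thesis
      by (intro exI[of _ "\<lambda>s. axis (other i) (d (T y + s))"] conjI)
  qed
qed

lemma trajectory_germ_iff:
  assumes "c 0 \<in> W"
  shows "trajectory_germ W Z c \<longleftrightarrow> simple_germ c"
  using simple_germ_exists[OF assms] unfolding trajectory_germ_def assigned_germ_iff by blast

lemma piece_simple_germ:
  assumes "trajectory_piece W Z I c" "t \<in> I"
  shows "simple_germ (\<lambda>s. c (t + s))"
  using assms trajectory_germ_iff[of "\<lambda>s. c (t + s)"] by (auto simp: trajectory_piece_def)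

lemma trajectory_piece_if_simple_germs:
  assumes "open I" "is_interval I" "I \<noteq> {}" "continuous_on I c"
    and "\<And>t. t \<in> I \<Longrightarrow> c t \<in> W" "\<And>t. t \<in> I \<Longrightarrow> simple_germ (\<lambda>s. c (t + s))"
  shows "trajectory_piece W Z I c"
  using assms trajectory_germ_iff by (auto simp: trajectory_piece_def)

lemma simple_germ_same_cell:
  assumes germ: "simple_germ c" and c: "isCont c 0" "c 0 \<in> W"
  shows "\<forall>\<^sub>F s in nhds 0. same_cell (c 0) (c s)"
proof -
  have generic: ?thesis if "c 0 $ 1 * c 0 $ 2 \<noteq> 0"
  proof -
    have "c 0 $ i \<noteq> 0" for i using that exhaust_2[of i] by auto
    then show ?thesis using eventually_cell[OF c] by (auto elim: eventually_mono)
  qed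
  consider "\<forall>\<^sub>F s in nhds 0. 0 < c s $ 1 * c s $ 2" | "\<forall>\<^sub>F s in nhds 0. c s $ 1 * c s $ 2 < 0" |
     i where "\<forall>\<^sub>F s in nhds 0. c s $ i = 0 \<and> c s \<noteq> 0" | "\<forall>\<^sub>F s in nhds 0. c s = 0"
    using germ unfolding simple_germ_def eventually_conj_iff by blast
  then show ?thesis
  proof cases
    case 1
    then show ?thesis using generic eventually_nhds_x_imp_x[OF 1] by fastforce
  next
    case 2
    then show ?thesis using generic eventually_nhds_x_imp_x[OF 2] by fastforce
  next
    case 3
    have "c 0 $ i = 0" "c 0 \<noteq> 0" using eventually_nhds_x_imp_x[OF 3] by auto
    then have "c 0 $ other i \<noteq> 0" using plane_eqI_other[of "c 0" i 0] by auto
    then have "\<forall>\<^sub>F s in nhds 0. sgn (c s $ other i) = sgn (c 0 $ other i)"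
      using c by (intro eventually_sgn_eq) (auto intro!: continuous_intros)
    then show ?thesis using 3
    proof eventually_elim
      case (elim s)
      have "sgn (c 0 $ j) = sgn (c s $ j)" for j
        using elim \<open>c 0 $ i = 0\<close> exhaust_2[of i] exhaust_2[of j] by auto
      then show ?case by (simp add: same_cell_def)
    qed
  next
    case 4
    then show ?thesis using eventually_nhds_x_imp_x[OF 4] by (auto elim: eventually_mono)
  qed
qed

text \<open>Each admissible germ stays in the cell where it starts, so the signs of the coordinates
are locally constant along a trajectory piece, whose domain is connected.\<close>

lemma piece_same_cell:
  assumes piece: "trajectory_piece W Z I c" and t: "t \<in> I" "t' \<in> I"
  shows "same_cell (c t) (c t')"
proof -
  have I: "open I" "is_interval I" "continuous_on I c" "c ` I \<subseteq> W"
    using piece by (auto simp: trajectory_piece_def)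
  \<comment> \<open>The cell of c t as a vector, so that it can be shown to be locally constant.\<close>
  define f where "f = (\<lambda>t. (\<chi> i. sgn (c t $ i)) :: plane)"
  have f: "f r = f s \<longleftrightarrow> same_cell (c r) (c s)" for r s
    by (simp add: f_def same_cell_def vec_eq_iff)
  have "\<forall>\<^sub>F s in at r within I. f r = f s" if "r \<in> I" for r
  proof -
    have "isCont c r" using I that by (simp add: continuous_on_eq_continuous_at)
    then have "isCont (\<lambda>s. c (r + s)) 0"
      by (intro isCont_o2[of 0 "\<lambda>s. r + s" c]) auto
    then have "\<forall>\<^sub>F s in nhds 0. same_cell (c r) (c (r + s))"
      using simple_germ_same_cell[OF piece_simple_germ[OF piece that]] I that by auto
    then have "\<forall>\<^sub>F s in nhds r. same_cell (c r) (c s)"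
      by (rule eventually_nhds_shift[THEN iffD1])
    then show ?thesis unfolding f by (simp add: eventually_at_filter eventually_mono)
  qed
  then have "f t = f t'"
    using I(2) t by (intro connected_local_const[of I]) (auto simp: is_interval_connected)
  then show ?thesis by (simp add: f)
qed

lemma piece_derivative:
  assumes piece: "trajectory_piece W Z I c" and t: "t \<in> I"
  shows "0 < c t $ 1 * c t $ 2 \<Longrightarrow> (c has_vector_derivative X (c t)) (at t)"
    "c t $ 1 * c t $ 2 < 0 \<Longrightarrow> (c has_vector_derivative Y (c t)) (at t)"
    "c t $ i = 0 \<Longrightarrow> c t \<noteq> 0 \<Longrightarrow> (c has_vector_derivative sliding_field Z i (c t)) (at t)"
proof -
  let ?c = "\<lambda>s. c (t + s)"
  consider "\<forall>\<^sub>F s in nhds 0. ?c s \<in> W \<and> 0 < ?c s $ 1 * ?c s $ 2 \<and> solves_at X ?c s" |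
    "\<forall>\<^sub>F s in nhds 0. ?c s \<in> W \<and> ?c s $ 1 * ?c s $ 2 < 0 \<and> solves_at Y ?c s" |
    j where "\<forall>\<^sub>F s in nhds 0. ?c s \<in> W \<and> ?c s $ j = 0 \<and> ?c s \<noteq> 0 \<and> solves_at (sliding_field Z j) ?c s" |
    "\<forall>\<^sub>F s in nhds 0. ?c s = 0"
    using piece_simple_germ[OF piece t] unfolding simple_germ_def by blast
  then have "0 < ?c 0 $ 1 * ?c 0 $ 2 \<and> solves_at X ?c 0 \<or> ?c 0 $ 1 * ?c 0 $ 2 < 0 \<and> solves_at Y ?c 0 \<or>
    (\<exists>j. ?c 0 $ j = 0 \<and> ?c 0 \<noteq> 0 \<and> solves_at (sliding_field Z j) ?c 0) \<or> ?c 0 = 0"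
  proof cases
    case 1 show ?thesis using eventually_nhds_x_imp_x[OF 1] by blast
  next
    case 2 show ?thesis using eventually_nhds_x_imp_x[OF 2] by blast
  next
    case 3 show ?thesis using eventually_nhds_x_imp_x[OF 3] by blast
  next
    case 4 show ?thesis using eventually_nhds_x_imp_x[OF 4] by blast
  qed
  then have "0 < c t $ 1 * c t $ 2 \<and> solves_at X c t \<or> c t $ 1 * c t $ 2 < 0 \<and> solves_at Y c t \<or>
    (\<exists>j. c t $ j = 0 \<and> c t \<noteq> 0 \<and> solves_at (sliding_field Z j) c t) \<or> c t = 0"
    unfolding solves_at_shift by simp
  moreover have "j = i" if "c t $ i = 0" "c t $ j = 0" "c t \<noteq> 0" for i j
    using that exhaust_2[of i] exhaust_2[of j] by (auto simp: plane_eq_iff)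
  moreover have "c t $ 1 * c t $ 2 = 0" if "c t $ i = 0" for i using that exhaust_2[of i] by auto
  ultimately show "0 < c t $ 1 * c t $ 2 \<Longrightarrow> (c has_vector_derivative X (c t)) (at t)"
    "c t $ 1 * c t $ 2 < 0 \<Longrightarrow> (c has_vector_derivative Y (c t)) (at t)"
    "c t $ i = 0 \<Longrightarrow> c t \<noteq> 0 \<Longrightarrow> (c has_vector_derivative sliding_field Z i (c t)) (at t)"
    unfolding solves_at_def by (auto, (metis less_irrefl)+)
qed

lemma stationary_origin_W: "stationary_origin W Z"
  unfolding stationary_origin_def
proof (intro conjI allI impI ballI)
  show "trajectory_piece W Z UNIV (\<lambda>_. 0)"
    by (rule trajectory_piece_if_simple_germs) (auto simp: zero_in_W simple_germ_def)
  fix I c t\<^sub>0 t assume "trajectory_piece W Z I c" "t\<^sub>0 \<in> I" "c t\<^sub>0 = 0" "t \<in> I"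
  then show "c t = 0" using piece_same_cell same_cell_eq_0_iff by blast
qed

definition leaf :: "plane \<Rightarrow> plane set" where
  "leaf u = {x \<in> W. same_cell u x \<and> (\<exists>r. straighten x = u + r *\<^sub>R cell_direction a b e u)}"

definition oriented_leaf :: "plane \<Rightarrow> bool" where
  "oriented_leaf u \<longleftrightarrow> (\<exists>T d. flow_leaf W Z (leaf u) T d \<and>
     (\<forall>x\<in>leaf u. \<forall>y\<in>leaf u. T x \<le> T y \<longleftrightarrow>
        (\<exists>r\<ge>0. straighten y = straighten x + r *\<^sub>R cell_direction a b e u)))"

text \<open>The motion along the leaf is the flow through a point p of it, restricted to the set N of
times at which it is in W and in the cell. This set is an interval: straightened, the flow runs
monotonically along a line, and the ball is convex.\<close>

lemma quadrant_oriented_leaf: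
  assumes tf: "transversal_field F K M \<kappa> sg" and u: "u \<in> ball 0 \<epsilon>"
    and sg: "cell_direction a b e u = sg"
    and orbit: "\<And>p q. same_cell u p \<Longrightarrow> same_cell u q \<Longrightarrow>
      (\<exists>t\<ge>0. q = lipschitz_field.flow F t p) \<longleftrightarrow> (\<exists>r\<ge>0. straighten q = straighten p + r *\<^sub>R sg)"
    and germ: "\<And>c. \<forall>\<^sub>F s in nhds 0. c s \<in> W \<and> same_cell u (c s) \<and> solves_at F c s \<Longrightarrow> simple_germ c"
    and derivative: "\<And>I c t. trajectory_piece W Z I c \<Longrightarrow> t \<in> I \<Longrightarrow> same_cell u (c t) \<Longrightarrow>
      (c has_vector_derivative F (c t)) (at t)"
    and nz: "\<And>i. u $ i \<noteq> 0"
  shows "oriented_leaf u"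
proof -
  interpret F: transversal_field F K M \<kappa> sg by fact
  define p where "p = unstraighten u"
  have p: "same_cell u p" "straighten p = u"
    using u same_cell_unstraighten by (auto simp: p_def)
  define N where "N = {t. F.flow t p \<in> W \<and> same_cell u (F.flow t p)}"
  define T where "T x = (THE t. F.flow t p = x)" for x
  have T: "T (F.flow t p) = t" for t
    unfolding T_def using F.flow_coordinate_inj by (intro the_equality) metis+
  have leaf_eq: "leaf u = (\<lambda>t. F.flow t p) ` N"
  proof (intro equalityI subsetI)
    fix x assume "x \<in> leaf u"
    then obtain r where x: "x \<in> W" "same_cell u x" and r: "straighten x = u + r *\<^sub>R sg"
      by (auto simp: leaf_def sg)
    have "\<exists>t. x = F.flow t p"
    proof (cases "0 \<le> r")
      case True
      then show ?thesis using orbit[OF p(1) x(2)] r p(2) by metis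
    next
      case False
      then have "\<exists>r\<ge>0. straighten p = straighten x + r *\<^sub>R sg"
        using r p(2) by (intro exI[of _ "- r"]) simp
      then obtain t where "p = F.flow t x" using orbit[OF x(2) p(1)] by blast
      then have "x = F.flow (- t) p" by simp
      then show ?thesis by blast
    qed
    then show "x \<in> (\<lambda>t. F.flow t p) ` N" using x by (auto simp: N_def)
  next
    fix x assume "x \<in> (\<lambda>t. F.flow t p) ` N"
    then obtain t where t: "x = F.flow t p" "x \<in> W" "same_cell u x" by (auto simp: N_def)
    have "\<exists>r. straighten x = u + r *\<^sub>R sg"
    proof (cases "0 \<le> t")
      case True
      then show ?thesis using orbit[OF p(1) t(3)] t(1) p(2) by metis
    next
      case False
      then have "\<exists>t\<ge>0. p = F.flow t x" using t(1) by (intro exI[of _ "- t"]) simp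
      then obtain r where "straighten p = straighten x + r *\<^sub>R sg" using orbit[OF t(3) p(1)] by blast
      then have "straighten x = u + (- r) *\<^sub>R sg" using p(2) by simp
      then show ?thesis by blast
    qed
    then show "x \<in> leaf u" using t by (simp add: leaf_def sg)
  qed
  then have T_image: "T ` leaf u = N" by (simp add: image_image T)
  have flow_cont: "isCont (\<lambda>t. F.flow t p) t" for t
    using F.flow_has_vector_derivative has_vector_derivative_continuous by blast
  have ev: "\<forall>\<^sub>F s in nhds 0. F.flow (t + s) p \<in> W \<and> same_cell u (F.flow (t + s) p)" if "t \<in> N" for t
  proof -
    have t: "F.flow t p \<in> W" "same_cell u (F.flow t p)" using that by (auto simp: N_def)
    have "isCont (\<lambda>s. F.flow (t + s) p) 0" 
      by (rule isCont_o2[of 0 "\<lambda>s. t + s" "\<lambda>s. F.flow s p", OF _ flow_cont]) simp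
    moreover have "F.flow t p $ i \<noteq> 0" for i using nz same_cell_zero_iff[OF t(2)] by blast
    ultimately have "\<forall>\<^sub>F s in nhds 0. F.flow (t + s) p \<in> W \<and> same_cell (F.flow t p) (F.flow (t + s) p)"
      using eventually_cell[of "\<lambda>s. F.flow (t + s) p"] t by simp
    then show ?thesis by eventually_elim (use t same_cell_trans in blast)
  qed
  have "trajectory_piece W Z N (\<lambda>t. F.flow t p)"
  proof (rule trajectory_piece_if_simple_germs)
    show "open N"
    proof (subst open_contains_ball, intro ballI)
      fix t assume "t \<in> N"
      have "\<forall>\<^sub>F s in nhds t. s \<in> N"
        using ev[OF \<open>t \<in> N\<close>] unfolding N_def mem_Collect_eq by (rule eventually_nhds_shift[THEN iffD1])
      then show "\<exists>r>0. ball t r \<subseteq> N"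
        unfolding eventually_nhds_metric by (auto simp: dist_commute)
    qed
    show "is_interval N"
      unfolding is_interval_1
    proof (intro ballI allI impI)
      fix t1 t2 t assume N: "t1 \<in> N" "t2 \<in> N" and t: "t1 \<le> t \<and> t \<le> t2"
      let ?x1 = "F.flow t1 p" and ?x = "F.flow t p" and ?x2 = "F.flow t2 p"
      have x: "?x1 \<in> W" "same_cell u ?x1" "?x2 \<in> W" "same_cell u ?x2" using N by (auto simp: N_def)
      have le: "sg $ i * F.flow r p $ i \<le> sg $ i * F.flow s p $ i" if "r \<le> s" for r s i
      proof -
        have "0 \<le> \<kappa> * (s - r)" using that F.speed_pos by simp
        then show ?thesis using F.flow_coordinate_increase[OF that, of i p] by (simp add: right_diff_distrib)
      qed
      have cell: "same_cell u ?x"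
        by (rule same_cell_between[OF x(2,4), of sg]) (use t le F.sg in \<open>auto simp: signs_def\<close>)
      have orb: "\<exists>q\<ge>0. straighten (F.flow s p) = straighten (F.flow r p) + q *\<^sub>R sg"
        if "r \<le> s" "same_cell u (F.flow r p)" "same_cell u (F.flow s p)" for r s
      proof -
        have "F.flow s p = F.flow (s - r) (F.flow r p)" by (simp flip: F.flow_add)
        then show ?thesis using orbit[OF that(2,3)] that(1) by (metis diff_ge_0_iff_ge)
      qed
      obtain q1 where q1: "0 \<le> q1" "straighten ?x = straighten ?x1 + q1 *\<^sub>R sg" using orb[of t1 t] t x cell by blast
      obtain q2 where q2: "0 \<le> q2" "straighten ?x2 = straighten ?x + q2 *\<^sub>R sg" using orb[of t t2] t x cell by blast
      have "straighten ?x \<in> closed_segment (straighten ?x1) (straighten ?x2)"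
      proof (cases "q1 + q2 = 0")
        case True
        then have "q1 = 0" using q1 q2 by linarith
        then show ?thesis using q1 by simp
      next
        case False
        then have "straighten ?x = (1 - q1 / (q1 + q2)) *\<^sub>R straighten ?x1 + (q1 / (q1 + q2)) *\<^sub>R straighten ?x2"
          unfolding q2(2) q1(2) by (simp add: algebra_simps flip: scaleR_add_left) (simp add: add_divide_distrib[symmetric] flip: scaleR_add_left distrib_left)
        then show ?thesis using q1 q2 False unfolding closed_segment_def
          by (auto intro!: exI[of _ "q1 / (q1 + q2)"])
      qed
      moreover have "closed_segment (straighten ?x1) (straighten ?x2) \<subseteq> ball 0 \<epsilon>"
        using x by (intro closed_segment_subset convex_ball) (auto simp: W_def)
      ultimately have "?x \<in> W" unfolding W_def by blast
      then show "t \<in> N" using cell by (simp add: N_def)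
    qed
    have "0 \<in> N" using p unstraighten_in_W[OF u] by (simp add: N_def p_def)
    then show "N \<noteq> {}" by blast
    show "continuous_on N (\<lambda>t. F.flow t p)" by (rule F.continuous_flow_time)
    show "F.flow t p \<in> W" if "t \<in> N" for t using that by (simp add: N_def)
    show "simple_germ (\<lambda>s. F.flow (t + s) p)" if "t \<in> N" for t
    proof (rule germ)
      show "\<forall>\<^sub>F s in nhds 0. F.flow (t + s) p \<in> W \<and> same_cell u (F.flow (t + s) p) \<and>
          solves_at F (\<lambda>s. F.flow (t + s) p) s"
        using ev[OF that] F.flow_shift_has_vector_derivative[of t p]
        by (auto simp: solves_at_def add.commute elim: eventually_mono)
    qed
  qed
  moreover have "c t \<in> leaf u \<and> T (c t) - T (c t\<^sub>0) = t - t\<^sub>0"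
    if piece: "trajectory_piece W Z I c" and t: "t\<^sub>0 \<in> I" "t \<in> I" and c: "c t\<^sub>0 \<in> leaf u" for I c t\<^sub>0 t
  proof -
    obtain k where k: "c t\<^sub>0 = F.flow k p" using c by (auto simp: leaf_eq)
    have cell: "same_cell u (c s)" if "s \<in> I" for s
      using same_cell_trans[OF _ piece_same_cell[OF piece t(1) that]] c by (auto simp: leaf_def)
    have "c t = F.flow (t - t\<^sub>0) (c t\<^sub>0)"
      using piece t derivative[OF piece _ cell] by (intro F.solution_eq_flow) (auto simp: trajectory_piece_def)
    then have ct: "c t = F.flow (t - t\<^sub>0 + k) p" by (simp add: k F.flow_add)
    moreover have "c t \<in> W" using piece t by (auto simp: trajectory_piece_def)
    ultimately have "c t \<in> leaf u" using cell[OF t(2)] by (auto simp: leaf_eq N_def)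
    then show ?thesis by (simp add: ct k T)
  qed
  ultimately have "flow_leaf W Z (leaf u) T (\<lambda>t. F.flow t p)"
    unfolding flow_leaf_def T_image by (auto simp: leaf_eq T)
  moreover have "T x \<le> T y \<longleftrightarrow> (\<exists>r\<ge>0. straighten y = straighten x + r *\<^sub>R cell_direction a b e u)"
    if xy: "x \<in> leaf u" "y \<in> leaf u" for x y
  proof -
    obtain s t where st: "x = F.flow s p" "y = F.flow t p" using xy by (auto simp: leaf_eq)
    have "(\<exists>r\<ge>0. straighten y = straighten x + r *\<^sub>R sg) \<longleftrightarrow> (\<exists>k\<ge>0. y = F.flow k x)"
      using orbit[of x y] xy by (auto simp: leaf_def)
    also have "\<dots> \<longleftrightarrow> (\<exists>k\<ge>0. F.flow t p = F.flow (k + s) p)" by (simp add: st F.flow_add)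
    also have "\<dots> \<longleftrightarrow> (\<exists>k\<ge>0. t = k + s)" using F.flow_coordinate_inj by metis
    also have "\<dots> \<longleftrightarrow> s \<le> t" by (auto intro: exI[of _ "t - s"])
    finally show ?thesis by (simp add: st T sg)
  qed
  ultimately show ?thesis unfolding oriented_leaf_def by blast
qed

text \<open>The part of a half axis in W is a single leaf, because the sliding field has no zero on
it; the time T' is that of the scalar sliding field, and T' \<circ> c
has derivative 1 along every trajectory piece c.\<close>

lemma axis_oriented_leaf:
  assumes u: "u $ i = 0" "u \<noteq> 0" "u \<in> ball 0 \<epsilon>"
  shows "oriented_leaf u"
proof -
  let ?V = "half_axis i u" and ?ax = "\<lambda>y. axis (other i) y :: plane"
  define v where "v = cell_direction a b e u"
  define \<sigma> where "\<sigma> = v $ other i"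
  have v: "v $ i = 0" "\<sigma> = 1 \<or> \<sigma> = -1"
    using cell_direction_axis[OF u(1,2)] by (auto simp: v_def \<sigma>_def)
  have v_eq: "v = ?ax \<sigma>" using axis_other_eq[OF v(1)] by (simp add: \<sigma>_def)
  have on_axis: "x $ i = 0" if "same_cell u x" for x
    using same_cell_zero_iff[OF that, of i] u(1) by simp
  have line: "(\<exists>r\<ge>0. q = p + r *\<^sub>R v) \<longleftrightarrow> \<sigma> * p $ other i \<le> \<sigma> * q $ other i"
    if "p $ i = 0" "q $ i = 0" for p q
  proof
    assume "\<exists>r\<ge>0. q = p + r *\<^sub>R v"
    then show "\<sigma> * p $ other i \<le> \<sigma> * q $ other i"
      using v(2) by (auto simp: \<sigma>_def[symmetric] algebra_simps)
  next
    assume le: "\<sigma> * p $ other i \<le> \<sigma> * q $ other i"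
    have "q = p + (\<sigma> * (q $ other i - p $ other i)) *\<^sub>R v"
      using v that by (intro plane_eqI_other[of _ i]) (auto simp: \<sigma>_def[symmetric])
    moreover have "0 \<le> \<sigma> * (q $ other i - p $ other i)" using le by (simp add: right_diff_distrib)
    ultimately show "\<exists>r\<ge>0. q = p + r *\<^sub>R v" by blast
  qed
  have leaf_eq: "leaf u = ?ax ` ?V"
  proof (intro equalityI subsetI)
    fix x assume "x \<in> leaf u"
    then have x: "x \<in> W" "same_cell u x" by (auto simp: leaf_def)
    show "x \<in> ?ax ` ?V"
      using half_axis_mem[OF x(1) on_axis[OF x(2)] x(2)] axis_other_eq[OF on_axis[OF x(2)]] by (metis imageI)
  next
    fix x assume "x \<in> ?ax ` ?V"
    then have x: "x \<in> W" "same_cell u x" by (auto simp: half_axis_def)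
    have z: "straighten x $ i = 0" using on_axis[OF same_cell_trans[OF x(2) same_cell_straighten]] .
    have "\<exists>r. straighten x = u + r *\<^sub>R v"
    proof (cases "\<sigma> * u $ other i \<le> \<sigma> * straighten x $ other i")
      case True
      then show ?thesis using line[OF u(1) z] by blast
    next
      case False
      then obtain r where "u = straighten x + r *\<^sub>R v" using line[OF z u(1)] by auto
      then have "straighten x = u + (- r) *\<^sub>R v" by simp
      then show ?thesis by blast
    qed
    then show "x \<in> leaf u" using x by (simp add: leaf_def v_def)
  qed
  obtain T d where T: "\<And>y. y \<in> ?V \<Longrightarrow> (T has_real_derivative 1 / sliding_field Z i (?ax y) $ other i) (at y)"
    and nz: "\<And>y. y \<in> ?V \<Longrightarrow> sliding_field Z i (?ax y) $ other i \<noteq> 0"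
    and d: "\<And>y. y \<in> ?V \<Longrightarrow> d (T y) = y"
    and d_cont: "continuous_on (T ` ?V) (\<lambda>t. ?ax (d t))"
    and d_germ: "\<And>t. t \<in> T ` ?V \<Longrightarrow> simple_germ (\<lambda>s. ?ax (d (t + s)))"
    and T_le: "\<And>x y. x \<in> ?V \<Longrightarrow> y \<in> ?V \<Longrightarrow> T x \<le> T y \<longleftrightarrow> \<sigma> * x \<le> \<sigma> * y"
    and T_img: "open (T ` ?V)" "is_interval (T ` ?V)"
    using sliding_time_function[OF u(1,2), of thesis] unfolding \<sigma>_def v_def by blast
  define T' where "T' x = T (x $ other i)" for x :: plane
  have T'_ax: "T' (?ax y) = T y" for y by (simp add: T'_def)
  have T'_img: "T' ` leaf u = T ` ?V" by (simp add: leaf_eq image_image T'_ax)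
  have u_leaf: "unstraighten u \<in> leaf u"
    using u(3) unstraighten_in_W same_cell_unstraighten by (auto simp: leaf_def intro: exI[of _ 0])
  have "trajectory_piece W Z (T ` ?V) (\<lambda>t. ?ax (d t))"
  proof (rule trajectory_piece_if_simple_germs)
    show "T ` ?V \<noteq> {}" using u_leaf by (auto simp: leaf_eq)
    show "?ax (d t) \<in> W" if "t \<in> T ` ?V" for t using that d by (auto simp: half_axis_def)
  qed (use T_img d_cont d_germ in auto)
  moreover have "c t \<in> leaf u \<and> T' (c t) - T' (c t\<^sub>0) = t - t\<^sub>0"
    if piece: "trajectory_piece W Z I c" and t: "t\<^sub>0 \<in> I" "t \<in> I" and c: "c t\<^sub>0 \<in> leaf u" for I c t\<^sub>0 t
  proof -
    have cell: "same_cell u (c s)" if "s \<in> I" for s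
      using same_cell_trans[OF _ piece_same_cell[OF piece t(1) that]] c by (auto simp: leaf_def)
    have I: "is_interval I" "\<And>s. s \<in> I \<Longrightarrow> c s \<in> W" using piece by (auto simp: trajectory_piece_def)
    have mem: "c s $ other i \<in> ?V" "?ax (c s $ other i) = c s" if "s \<in> I" for s
      using half_axis_mem[OF I(2)[OF that] on_axis[OF cell[OF that]] cell[OF that]]
        axis_other_eq[OF on_axis[OF cell[OF that]]] by auto
    have "((\<lambda>s. T' (c s) - s) has_real_derivative 0) (at s within I)" if "s \<in> I" for s
    proof -
      have "c s \<noteq> 0" using same_cell_eq_0_iff[OF cell[OF that]] u(2) by simp
      then have "(c has_vector_derivative sliding_field Z i (c s)) (at s)"
        using piece_derivative(3)[OF piece that on_axis[OF cell[OF that]]] by blast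
      then have "((\<lambda>s. c s $ other i) has_real_derivative sliding_field Z i (c s) $ other i) (at s)"
        using bounded_linear.has_vector_derivative[OF bounded_linear_vec_nth]
        by (simp add: has_real_derivative_iff_has_vector_derivative)
      from DERIV_chain2[OF T[OF mem(1)[OF that]] this]
      have "((\<lambda>s. T' (c s)) has_real_derivative 1) (at s)"
        using nz[OF mem(1)[OF that]] by (simp add: T'_def mem(2)[OF that])
      then show ?thesis
        by (auto intro!: derivative_eq_intros intro: has_field_derivative_at_within)
    qed
    then have "\<exists>k. \<forall>s\<in>I. T' (c s) - s = k"
      by (intro has_field_derivative_zero_constant) (use I(1) in \<open>auto simp: is_interval_convex\<close>)
    then have "T' (c t) - t = T' (c t\<^sub>0) - t\<^sub>0" using t by metis
    moreover have "c t \<in> leaf u" unfolding leaf_eq using mem[OF t(2)] by (metis imageI)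
    ultimately show ?thesis by simp
  qed
  ultimately have "flow_leaf W Z (leaf u) T' (\<lambda>t. ?ax (d t))"
    unfolding flow_leaf_def T'_img by (auto simp: leaf_eq T'_ax d)
  moreover have "T' x \<le> T' y \<longleftrightarrow> (\<exists>r\<ge>0. straighten y = straighten x + r *\<^sub>R cell_direction a b e u)"
    if xy: "x \<in> leaf u" "y \<in> leaf u" for x y
  proof -
    let ?j = "other i"
    have x: "same_cell u x" "x $ i = 0" "x $ ?j \<in> ?V" and y: "same_cell u y" "y $ i = 0" "y $ ?j \<in> ?V"
      using xy on_axis half_axis_mem by (auto simp: leaf_def)
    have s: "straighten x $ i = 0" "straighten y $ i = 0"
      using x y on_axis same_cell_trans same_cell_straighten by blast+
    have cell: "same_cell x y" "same_cell y x"
      using x y same_cell_trans same_cell_sym by blast+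
    have "x $ ?j \<le> y $ ?j \<longleftrightarrow> straighten x $ ?j \<le> straighten y $ ?j"
      and "y $ ?j \<le> x $ ?j \<longleftrightarrow> straighten y $ ?j \<le> straighten x $ ?j"
      using straighten_axis_mono[OF x(2) y(2) cell(1)] straighten_axis_mono[OF y(2) x(2) cell(2)]
        plane_eqI_other[of x i y] x(2) y(2)
      by (cases "x $ ?j" "y $ ?j" rule: linorder_cases; auto)+
    then have "T' x \<le> T' y \<longleftrightarrow> \<sigma> * straighten x $ ?j \<le> \<sigma> * straighten y $ ?j"
      using T_le[OF x(3) y(3)] v(2) by (auto simp: T'_def)
    then show ?thesis using line[OF s] by (simp add: v_def)
  qed
  ultimately show ?thesis unfolding oriented_leaf_def by blast
qed

lemma oriented_leaf:
  assumes u: "u \<in> ball 0 \<epsilon>" "u \<noteq> 0"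
  shows "oriented_leaf u"
proof -
  consider i where "u $ i = 0" | "0 < u $ 1 * u $ 2" | "u $ 1 * u $ 2 < 0"
    by (metis linorder_neqE_linordered_idom mult_eq_0_iff)
  then show ?thesis
  proof cases
    case 1
    then show ?thesis using axis_oriented_leaf u by blast
  next
    case 2
    have nz: "u $ i \<noteq> 0" for i using 2 exhaust_2[of i] by auto
    show ?thesis
    proof (rule quadrant_oriented_leaf[OF X.transversal_field_axioms u(1) _ _ _ _ nz])
      show "cell_direction a b e u = vector [a, b]" using 2 by (simp add: cell_direction_def)
      show "(\<exists>t\<ge>0. q = X.flow t p) \<longleftrightarrow> (\<exists>r\<ge>0. straighten q = straighten p + r *\<^sub>R vector [a, b])"
        if "same_cell u p" "same_cell u q" for p q
        using that 2 same_cell_mult_pos_iff(1)[OF that(1)] same_cell_trans[OF same_cell_sym[OF that(1)] that(2)]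
        by (intro straighten_orbit_pos) auto
      show "simple_germ c" if "\<forall>\<^sub>F s in nhds 0. c s \<in> W \<and> same_cell u (c s) \<and> solves_at X c s" for c
        using simple_germ_quadrant(1)[OF 2 that] .
      show "(c has_vector_derivative X (c t)) (at t)"
        if "trajectory_piece W Z I c" "t \<in> I" "same_cell u (c t)" for I c t
        using piece_derivative(1)[OF that(1,2)] same_cell_mult_pos_iff(1)[OF that(3)] 2 by blast
    qed
  next
    case 3
    have nz: "u $ i \<noteq> 0" for i using 3 exhaust_2[of i] by auto
    show ?thesis
    proof (rule quadrant_oriented_leaf[OF Y.transversal_field_axioms u(1) _ _ _ _ nz])
      show "cell_direction a b e u = vector [- a, - b]" using 3 by (simp add: cell_direction_def)
      show "(\<exists>t\<ge>0. q = Y.flow t p) \<longleftrightarrow> (\<exists>r\<ge>0. straighten q = straighten p + r *\<^sub>R vector [- a, - b])"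
        if "same_cell u p" "same_cell u q" for p q
        using that 3 same_cell_mult_pos_iff(2)[OF that(1)] same_cell_trans[OF same_cell_sym[OF that(1)] that(2)]
        by (intro straighten_orbit_neg) auto
      show "simple_germ c" if "\<forall>\<^sub>F s in nhds 0. c s \<in> W \<and> same_cell u (c s) \<and> solves_at Y c s" for c
        using simple_germ_quadrant(2)[OF 3 that] .
      show "(c has_vector_derivative Y (c t)) (at t)"
        if "trajectory_piece W Z I c" "t \<in> I" "same_cell u (c t)" for I c t
        using piece_derivative(2)[OF that(1,2)] same_cell_mult_pos_iff(2)[OF that(3)] 3 by blast
    qed
  qed
qed

end

section \<open>Orientation\<close>

definition circle_point :: "real \<Rightarrow> real \<Rightarrow> plane" where
  "circle_point r t = r *\<^sub>R vector [cos (2 * pi * t), sin (2 * pi * t)]"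

lemma norm_circle_point: "norm (circle_point r t) = \<bar>r\<bar>"
proof -
  have "norm (vector [cos (2 * pi * t), sin (2 * pi * t)] :: plane) = 1"
    by (simp add: norm_vec_def L2_set_def sum_2 add.commute)
  then show ?thesis by (simp add: circle_point_def)
qed

lemma continuous_on_circle_point [continuous_intros]:
  fixes f g :: "'a::t2_space \<Rightarrow> real"
  assumes "continuous_on S f" "continuous_on S g"
  shows "continuous_on S (\<lambda>z. circle_point (f z) (g z))"
  unfolding circle_point_def by (intro continuous_on_scaleR continuous_on_plane continuous_intros assms)

lemma circle_point_periodic [simp]: "circle_point r 1 = circle_point r 0"
  by (simp add: circle_point_def)

lemma bounded_linear_to_complex: "bounded_linear to_complex"
  by (rule linear_conv_bounded_linear[THEN iffD1], rule linearI) (auto simp: to_complex_def complex_eq_iff)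

lemma to_complex_eq_iff [simp]: "to_complex x = to_complex y \<longleftrightarrow> x = y"
  by (simp add: to_complex_def plane_eq_iff)

lemma to_complex_eq_0_iff [simp]: "to_complex x = 0 \<longleftrightarrow> x = 0"
  by (simp add: to_complex_def plane_eq_iff complex_eq_iff)

lemma continuous_on_to_complex [continuous_intros]:
  "continuous_on S f \<Longrightarrow> continuous_on S (\<lambda>z. to_complex (f z))"
  by (rule continuous_on_compose2[OF linear_continuous_on[OF bounded_linear_to_complex, of UNIV]]) auto

definition image_loop :: "vfield \<Rightarrow> plane \<Rightarrow> real \<Rightarrow> real \<Rightarrow> complex" where
  "image_loop h p r t = to_complex (h (p + circle_point r t)) - to_complex (h p)"

context
  fixes W :: "plane set" and h :: vfield
  assumes W: "open W" "connected W" and h: "continuous_on W h" "inj_on h W"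
begin

text \<open>By injectivity of h the image of the moving circle never meets the image of its
centre, which gives a homotopy of loops in the punctured plane.\<close>

lemma winding_number_image_loop_cong:
  fixes P :: "real \<Rightarrow> plane" and R :: "real \<Rightarrow> real"
  assumes P: "continuous_on {0..1} P" and R: "continuous_on {0..1} R"
    and sub: "\<And>s. s \<in> {0..1} \<Longrightarrow> cball (P s) (R s) \<subseteq> W" and pos: "\<And>s. s \<in> {0..1} \<Longrightarrow> 0 < R s"
  shows "winding_number (image_loop h (P 0) (R 0)) 0 = winding_number (image_loop h (P 1) (R 1)) 0"
proof (rule winding_number_homotopic_loops)
  let ?H = "\<lambda>z. image_loop h (P (fst z)) (R (fst z)) (snd z)"
  let ?Q = "{0..1::real} \<times> {0..1::real}"
  have PW: "P s \<in> W" and PcW: "P s + circle_point (R s) t \<in> W" if "s \<in> {0..1}" for s t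
    using sub[OF that] pos[OF that] by (auto simp: subset_iff dist_norm norm_circle_point)
  have contP: "continuous_on ?Q (\<lambda>z. P (fst z))" "continuous_on ?Q (\<lambda>z. R (fst z))"
    by (auto intro!: continuous_intros continuous_on_compose2[OF P] continuous_on_compose2[OF R])
  have "continuous_on ?Q ?H"
    unfolding image_loop_def
    by (intro continuous_intros continuous_on_compose2[OF h(1)] contP) (use PW PcW in auto)
  moreover have "?H z \<noteq> 0" if "z \<in> ?Q" for z
  proof -
    have s: "fst z \<in> {0..1}" using that by auto
    have "circle_point (R (fst z)) (snd z) \<noteq> 0"
      using pos[OF s] norm_circle_point[of "R (fst z)" "snd z"] by (metis abs_zero less_irrefl norm_zero abs_0_eq)
    then have "h (P (fst z) + circle_point (R (fst z)) (snd z)) \<noteq> h (P (fst z))"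
      using inj_onD[OF h(2) _ PcW[OF s] PW[OF s]] by fastforce
    then show ?thesis by (simp add: image_loop_def)
  qed
  ultimately show "homotopic_loops (- {0}) (image_loop h (P 0) (R 0)) (image_loop h (P 1) (R 1))"
    unfolding homotopic_loops
    by (intro exI[of _ ?H]) (auto simp: pathfinish_def pathstart_def image_loop_def)
qed

text \<open>Shrink the circle, move its centre along a path in W, and enlarge it again.\<close>

lemma winding_number_image_loop_eq:
  assumes "0 < r" "cball p r \<subseteq> W" "0 < r'" "cball p' r' \<subseteq> W"
  shows "winding_number (image_loop h p r) 0 = winding_number (image_loop h p' r') 0"
proof -
  have "p \<in> W" "p' \<in> W" using assms by auto
  moreover have "path_connected W" using W by (simp add: connected_open_path_connected)
  ultimately obtain g where g: "path g" "path_image g \<subseteq> W" "pathstart g = p" "pathfinish g = p'"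
    unfolding path_connected_def by blast
  have "compact (path_image g)" using g(1) by (rule compact_path_image)
  then obtain m where m: "m > 0" "(\<Union>x\<in>path_image g. cball x m) \<subseteq> W"
    using compact_subset_open_imp_cball_epsilon_subset[of "path_image g" W] W(1) g(2) by auto
  define k where "k = min m (min r r')"
  have k: "0 < k" "k \<le> m" "k \<le> r" "k \<le> r'" using m assms by (auto simp: k_def)
  have shrink: "winding_number (image_loop h q R) 0 = winding_number (image_loop h q k) 0"
    if "k \<le> R" "cball q R \<subseteq> W" for q R
  proof -
    have bounds: "k \<le> R + s * (k - R) \<and> R + s * (k - R) \<le> R" if "s \<in> {0..1}" for s
    proof -
      have "0 \<le> s * (R - k)" "s * (R - k) \<le> R - k"
        using that \<open>k \<le> R\<close> by (auto intro!: mult_left_le_one_le)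
      then show ?thesis by (simp add: algebra_simps)
    qed
    have "winding_number (image_loop h q (R + 0 * (k - R))) 0 = winding_number (image_loop h q (R + 1 * (k - R))) 0"
    proof (rule winding_number_image_loop_cong[where P="\<lambda>_. q" and R="\<lambda>s. R + s * (k - R)"])
      fix s :: real assume s: "s \<in> {0..1}"
      show "cball q (R + s * (k - R)) \<subseteq> W"
        using subset_cball[of "R + s * (k - R)" R q] bounds[OF s] that(2) by blast
      show "0 < R + s * (k - R)" using bounds[OF s] k(1) by linarith
    qed (intro continuous_intros)+
    then show ?thesis by simp
  qed
  have "winding_number (image_loop h (g 0) k) 0 = winding_number (image_loop h (g 1) k) 0"
  proof (rule winding_number_image_loop_cong[where R="\<lambda>_. k"])
    show "continuous_on {0..1} g" using g(1) by (simp add: path_def)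
    fix s :: real assume "s \<in> {0..1}"
    then have "g s \<in> path_image g" by (simp add: path_image_def)
    then have "cball (g s) m \<subseteq> W" using m by blast
    then show "cball (g s) k \<subseteq> W" using subset_cball[OF k(2)] by blast
  qed (use k in \<open>auto intro: continuous_intros\<close>)
  then show ?thesis
    using shrink[OF k(3) assms(2)] shrink[OF k(4) assms(4)] g by (simp add: pathstart_def pathfinish_def)
qed

text \<open>It suffices to look at circles about the origin. A point and its image lie in the same
cell, so the segment between them avoids the origin and the straight-line homotopy deforms the image
of the circle to the circle.\<close>

lemma orientation_preserving_if_same_cell:
  assumes zero: "0 \<in> W" and cell: "\<And>x. x \<in> W \<Longrightarrow> same_cell x (h x)"
  shows "orientation_preserving W h"
  unfolding orientation_preserving_def
proof (intro ballI allI impI)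
  fix p e assume p: "p \<in> W" "(e::real) > 0" "cball p e \<subseteq> W"
  obtain r where r: "0 < r" "cball 0 r \<subseteq> W" using W(1) zero open_contains_cball by blast
  have h0: "h 0 = 0" using same_cell_eq_0_iff[OF cell[OF zero]] by simp
  have mem: "circle_point r t \<in> W" for t
    using r by (auto simp: subset_iff norm_circle_point)
  have circ: "(\<lambda>t. to_complex (circle_point r t)) = circlepath 0 r"
    by (rule ext) (simp add: circlepath to_complex_def circle_point_def complex_eq_iff Re_exp Im_exp)
  have "homotopic_loops (- {0}) (image_loop h 0 r) (\<lambda>t. to_complex (circle_point r t))"
  proof (rule homotopic_loops_linear)
    show "path (image_loop h 0 r)"
      unfolding path_def image_loop_def
      by (intro continuous_intros continuous_on_compose2[OF h(1)]) (auto simp: mem)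
    show "closed_segment (image_loop h 0 r t) (to_complex (circle_point r t)) \<subseteq> - {0}" if "t \<in> {0..1}" for t
    proof -
      let ?c = "circle_point r t"
      have "?c \<noteq> 0" using r(1) norm_circle_point[of r t] by auto
      have "image_loop h 0 r t = to_complex (h ?c)"
        by (simp add: image_loop_def h0 to_complex_def Complex_eq_0)
      moreover have "closed_segment (to_complex (h ?c)) (to_complex ?c) = to_complex ` closed_segment (h ?c) ?c"
        by (rule closed_segment_linear_image[OF bounded_linear.linear[OF bounded_linear_to_complex]])
      moreover have "closed_segment (h ?c) ?c \<subseteq> {x. same_cell ?c x}"
        using cell[OF mem] by (intro closed_segment_subset convex_cell) auto
      ultimately show ?thesis
        using same_cell_eq_0_iff \<open>?c \<noteq> 0\<close> by fastforce
    qed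
  qed (auto simp: path_def pathfinish_def pathstart_def image_loop_def intro!: continuous_intros)
  then have "winding_number (image_loop h 0 r) 0 = winding_number (circlepath 0 r) 0"
    unfolding circ by (rule winding_number_homotopic_loops)
  also have "\<dots> = 1" using r(1) by (rule winding_number_circlepath_centre)
  finally have "winding_number (image_loop h p e) 0 = 1"
    using winding_number_image_loop_eq[OF p(2,3) r] by simp
  then show "winding_number (\<lambda>t. to_complex (h (p + e *\<^sub>R vector [cos (2 * pi * t), sin (2 * pi * t)])))
      (to_complex (h p)) = 1"
    by (subst winding_number_offset) (simp add: image_loop_def[abs_def] circle_point_def)
qed

end

section \<open>Local equivalence of fields of the same local type\<close>

locale straightened_pair =
  L: straightened X Y K M \<kappa> a b Z \<rho> e \<epsilon> + R: straightened X' Y' K' M' \<kappa>' a b Z' \<rho>' e \<epsilon>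
  for X Y :: vfield and K M \<kappa> a b :: real and Z :: pwfield and \<rho> :: real and e :: "plane \<Rightarrow> real"
    and \<epsilon> :: real and X' Y' :: vfield and K' M' \<kappa>' :: real and Z' :: pwfield and \<rho>' :: real
begin

definition transfer :: vfield where
  "transfer x = R.unstraighten (L.straighten x)"

definition transfer_back :: vfield where
  "transfer_back x = L.unstraighten (R.straighten x)"

lemma straighten_transfer: "x \<in> L.W \<Longrightarrow> R.straighten (transfer x) = L.straighten x"
  by (simp add: transfer_def L.W_def)

lemma transfer_in_W: "x \<in> L.W \<Longrightarrow> transfer x \<in> R.W"
  unfolding R.W_def by (simp add: straighten_transfer) (simp add: L.W_def)

lemma same_cell_transfer: "x \<in> L.W \<Longrightarrow> same_cell x (transfer x)"
  unfolding transfer_def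
  by (rule same_cell_trans[OF L.same_cell_straighten R.same_cell_unstraighten]) (simp add: L.W_def)

lemma homeomorphism_transfer: "homeomorphism L.W R.W transfer transfer_back"
  using homeomorphism_compose[OF L.homeomorphism_straighten homeomorphism_symD[OF R.homeomorphism_straighten]]
  by (simp add: o_def transfer_def[abs_def] transfer_back_def[abs_def])

lemma transfer_surj:
  assumes "y \<in> R.W"
  obtains x where "x \<in> L.W" "y = transfer x"
  using homeomorphism_transfer assms unfolding homeomorphism_def by blast

lemma transfer_zero: "transfer 0 = 0"
  using same_cell_eq_0_iff[OF same_cell_transfer[OF L.zero_in_W]] by simp

lemma transfer_leaf: "transfer ` L.leaf u = R.leaf u"
proof (intro equalityI subsetI)
  fix y assume "y \<in> transfer ` L.leaf u"
  then show "y \<in> R.leaf u"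
    using transfer_in_W straighten_transfer same_cell_trans[OF _ same_cell_transfer]
    by (auto simp: L.leaf_def R.leaf_def)
next
  fix y assume y: "y \<in> R.leaf u"
  then obtain x where x: "x \<in> L.W" "y = transfer x"
    using transfer_surj unfolding R.leaf_def by blast
  then have "x \<in> L.leaf u"
    using y straighten_transfer[OF x(1)] same_cell_trans[OF _ same_cell_sym[OF same_cell_transfer[OF x(1)]]]
    by (auto simp: L.leaf_def R.leaf_def)
  then show "y \<in> transfer ` L.leaf u" using x by blast
qed

lemma maps_trajectories_transfer: "maps_trajectories L.W Z R.W Z' transfer"
proof (rule maps_trajectories_if_leaves[where h=transfer, OF L.stationary_origin_W R.stationary_origin_W transfer_zero])
  fix x assume x: "x \<in> L.W" "x \<noteq> 0"
  define u where "u = L.straighten x"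
  have u: "u \<in> ball 0 \<epsilon>" "u \<noteq> 0"
    using x same_cell_eq_0_iff[OF L.same_cell_straighten[of x]] by (auto simp: u_def L.W_def)
  obtain T d where T: "flow_leaf L.W Z (L.leaf u) T d" "\<And>y z. y \<in> L.leaf u \<Longrightarrow> z \<in> L.leaf u \<Longrightarrow>
      T y \<le> T z \<longleftrightarrow> (\<exists>r\<ge>0. L.straighten z = L.straighten y + r *\<^sub>R cell_direction a b e u)"
    using L.oriented_leaf[OF u] unfolding L.oriented_leaf_def by blast
  obtain T' d' where T': "flow_leaf R.W Z' (R.leaf u) T' d'" "\<And>y z. y \<in> R.leaf u \<Longrightarrow> z \<in> R.leaf u \<Longrightarrow>
      T' y \<le> T' z \<longleftrightarrow> (\<exists>r\<ge>0. R.straighten z = R.straighten y + r *\<^sub>R cell_direction a b e u)"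
    using R.oriented_leaf[OF u] unfolding R.oriented_leaf_def by blast
  have "x \<in> L.leaf u"
    using x same_cell_sym[OF L.same_cell_straighten[of x]]
    by (auto simp: L.leaf_def u_def intro: exI[of _ 0])
  moreover have "T y \<le> T z \<longleftrightarrow> T' (transfer y) \<le> T' (transfer z)" if "y \<in> L.leaf u" "z \<in> L.leaf u" for y z
  proof -
    have "transfer y \<in> R.leaf u" "transfer z \<in> R.leaf u" using that transfer_leaf by blast+
    moreover have "y \<in> L.W" "z \<in> L.W" using that by (auto simp: L.leaf_def)
    ultimately show ?thesis using T(2)[OF that] T'(2) straighten_transfer by simp
  qed
  ultimately show "\<exists>L T d T' d'. x \<in> L \<and> flow_leaf L.W Z L T d \<and> flow_leaf R.W Z' (transfer ` L) T' d' \<and>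
      (\<forall>y\<in>L. \<forall>z\<in>L. T y \<le> T z \<longleftrightarrow> T' (transfer y) \<le> T' (transfer z))"
    using T(1) T'(1) transfer_leaf by (metis (no_types, lifting))
qed

lemma transfer_Sigma: "transfer ` Sigma_set L.W = Sigma_set R.W"
proof -
  have iff: "x $ 1 * x $ 2 = 0 \<longleftrightarrow> transfer x $ 1 * transfer x $ 2 = 0" if "x \<in> L.W" for x
    using same_cell_zero_iff[OF same_cell_transfer[OF that]] by simp
  show ?thesis
  proof (intro equalityI subsetI)
    fix y assume "y \<in> transfer ` Sigma_set L.W"
    then show "y \<in> Sigma_set R.W" using iff transfer_in_W by (auto simp: Sigma_set_def)
  next
    fix y assume y: "y \<in> Sigma_set R.W"
    then obtain x where "x \<in> L.W" "y = transfer x" using transfer_surj by (auto simp: Sigma_set_def)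
    then show "y \<in> transfer ` Sigma_set L.W" using y iff by (auto simp: Sigma_set_def)
  qed
qed

lemma locally_equivalent:
  assumes "ball 0 \<rho> \<subseteq> U" "ball 0 \<rho>' \<subseteq> U"
  shows "locally_equivalent U Z Z'"
proof -
  have "connected L.W"
    using homeomorphic_connectedness[of L.W "ball 0 \<epsilon>"] L.homeomorphism_straighten
    by (auto simp: homeomorphic_def)
  moreover have "continuous_on L.W transfer" "inj_on transfer L.W"
    using homeomorphism_transfer unfolding homeomorphism_def by (auto intro: inj_on_inverseI)
  ultimately have orient: "orientation_preserving L.W transfer"
    using L.open_W L.zero_in_W same_cell_transfer by (intro orientation_preserving_if_same_cell) auto
  show ?thesis
    unfolding locally_equivalent_def
    by (rule exI[of _ L.W], rule exI[of _ R.W], rule exI[of _ transfer], rule exI[of _ transfer_back])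
      (intro conjI orient L.open_W R.open_W L.zero_in_W R.zero_in_W
        order_trans[OF L.W_subset assms(1)] order_trans[OF R.W_subset assms(2)]
        homeomorphism_transfer transfer_Sigma maps_trajectories_transfer)
qed

end

text \<open>Two fields of the same local type have the same straightened trajectories in a common
ball, so the equivalence is one straightening followed by the inverse of the other.\<close>

theorem locally_equivalent_if_same_local_type:
  assumes L: "local_type X Y K M \<kappa> a b Z \<rho> e" and R: "local_type X' Y' K' M' \<kappa>' a b Z' \<rho>' e"
    and "ball 0 \<rho> \<subseteq> U" "ball 0 \<rho>' \<subseteq> U"
  shows "locally_equivalent U Z Z'"
proof -
  interpret L: local_type X Y K M \<kappa> a b Z \<rho> e by fact
  interpret R: local_type X' Y' K' M' \<kappa>' a b Z' \<rho>' e by fact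
  have ball: "\<exists>\<epsilon>>0. ball 0 \<epsilon> \<subseteq> f ` ball 0 r"
    if "continuous_on UNIV f" "inj f" "f 0 = 0" "0 < r" for f :: vfield and r :: real
  proof -
    have "open (f ` ball 0 r)"
      using that by (intro invariance_of_domain) (auto intro: continuous_on_subset inj_on_subset)
    moreover have "0 \<in> f ` ball 0 r" using that by (intro image_eqI[of _ _ 0]) auto
    ultimately show ?thesis using open_contains_ball by blast
  qed
  obtain \<epsilon>1 where 1: "\<epsilon>1 > 0" "ball 0 \<epsilon>1 \<subseteq> L.straighten ` ball 0 \<rho>"
    using ball[OF L.continuous_straighten L.inj_straighten L.straighten_0 L.radius_pos] by blast
  obtain \<epsilon>2 where 2: "\<epsilon>2 > 0" "ball 0 \<epsilon>2 \<subseteq> R.straighten ` ball 0 \<rho>'"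
    using ball[OF R.continuous_straighten R.inj_straighten R.straighten_0 R.radius_pos] by blast
  have "ball (0::plane) (min \<epsilon>1 \<epsilon>2) \<subseteq> ball 0 \<epsilon>1" "ball (0::plane) (min \<epsilon>1 \<epsilon>2) \<subseteq> ball 0 \<epsilon>2"
    by (auto intro: subset_ball)
  then interpret straightened_pair X Y K M \<kappa> a b Z \<rho> e "min \<epsilon>1 \<epsilon>2" X' Y' K' M' \<kappa>' Z' \<rho>'
    using 1 2 by unfold_locales (blast | simp)+
  show ?thesis by (rule locally_equivalent[OF assms(3,4)])
qed

section \<open>Fields of class C^r\<close>

lemma has_derivative_pd:
  assumes "f differentiable (at x)"
  shows "(f has_derivative (\<lambda>v. v $ 1 *\<^sub>R pd 1 f x + v $ 2 *\<^sub>R pd 2 f x)) (at x)"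
proof -
  have f: "(f has_derivative frechet_derivative f (at x)) (at x)"
    using assms by (simp add: frechet_derivative_works[symmetric])
  interpret linear "frechet_derivative f (at x)"
    using f by (rule has_derivative_linear)
  have "frechet_derivative f (at x) v = v $ 1 *\<^sub>R pd 1 f x + v $ 2 *\<^sub>R pd 2 f x" for v
  proof -
    have "v = v $ 1 *\<^sub>R axis 1 1 + v $ 2 *\<^sub>R axis 2 1"
      by (simp add: plane_eq_iff axis_def)
    then have "frechet_derivative f (at x) v = frechet_derivative f (at x) (v $ 1 *\<^sub>R axis 1 1 + v $ 2 *\<^sub>R axis 2 1)"
      by simp
    also have "\<dots> = v $ 1 *\<^sub>R pd 1 f x + v $ 2 *\<^sub>R pd 2 f x"
      by (simp only: add scale pd_def)
    finally show ?thesis .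
  qed
  then have "frechet_derivative f (at x) = (\<lambda>v. v $ 1 *\<^sub>R pd 1 f x + v $ 2 *\<^sub>R pd 2 f x)"
    by (rule ext)
  then show ?thesis using f by simp
qed

lemma pd_eq_derivative: "(f has_derivative f') (at x) \<Longrightarrow> pd i f x = f' (axis i 1)"
  unfolding pd_def by (simp add: frechet_derivative_at[symmetric])

lemma pd_cong_open:
  assumes "open S" "x \<in> S" "\<And>y. y \<in> S \<Longrightarrow> f y = g y"
  shows "pd i f x = pd i g x" "f differentiable (at x) \<longleftrightarrow> g differentiable (at x)"
proof -
  have iff: "(f has_derivative D) (at x) \<longleftrightarrow> (g has_derivative D) (at x)" for D
    using has_derivative_transform_within_open[OF _ assms(1,2)] assms(3) by metis
  show "pd i f x = pd i g x" unfolding pd_def frechet_derivative_def iff ..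
  show "f differentiable (at x) \<longleftrightarrow> g differentiable (at x)" unfolding differentiable_def iff ..
qed

definition quadratic_curve :: "vfield \<Rightarrow> vfield \<Rightarrow> vfield \<Rightarrow> real \<Rightarrow> vfield" where
  "quadratic_curve A B C t = (\<lambda>x. A x + t *\<^sub>R B x + t\<^sup>2 *\<^sub>R C x)"

text \<open>The k-th derivative of the curve A + t B + t^2 C: differentiation replaces the
coefficients (A, B, C) by (B, 2 C, 0).\<close>

primrec quadratic_derivative :: "nat \<Rightarrow> vfield \<Rightarrow> vfield \<Rightarrow> vfield \<Rightarrow> real \<Rightarrow> vfield" where
  "quadratic_derivative 0 A B C = quadratic_curve A B C"
| "quadratic_derivative (Suc k) A B C = quadratic_derivative k B (\<lambda>x. 2 *\<^sub>R C x) (\<lambda>_. 0)"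

context
  fixes U :: "plane set" and r :: nat
  assumes U: "open U" "bounded U" "0 \<in> U"
begin

lemma Cr_pds_differentiable:
  "f \<in> Cr r U \<Longrightarrow> length is < r \<Longrightarrow> x \<in> U \<Longrightarrow> pds is f differentiable (at x)"
  by (simp add: Cr_def)

text \<open>Linearity of iterated partial derivatives needs the differentiability of all derivatives
of lower order in a neighbourhood, hence the restrictions to U and to order r.\<close>

lemma pds_linear_combination:
  assumes f: "f \<in> Cr r U" and g: "g \<in> Cr r U"
  shows "length is \<le> r \<Longrightarrow> x \<in> U \<Longrightarrow>
    pds is (\<lambda>x. \<alpha> *\<^sub>R f x + \<beta> *\<^sub>R g x) x = \<alpha> *\<^sub>R pds is f x + \<beta> *\<^sub>R pds is g x"
proof (induction "is" arbitrary: x)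
  case (Cons i "is")
  have fg: "pds is f differentiable (at x)" "pds is g differentiable (at x)"
    using Cons.prems f g Cr_pds_differentiable by auto
  have "pd i (pds is (\<lambda>x. \<alpha> *\<^sub>R f x + \<beta> *\<^sub>R g x)) x = pd i (\<lambda>x. \<alpha> *\<^sub>R pds is f x + \<beta> *\<^sub>R pds is g x) x"
    by (rule pd_cong_open(1)[OF U(1) Cons.prems(2)]) (use Cons in auto)
  also have "\<dots> = \<alpha> *\<^sub>R pd i (pds is f) x + \<beta> *\<^sub>R pd i (pds is g) x"
    using fg unfolding frechet_derivative_works
    by (subst pd_eq_derivative) (auto intro!: derivative_intros simp: pd_def)
  finally show ?case by simp
qed simp

lemma Cr_linear_combination:
  assumes f: "f \<in> Cr r U" and g: "g \<in> Cr r U"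
  shows "(\<lambda>x. \<alpha> *\<^sub>R f x + \<beta> *\<^sub>R g x) \<in> Cr r U"
  unfolding Cr_def mem_Collect_eq
proof (intro conjI allI impI ballI)
  show "x \<notin> closure U \<Longrightarrow> \<alpha> *\<^sub>R f x + \<beta> *\<^sub>R g x = 0" for x
    using f g by (simp add: Cr_def)
  show "continuous_on (closure U) (\<lambda>x. \<alpha> *\<^sub>R f x + \<beta> *\<^sub>R g x)"
    using f g by (auto simp: Cr_def intro!: continuous_intros)
  fix "is" :: "2 list"
  show "pds is (\<lambda>x. \<alpha> *\<^sub>R f x + \<beta> *\<^sub>R g x) differentiable (at x)" if "length is < r" "x \<in> U" for x
  proof -
    have "(\<lambda>x. \<alpha> *\<^sub>R pds is f x + \<beta> *\<^sub>R pds is g x) differentiable (at x)"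
      using Cr_pds_differentiable[OF f that] Cr_pds_differentiable[OF g that] by (intro derivative_intros) auto
    then show ?thesis
      by (subst pd_cong_open(2)[OF U(1) that(2), where g="\<lambda>x. \<alpha> *\<^sub>R pds is f x + \<beta> *\<^sub>R pds is g x"])
        (use that pds_linear_combination[OF f g] in auto)
  qed
  assume len: "length is \<le> r"
  obtain f' g' where "continuous_on (closure U) f'" "\<forall>x\<in>U. f' x = pds is f x"
    "continuous_on (closure U) g'" "\<forall>x\<in>U. g' x = pds is g x"
    using f g len unfolding Cr_def by blast
  then show "\<exists>h. continuous_on (closure U) h \<and> (\<forall>x\<in>U. h x = pds is (\<lambda>x. \<alpha> *\<^sub>R f x + \<beta> *\<^sub>R g x) x)"
    using pds_linear_combination[OF f g len]
    by (intro exI[of _ "\<lambda>x. \<alpha> *\<^sub>R f' x + \<beta> *\<^sub>R g' x"]) (auto intro!: continuous_intros)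
qed

lemma pds_constant:
  assumes "x \<in> U"
  shows "pds is (restrict_field U (\<lambda>_. v)) x = (if is = [] then v else 0)"
  using assms
proof (induction "is" arbitrary: x)
  case Nil
  then show ?case using closure_subset by (auto simp: restrict_field_def)
next
  case (Cons i "is")
  have "pd i (pds is (restrict_field U (\<lambda>_. v))) x = pd i (\<lambda>_. if is = [] then v else 0) x"
    by (rule pd_cong_open(1)[OF U(1) Cons.prems]) (use Cons in auto)
  also have "\<dots> = 0" by (subst pd_eq_derivative[OF has_derivative_const]) simp
  finally show ?case by simp
qed

lemma Cr_constant: "restrict_field U (\<lambda>_. v) \<in> Cr r U"
  unfolding Cr_def mem_Collect_eq
proof (intro conjI allI impI ballI)
  show "continuous_on (closure U) (restrict_field U (\<lambda>_. v))"
    by (rule continuous_on_eq[OF continuous_on_const[of _ v]]) (simp add: restrict_field_def)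
  fix "is" :: "2 list"
  show "pds is (restrict_field U (\<lambda>_. v)) differentiable (at x)" if "x \<in> U" for x
    by (subst pd_cong_open(2)[OF U(1) that, where g="\<lambda>_. if is = [] then v else 0"])
      (use pds_constant in auto)
  show "\<exists>g. continuous_on (closure U) g \<and> (\<forall>x\<in>U. g x = pds is (restrict_field U (\<lambda>_. v)) x)"
    using pds_constant by (intro exI[of _ "\<lambda>_. if is = [] then v else 0"]) auto
qed (simp add: restrict_field_def)

lemma Cr_zero: "(\<lambda>_. 0) \<in> Cr r U"
proof -
  have "restrict_field U (\<lambda>_. 0) = (\<lambda>_. 0)" by (rule ext) (simp add: restrict_field_def)
  then show ?thesis using Cr_constant[of 0] by simp
qed

lemma Cr_scale: "f \<in> Cr r U \<Longrightarrow> (\<lambda>x. \<alpha> *\<^sub>R f x) \<in> Cr r U"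
  using Cr_linear_combination[of f f \<alpha> 0] by simp

text \<open>All derivatives up to order r extend continuously to the compact closure, and there are
finitely many of them. Without boundedness the supremum in the norm would bound nothing.\<close>

lemma Cr_bdd_above:
  assumes f: "f \<in> Cr r U"
  shows "bdd_above ((\<lambda>(is, x). norm (pds is f x)) ` ({is. length is \<le> r} \<times> U))"
proof -
  have "\<exists>B. \<forall>x\<in>U. norm (pds is f x) \<le> B" if "length is \<le> r" for "is"
  proof -
    obtain g where g: "continuous_on (closure U) g" "\<forall>x\<in>U. g x = pds is f x"
      using f \<open>length is \<le> r\<close> unfolding Cr_def by blast
    have "compact (closure U)" using U(2) by (simp add: compact_closure)
    then have "bounded (g ` closure U)" using g(1) by (intro compact_imp_bounded compact_continuous_image)
    then obtain B where "\<forall>y\<in>g ` closure U. norm y \<le> B" unfolding bounded_iff by blast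
    then show ?thesis using g(2) closure_subset by (metis image_eqI subsetD)
  qed
  then obtain B where B: "\<And>is x. length is \<le> r \<Longrightarrow> x \<in> U \<Longrightarrow> norm (pds is f x) \<le> B is" by metis
  have fin: "finite {is :: 2 list. length is \<le> r}"
    using finite_lists_length_le[of "UNIV :: 2 set" r] by simp
  show ?thesis
  proof (rule bdd_aboveI)
    fix y assume "y \<in> (\<lambda>(is, x). norm (pds is f x)) ` ({is. length is \<le> r} \<times> U)"
    then obtain "is" x where "length is \<le> r" "x \<in> U" "y = norm (pds is f x)" by auto
    then have "y \<le> B is" "B is \<le> Max (B ` {is. length is \<le> r})" using B fin by auto
    then show "y \<le> Max (B ` {is. length is \<le> r})" by linarith
  qed
qed

lemma norm_pds_le_Cr_norm:
  assumes "f \<in> Cr r U" "length is \<le> r" "x \<in> U"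
  shows "norm (pds is f x) \<le> Cr_norm r U f"
  using cSUP_upper[OF _ Cr_bdd_above[OF assms(1)], of "(is, x)"] assms(2,3) by (simp add: Cr_norm_def)

lemma norm_le_Cr_norm: "f \<in> Cr r U \<Longrightarrow> x \<in> U \<Longrightarrow> norm (f x) \<le> Cr_norm r U f"
  using norm_pds_le_Cr_norm[of f "[]" x] by simp

lemma Cr_norm_scale_le:
  assumes f: "f \<in> Cr r U"
  shows "Cr_norm r U (\<lambda>x. \<alpha> *\<^sub>R f x) \<le> \<bar>\<alpha>\<bar> * Cr_norm r U f"
  unfolding Cr_norm_def[of r U "\<lambda>x. \<alpha> *\<^sub>R f x"]
proof (rule cSUP_least)
  show "{is::2 list. length is \<le> r} \<times> U \<noteq> {}" using U(3) by (auto intro: exI[of _ "[]"])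
  fix z :: "2 list \<times> plane" assume "z \<in> {is. length is \<le> r} \<times> U"
  then obtain "is" x where z: "z = (is, x)" "length is \<le> r" "x \<in> U" by auto
  then have "pds is (\<lambda>x. \<alpha> *\<^sub>R f x) x = \<alpha> *\<^sub>R pds is f x"
    using pds_linear_combination[OF f f, of "is" x \<alpha> 0] by simp
  then show "(case z of (is, x) \<Rightarrow> norm (pds is (\<lambda>x. \<alpha> *\<^sub>R f x) x)) \<le> \<bar>\<alpha>\<bar> * Cr_norm r U f"
    using norm_pds_le_Cr_norm[OF f z(2,3)] z by (simp add: mult_left_mono)
qed

lemma quadratic_curve_in_Cr:
  assumes "A \<in> Cr r U" "B \<in> Cr r U" "C \<in> Cr r U"
  shows "quadratic_curve A B C t \<in> Cr r U"
  using Cr_linear_combination[OF Cr_linear_combination[OF assms(1,2), of 1 t] assms(3), of 1 "t\<^sup>2"]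
  by (simp add: quadratic_curve_def)

lemma quadratic_curve_derivative:
  assumes C: "C \<in> Cr r U"
  shows "has_Cr_derivative r U (quadratic_curve A B C) (quadratic_curve B (\<lambda>x. 2 *\<^sub>R C x) (\<lambda>_. 0) t) t"
  unfolding has_Cr_derivative_def
proof (rule Lim_null_comparison)
  have eq: "(\<lambda>x. (quadratic_curve A B C (t + h) x - quadratic_curve A B C t x) /\<^sub>R h
      - quadratic_curve B (\<lambda>x. 2 *\<^sub>R C x) (\<lambda>_. 0) t x) = (\<lambda>x. h *\<^sub>R C x)" if "h \<noteq> 0" for h
  proof
    fix x
    have "quadratic_curve A B C (t + h) x - quadratic_curve A B C t x =
        h *\<^sub>R (B x + (2 * t) *\<^sub>R C x + h *\<^sub>R C x)"
      by (simp add: quadratic_curve_def algebra_simps power2_eq_square)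
    then show "(quadratic_curve A B C (t + h) x - quadratic_curve A B C t x) /\<^sub>R h
        - quadratic_curve B (\<lambda>x. 2 *\<^sub>R C x) (\<lambda>_. 0) t x = h *\<^sub>R C x"
      using that by (simp add: quadratic_curve_def mult.commute)
  qed
  have "0 \<le> Cr_norm r U (\<lambda>x. h *\<^sub>R C x)" for h
    using norm_le_Cr_norm[OF Cr_scale[OF C] U(3), of h] norm_ge_zero order_trans by blast
  then show "\<forall>\<^sub>F h in at 0. norm (Cr_norm r U (\<lambda>x. (quadratic_curve A B C (t + h) x - quadratic_curve A B C t x) /\<^sub>R h
      - quadratic_curve B (\<lambda>x. 2 *\<^sub>R C x) (\<lambda>_. 0) t x)) \<le> \<bar>h\<bar> * Cr_norm r U C"
    using Cr_norm_scale_le[OF C] by (auto simp: eq eventually_at_filter)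
  have "((\<lambda>h. \<bar>h\<bar> * Cr_norm r U C) \<longlongrightarrow> \<bar>0\<bar> * Cr_norm r U C) (at 0)" by (intro tendsto_intros)
  then show "((\<lambda>h. \<bar>h\<bar> * Cr_norm r U C) \<longlongrightarrow> 0) (at 0)" by simp
qed

lemma quadratic_derivative_props:
  assumes "A \<in> Cr r U" "B \<in> Cr r U" "C \<in> Cr r U"
  shows "quadratic_derivative k A B C t \<in> Cr r U"
    "has_Cr_derivative r U (quadratic_derivative k A B C) (quadratic_derivative (Suc k) A B C t) t"
  using assms
proof (induction k arbitrary: A B C)
  case 0
  { case 1 then show ?case by (simp add: quadratic_curve_in_Cr) }
  { case 2 then show ?case using quadratic_curve_derivative[of C A B t] by simp }
next
  case (Suc k)
  { case 1 then show ?case using Suc.IH(1)[of B "\<lambda>x. 2 *\<^sub>R C x" "\<lambda>_. 0"] by (simp add: Cr_scale Cr_zero) }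
  { case 2 then show ?case using Suc.IH(2)[of B "\<lambda>x. 2 *\<^sub>R C x" "\<lambda>_. 0"] by (simp add: Cr_scale Cr_zero) }
qed

lemma smooth_quadratic_curve:
  assumes "A \<in> Cr r U" "B \<in> Cr r U" "C \<in> Cr r U" "A' \<in> Cr r U" "B' \<in> Cr r U" "C' \<in> Cr r U"
  shows "smooth_curve r U I (\<lambda>t. (quadratic_curve A B C t, quadratic_curve A' B' C' t))"
    "has_Omega_derivative r U (\<lambda>t. (quadratic_curve A B C t, quadratic_curve A' B' C' t)) (B, B') 0"
proof -
  show "smooth_curve r U I (\<lambda>t. (quadratic_curve A B C t, quadratic_curve A' B' C' t))"
    unfolding smooth_curve_def has_Omega_derivative_def Omega_def
    by (rule exI[of _ "\<lambda>k t. (quadratic_derivative k A B C t, quadratic_derivative k A' B' C' t)"])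
      (use quadratic_derivative_props[OF assms(1-3)] quadratic_derivative_props[OF assms(4-6)] in \<open>simp add: eta_contract_eq\<close>)
  show "has_Omega_derivative r U (\<lambda>t. (quadratic_curve A B C t, quadratic_curve A' B' C' t)) (B, B') 0"
    using quadratic_curve_derivative[OF assms(3), of A B 0] quadratic_curve_derivative[OF assms(6), of A' B' 0]
    by (simp add: has_Omega_derivative_def quadratic_curve_def[of B] quadratic_curve_def[of B'])
qed

lemma Cr_differentiable: "f \<in> Cr r U \<Longrightarrow> 1 \<le> r \<Longrightarrow> x \<in> U \<Longrightarrow> f differentiable (at x)"
  using Cr_pds_differentiable[of f "[]" x] by simp

lemma Cr_locally_lipschitz:
  assumes f: "f \<in> Cr r U" and r: "1 \<le> r"
  obtains \<rho> K where "0 < \<rho>" "0 < K" "cball 0 \<rho> \<subseteq> U"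
    "\<And>x y. x \<in> cball 0 \<rho> \<Longrightarrow> y \<in> cball 0 \<rho> \<Longrightarrow> norm (f x - f y) \<le> K * norm (x - y)"
proof -
  obtain \<rho> where \<rho>: "0 < \<rho>" "cball 0 \<rho> \<subseteq> U" using U(1,3) open_contains_cball by blast
  define B where "B = Cr_norm r U f"
  have B: "norm (pd i f x) \<le> B" if "x \<in> U" for i x
    using norm_pds_le_Cr_norm[OF f, of "[i]" x] that r by (simp add: B_def)
  have B0: "0 \<le> B" using B[OF U(3)] norm_ge_zero order_trans by blast
  have "norm (f x - f y) \<le> (2 * B) * norm (x - y)" if xy: "x \<in> cball 0 \<rho>" "y \<in> cball 0 \<rho>" for x y
  proof (rule differentiable_bound[where f'="\<lambda>x v. v $ 1 *\<^sub>R pd 1 f x + v $ 2 *\<^sub>R pd 2 f x", OF convex_cball _ _ xy])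
    fix x assume "x \<in> cball (0::plane) \<rho>"
    then have x: "x \<in> U" using \<rho> by blast
    show "(f has_derivative (\<lambda>v. v $ 1 *\<^sub>R pd 1 f x + v $ 2 *\<^sub>R pd 2 f x)) (at x within cball 0 \<rho>)"
      by (rule has_derivative_at_withinI[OF has_derivative_pd[OF Cr_differentiable[OF f r x]]])
    show "onorm (\<lambda>v::plane. v $ 1 *\<^sub>R pd 1 f x + v $ 2 *\<^sub>R pd 2 f x) \<le> 2 * B"
    proof (rule onorm_le)
      fix v :: plane
      have "norm (v $ i *\<^sub>R pd i f x) \<le> norm v * B" for i
        using component_le_norm_cart[of v i] B[OF x, of i] by (simp add: mult_mono)
      from norm_triangle_le[OF add_mono[OF this[of 1] this[of 2]]]
      show "norm (v $ 1 *\<^sub>R pd 1 f x + v $ 2 *\<^sub>R pd 2 f x) \<le> 2 * B * norm v"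
        by (simp add: mult_ac)
    qed
  qed
  then have "norm (f x - f y) \<le> (2 * B + 1) * norm (x - y)" if "x \<in> cball 0 \<rho>" "y \<in> cball 0 \<rho>" for x y
    using that by (smt (verit, best) mult_right_mono norm_ge_zero)
  then show ?thesis using that[of \<rho> "2 * B + 1"] \<rho> B0 by simp
qed

end

lemma detZ_has_derivative:
  assumes "F differentiable (at x)" "G differentiable (at x)"
  shows "(detZ (F, G) has_derivative (\<lambda>v. frechet_derivative F (at x) v $ 1 * G x $ 2 + F x $ 1 * frechet_derivative G (at x) v $ 2
      - (frechet_derivative F (at x) v $ 2 * G x $ 1 + F x $ 2 * frechet_derivative G (at x) v $ 1))) (at x)"
proof -
  have *: "((\<lambda>x. H x $ i) has_derivative (\<lambda>v. frechet_derivative H (at x) v $ i)) (at x)"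
    if "H differentiable (at x)" for H :: vfield and i
    using bounded_linear.has_derivative[OF bounded_linear_vec_nth] that unfolding frechet_derivative_works by blast
  show ?thesis
    unfolding detZ_def fst_conv snd_conv
    by (rule has_derivative_eq_rhs, rule has_derivative_diff; (rule has_derivative_mult)?)
      (use *[OF assms(1)] *[OF assms(2)] in \<open>auto simp: fun_eq_iff\<close>)
qed

lemma pd_detZ:
  assumes "F differentiable (at x)" "G differentiable (at x)"
  shows "pd i (detZ (F, G)) x = pd i F x $ 1 * G x $ 2 + F x $ 1 * pd i G x $ 2
      - (pd i F x $ 2 * G x $ 1 + F x $ 2 * pd i G x $ 1)"
  using pd_eq_derivative[OF detZ_has_derivative[OF assms], of i] by (simp add: pd_def)

section \<open>The determinant at the origin along a transverse unfolding\<close>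

text \<open>The derivative of the functional det Z(0) at Z in the direction V.\<close>

definition det_velocity :: "pwfield \<Rightarrow> pwfield \<Rightarrow> real" where
  "det_velocity Z V = fst V 0 $ 1 * snd Z 0 $ 2 + fst Z 0 $ 1 * snd V 0 $ 2
     - (fst V 0 $ 2 * snd Z 0 $ 1 + fst Z 0 $ 2 * snd V 0 $ 1)"

lemma pd_quadratic_curve:
  assumes "A differentiable (at x)" "B differentiable (at x)" "C differentiable (at x)"
  shows "pd i (quadratic_curve A B C t) x = pd i A x + t *\<^sub>R pd i B x + t\<^sup>2 *\<^sub>R pd i C x"
    "quadratic_curve A B C t differentiable (at x)"
proof -
  have "(quadratic_curve A B C t has_derivative (\<lambda>v. frechet_derivative A (at x) v
      + t *\<^sub>R frechet_derivative B (at x) v + t\<^sup>2 *\<^sub>R frechet_derivative C (at x) v)) (at x)"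
    using assms unfolding quadratic_curve_def frechet_derivative_works by (auto intro!: derivative_eq_intros)
  from pd_eq_derivative[OF this, of i] this
  show "pd i (quadratic_curve A B C t) x = pd i A x + t *\<^sub>R pd i B x + t\<^sup>2 *\<^sub>R pd i C x"
    "quadratic_curve A B C t differentiable (at x)"
    by (auto simp add: pd_def intro: differentiableI)
qed

lemma isCont_tendsto_nhds: "isCont f x \<Longrightarrow> (f \<longlongrightarrow> f x) (nhds x)"
  by (simp add: continuous_at tendsto_at_iff_tendsto_nhds)

text \<open>Let Z = (X, Y) and V = (A, B). Since det Z(0) = 0, the vectors at the origin satisfy
Y = - l X. If det Z(0) did not change to first order in the direction V, then also B = - l A - m X
for some m. Adding - m A(0) t^2 to the second component of Z + t V gives X + t A and
- (l + t m) (X + t A) at the origin, whose determinant is 0 for all t. Hence V would be tangent to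
the set of degenerate fields.\<close>

lemma det_velocity_nonzero:
  assumes U: "open U" "bounded U" "0 \<in> U" and r: "1 \<le> r"
    and Z: "Z \<in> Xi11 r U" and V: "V \<in> Omega r U" "V \<notin> tangent_space r U (Xi11 r U) Z"
  shows "det_velocity Z V \<noteq> 0"
proof
  assume zero: "det_velocity Z V = 0"
  obtain X Y A B where eqs: "Z = (X, Y)" "V = (A, B)" by (metis prod.collapse)
  have XY: "X \<in> Cr r U" "Y \<in> Cr r U" and AB: "A \<in> Cr r U" "B \<in> Cr r U"
    using Z V by (auto simp: eqs Xi11_def Omega_def)
  have opp: "\<And>i. X 0 $ i * Y 0 $ i < 0" and det: "X 0 $ 1 * Y 0 $ 2 = X 0 $ 2 * Y 0 $ 1"
    and pd: "\<And>i. pd i (detZ Z) 0 \<noteq> 0"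
    using Z by (auto simp: eqs Xi11_def detZ_def)
  have nz: "X 0 $ 1 \<noteq> 0" using opp[of 1] by auto
  define l where "l = - Y 0 $ 1 / X 0 $ 1"
  define m where "m = - (B 0 $ 1 + l * A 0 $ 1) / X 0 $ 1"
  have Y0: "Y 0 $ i = - l * X 0 $ i" for i
    using nz det exhaust_2[of i] by (auto simp: l_def field_simps)
  have B0: "B 0 $ i = - l * A 0 $ i - m * X 0 $ i" for i
  proof -
    have 1: "m * X 0 $ 1 = - (B 0 $ 1 + l * A 0 $ 1)" using nz by (simp add: m_def)
    have "X 0 $ 1 * B 0 $ 2 = X 0 $ 1 * (- l * A 0 $ 2) + X 0 $ 2 * (B 0 $ 1 + l * A 0 $ 1)"
      using zero unfolding det_velocity_def eqs fst_conv snd_conv Y0 by (simp add: algebra_simps)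
    also have "B 0 $ 1 + l * A 0 $ 1 = - (m * X 0 $ 1)" using 1 by simp
    finally have "X 0 $ 1 * B 0 $ 2 = X 0 $ 1 * (- l * A 0 $ 2 - m * X 0 $ 2)" by (simp add: algebra_simps)
    then have "B 0 $ 2 = - l * A 0 $ 2 - m * X 0 $ 2" using nz by simp
    then show ?thesis using 1 exhaust_2[of i] by auto
  qed
  define C where "C = (\<lambda>x. (- m) *\<^sub>R restrict_field U (\<lambda>_. A 0) x)"
  have C: "C \<in> Cr r U" unfolding C_def by (intro Cr_scale Cr_constant U)
  have C0: "C 0 = - m *\<^sub>R A 0" using U(3) closure_subset by (auto simp: C_def restrict_field_def)
  define \<sigma> where "\<sigma> t = (quadratic_curve X A (\<lambda>_. 0) t, quadratic_curve Y B C t)" for t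
  note zero_Cr = Cr_zero[OF U]
  have smooth: "smooth_curve r U I \<sigma>" for I
    using smooth_quadratic_curve(1)[OF U XY(1) AB(1) zero_Cr XY(2) AB(2) C] by (simp add: \<sigma>_def[abs_def])
  have deriv: "has_Omega_derivative r U \<sigma> V 0"
    using smooth_quadratic_curve(2)[OF U XY(1) AB(1) zero_Cr XY(2) AB(2) C] by (simp add: \<sigma>_def[abs_def] eqs)
  have \<sigma>0: "\<sigma> 0 = Z" by (simp add: \<sigma>_def eqs quadratic_curve_def)
  have Omega: "\<sigma> t \<in> Omega r U" for t
    unfolding \<sigma>_def Omega_def by (intro SigmaI quadratic_curve_in_Cr U XY AB C zero_Cr)
  have val: "fst (\<sigma> t) 0 $ i = X 0 $ i + t * A 0 $ i"
    "snd (\<sigma> t) 0 $ i = Y 0 $ i + t * B 0 $ i - t\<^sup>2 * (m * A 0 $ i)" for t i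
    by (simp_all add: \<sigma>_def quadratic_curve_def C0)
  have det0: "detZ (\<sigma> t) 0 = 0" for t
    unfolding detZ_def val Y0 B0 by (simp add: algebra_simps power2_eq_square)
  have diff: "f differentiable (at 0)" if "f \<in> Cr r U" for f
    by (rule Cr_differentiable[OF U that r U(3)])
  have cont: "isCont (\<lambda>t. pd i (detZ (\<sigma> t)) 0) 0" for i
  proof -
    note d1 = pd_quadratic_curve[OF diff[OF XY(1)] diff[OF AB(1)] diff[OF zero_Cr]]
    note d2 = pd_quadratic_curve[OF diff[OF XY(2)] diff[OF AB(2)] diff[OF C]]
    have "pd i (detZ (\<sigma> t)) 0 =
       (pd i X 0 + t *\<^sub>R pd i A 0 + t\<^sup>2 *\<^sub>R pd i (\<lambda>_. 0 :: plane) 0) $ 1 * snd (\<sigma> t) 0 $ 2 +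
       fst (\<sigma> t) 0 $ 1 * (pd i Y 0 + t *\<^sub>R pd i B 0 + t\<^sup>2 *\<^sub>R pd i C 0) $ 2 -
       ((pd i X 0 + t *\<^sub>R pd i A 0 + t\<^sup>2 *\<^sub>R pd i (\<lambda>_. 0 :: plane) 0) $ 2 * snd (\<sigma> t) 0 $ 1 +
       fst (\<sigma> t) 0 $ 2 * (pd i Y 0 + t *\<^sub>R pd i B 0 + t\<^sup>2 *\<^sub>R pd i C 0) $ 1)" for t
      unfolding \<sigma>_def by (subst pd_detZ[OF d1(2) d2(2)]) (simp only: d1(1) d2(1) fst_conv snd_conv)
    then show ?thesis unfolding val by (simp only:) (intro continuous_intros)
  qed
  have "\<forall>\<^sub>F t in nhds 0. \<forall>i. fst (\<sigma> t) 0 $ i * snd (\<sigma> t) 0 $ i < 0"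
  proof (rule eventually_all_finite)
    fix i
    have "isCont (\<lambda>t. fst (\<sigma> t) 0 $ i * snd (\<sigma> t) 0 $ i) 0"
      unfolding val by (intro continuous_intros)
    from isCont_tendsto_nhds[OF this]
    have "((\<lambda>t. fst (\<sigma> t) 0 $ i * snd (\<sigma> t) 0 $ i) \<longlongrightarrow> X 0 $ i * Y 0 $ i) (nhds 0)"
      unfolding \<sigma>0 by (simp add: eqs)
    then show "\<forall>\<^sub>F t in nhds 0. fst (\<sigma> t) 0 $ i * snd (\<sigma> t) 0 $ i < 0"
      using opp[of i] by (rule order_tendstoD)
  qed
  moreover have "\<forall>\<^sub>F t in nhds 0. \<forall>i. pd i (detZ (\<sigma> t)) 0 \<noteq> 0"
  proof (rule eventually_all_finite)
    fix i
    have "((\<lambda>t. pd i (detZ (\<sigma> t)) 0) \<longlongrightarrow> pd i (detZ Z) 0) (nhds 0)"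
      using isCont_tendsto_nhds[OF cont[of i]] unfolding \<sigma>0 .
    then show "\<forall>\<^sub>F t in nhds 0. pd i (detZ (\<sigma> t)) 0 \<noteq> 0"
      using pd[of i] by (rule tendsto_imp_eventually_ne)
  qed
  ultimately have "\<forall>\<^sub>F t in nhds 0. \<sigma> t \<in> Xi11 r U"
    by eventually_elim (simp add: Xi11_def Omega det0)
  then obtain d where d: "d > 0" "\<And>t. dist t 0 < d \<Longrightarrow> \<sigma> t \<in> Xi11 r U"
    unfolding eventually_nhds_metric by blast
  have "V \<in> tangent_space r U (Xi11 r U) Z"
    unfolding tangent_space_def
    using V(1) d smooth deriv \<sigma>0 by (auto intro!: exI[of _ d] exI[of _ \<sigma>] simp: dist_real_def)
  then show False using V(2) by blast
qed

lemma Cr_curve_component_derivative: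
  assumes U: "open U" "bounded U" "0 \<in> U" and "0 < d" and g: "\<And>t. \<bar>t\<bar> < d \<Longrightarrow> g t \<in> Cr r U" and D: "D \<in> Cr r U"
    and deriv: "has_Cr_derivative r U g D 0"
  shows "((\<lambda>t. g t 0 $ i) has_real_derivative D 0 $ i) (at 0)"
  unfolding DERIV_def
proof (rule LIM_zero_cancel, rule Lim_null_comparison)
  let ?q = "\<lambda>h x. (g (0 + h) x - g 0 x) /\<^sub>R h - D x"
  show "((\<lambda>h. Cr_norm r U (?q h)) \<longlongrightarrow> 0) (at 0)"
    using deriv by (simp add: has_Cr_derivative_def)
  have "norm ((g (0 + h) 0 $ i - g 0 0 $ i) / h - D 0 $ i) \<le> Cr_norm r U (?q h)" if h: "\<bar>h\<bar> < d" for h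
  proof -
    have "(\<lambda>x. (inverse h) *\<^sub>R g (0 + h) x + (- inverse h) *\<^sub>R g 0 x) \<in> Cr r U"
      using h \<open>0 < d\<close> by (intro Cr_linear_combination U g) auto
    from Cr_linear_combination[OF U this D, of 1 "- 1"]
    have "(\<lambda>x. 1 *\<^sub>R ((inverse h) *\<^sub>R g (0 + h) x + (- inverse h) *\<^sub>R g 0 x) + (- 1) *\<^sub>R D x) \<in> Cr r U" .
    then have "?q h \<in> Cr r U" by (simp add: algebra_simps)
    then have "norm (?q h 0) \<le> Cr_norm r U (?q h)" by (rule norm_le_Cr_norm[OF U _ U(3)])
    moreover have "?q h 0 $ i = (g (0 + h) 0 $ i - g 0 0 $ i) / h - D 0 $ i"
      by (simp add: divide_inverse mult.commute)
    ultimately show ?thesis using component_le_norm_cart[of "?q h 0" i] by simp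
  qed
  then show "\<forall>\<^sub>F h in at 0. norm ((g (0 + h) 0 $ i - g 0 0 $ i) / h - D 0 $ i) \<le> Cr_norm r U (?q h)"
    using \<open>0 < d\<close> unfolding eventually_at by (intro exI[of _ d]) (simp add: dist_real_def)
qed

section \<open>The local types in both families\<close>

text \<open>The sign of det Z on the half axes: it is the sign s of det Z(0) if this is not 0, and
otherwise it is found from the partial derivatives, where c_1 and c_2 are the signs of those with
respect to x_2 and x_1.\<close>

definition axis_sign :: "real \<Rightarrow> real \<Rightarrow> real \<Rightarrow> plane \<Rightarrow> real" where
  "axis_sign s c\<^sub>1 c\<^sub>2 p = (if s \<noteq> 0 then s else if p $ 1 \<noteq> 0 then c\<^sub>2 * sgn (p $ 1) else c\<^sub>1 * sgn (p $ 2))"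

lemma axis_sign_cell: "same_cell p q \<Longrightarrow> axis_sign s c\<^sub>1 c\<^sub>2 p = axis_sign s c\<^sub>1 c\<^sub>2 q"
  using same_cell_zero_iff[of p q 1] by (simp add: axis_sign_def same_cell_def)

lemma axis_sign_unit:
  assumes "c\<^sub>1 = 1 \<or> c\<^sub>1 = -1" "c\<^sub>2 = 1 \<or> c\<^sub>2 = -1" "p \<noteq> 0"
  shows "axis_sign (sgn x) c\<^sub>1 c\<^sub>2 p = 1 \<or> axis_sign (sgn x) c\<^sub>1 c\<^sub>2 p = -1"
  using assms by (auto simp: axis_sign_def plane_eq_iff sgn_if)

text \<open>If f(0) = 0, then on an axis f differs from its linear part x_j \<partial>_j f(0) by at most half
of the size of the latter.\<close>

lemma det_sign_near_origin:
  fixes f :: "plane \<Rightarrow> real"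
  assumes f: "f differentiable (at 0)" and nondegenerate: "f 0 \<noteq> 0 \<or>
      (c\<^sub>1 = sgn (pd 2 f 0) \<and> c\<^sub>2 = sgn (pd 1 f 0) \<and> (\<forall>i. pd i f 0 \<noteq> 0))"
  shows "\<exists>\<rho>>0. \<forall>p\<in>ball 0 \<rho>. \<forall>i. p $ i = 0 \<longrightarrow> p \<noteq> 0 \<longrightarrow> 0 < axis_sign (sgn (f 0)) c\<^sub>1 c\<^sub>2 p * f p"
proof (cases "f 0 = 0")
  case False
  have "isCont f 0" using f by (rule differentiable_imp_continuous_within)
  then have "\<forall>\<^sub>F p in nhds 0. sgn (f p) = sgn (f 0)" using False by (rule eventually_sgn_eq)
  then obtain d where d: "d > 0" "\<And>p. dist p 0 < d \<Longrightarrow> sgn (f p) = sgn (f 0)"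
    unfolding eventually_nhds_metric by blast
  have "0 < axis_sign (sgn (f 0)) c\<^sub>1 c\<^sub>2 p * f p" if "p \<in> ball 0 d" for p
  proof -
    have "sgn (f p) = sgn (f 0)" using d(2)[of p] that by (simp add: dist_commute)
    moreover from this have "f p \<noteq> 0" using False by (metis sgn_eq_0_iff)
    moreover have "sgn (f p) * f p = \<bar>f p\<bar>" by (simp add: abs_sgn mult.commute)
    ultimately show ?thesis using False by (simp add: axis_sign_def sgn_eq_0_iff)
  qed
  then show ?thesis using d(1) by blast
next
  case True
  then have pd: "\<And>i. pd i f 0 \<noteq> 0" and c: "c\<^sub>1 = sgn (pd 2 f 0)" "c\<^sub>2 = sgn (pd 1 f 0)"
    using nondegenerate by auto
  \<comment> \<open>An error of m |x_j| in the linear approximation is at most half of the linear term.\<close>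
  define m where "m = min \<bar>pd 1 f 0\<bar> \<bar>pd 2 f 0\<bar> / 2"
  have m: "m > 0" using pd by (simp add: m_def)
  have m_le: "2 * m \<le> \<bar>pd i f 0\<bar>" for i using exhaust_2[of i] by (auto simp: m_def)
  obtain d where d: "d > 0" "\<And>p. norm (p - 0) < d \<Longrightarrow>
      norm (f p - f 0 - ((p - 0) $ 1 *\<^sub>R pd 1 f 0 + (p - 0) $ 2 *\<^sub>R pd 2 f 0)) \<le> m * norm (p - 0)"
    using has_derivative_pd[OF f] m unfolding has_derivative_at_alt by blast
  have "0 < axis_sign (sgn (f 0)) c\<^sub>1 c\<^sub>2 p * f p" if p: "p \<in> ball 0 d" "p $ i = 0" "p \<noteq> 0" for p i
  proof -
    let ?x = "p $ other i" and ?D = "pd (other i) f 0"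
    have x: "?x \<noteq> 0" using p plane_eqI_other[of p i 0] by auto
    have sum: "p $ 1 *\<^sub>R pd 1 f 0 + p $ 2 *\<^sub>R pd 2 f 0 = ?x * ?D"
      using p(2) exhaust_2[of i] by auto
    have "norm p = \<bar>?x\<bar>" using axis_other_eq[OF p(2)] norm_axis[of "other i" ?x] by simp
    then have bound: "\<bar>f p - ?x * ?D\<bar> \<le> m * \<bar>?x\<bar>" using d(2)[of p] p(1) True sum by simp
    have "axis_sign (sgn (f 0)) c\<^sub>1 c\<^sub>2 p = sgn (?x * ?D)"
      using True c x p(2) exhaust_2[of i] by (auto simp: axis_sign_def sgn_mult)
    moreover have "m * \<bar>?x\<bar> < \<bar>?x * ?D\<bar>"
    proof -
      have "m < \<bar>?D\<bar>" using m m_le[of "other i"] by linarith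
      then show ?thesis using x by (simp add: abs_mult mult.commute)
    qed
    ultimately show ?thesis using bound by (auto simp: sgn_if abs_if split: if_splits)
  qed
  then show ?thesis using d(1) by blast
qed

text \<open>The fields are extended from a small ball by composition with the nearest-point
projection, which does not increase Lipschitz constants. The radius is such that on the ball the
components differ from their values at the origin by at most \<kappa>, while the latter are at least
2 \<kappa> in size.\<close>

lemma local_type_exists:
  fixes F G :: vfield
  assumes \<rho>: "0 < \<rho>" "cball 0 \<rho> \<subseteq> U" and K: "0 < K"
    and F: "\<And>x y. x \<in> cball 0 \<rho> \<Longrightarrow> y \<in> cball 0 \<rho> \<Longrightarrow> norm (F x - F y) \<le> K * norm (x - y)"
    and G: "\<And>x y. x \<in> cball 0 \<rho> \<Longrightarrow> y \<in> cball 0 \<rho> \<Longrightarrow> norm (G x - G y) \<le> K * norm (x - y)"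
    and opp: "\<And>i. F 0 $ i * G 0 $ i < 0"
    and ab: "a = sgn (F 0 $ 1)" "b = sgn (F 0 $ 2)"
    and det: "\<exists>\<rho>>0. \<forall>p\<in>ball 0 \<rho>. \<forall>i. p $ i = 0 \<longrightarrow> p \<noteq> 0 \<longrightarrow> 0 < e p * detZ (F, G) p"
    and e: "\<And>p. p \<noteq> 0 \<Longrightarrow> e p = 1 \<or> e p = -1" "\<And>p q. same_cell p q \<Longrightarrow> e p = e q"
  shows "\<exists>X Y K M \<kappa> \<rho>'. ball 0 \<rho>' \<subseteq> U \<and> local_type X Y K M \<kappa> a b (F, G) \<rho>' e"
proof -
  obtain \<rho>\<^sub>1 where \<rho>\<^sub>1: "\<rho>\<^sub>1 > 0" "\<And>p i. p \<in> ball 0 \<rho>\<^sub>1 \<Longrightarrow> p $ i = 0 \<Longrightarrow> p \<noteq> 0 \<Longrightarrow> 0 < e p * detZ (F, G) p"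
    using det by blast
  define s :: plane where "s = vector [a, b]"
  have s: "s $ i = sgn (F 0 $ i)" for i using exhaust_2[of i] ab by (auto simp: s_def)
  have nz: "F 0 $ i \<noteq> 0" "G 0 $ i \<noteq> 0" for i using opp[of i] by auto
  have s_unit: "s $ i = 1 \<or> s $ i = -1" for i using nz(1)[of i] by (auto simp: s sgn_if)
  have sF: "s $ i * F 0 $ i = \<bar>F 0 $ i\<bar>" and sG: "- s $ i * G 0 $ i = \<bar>G 0 $ i\<bar>" for i
    using opp[of i] by (auto simp: s sgn_if mult_less_0_iff)
  define \<kappa> where "\<kappa> = Min (range (\<lambda>i. \<bar>F 0 $ i\<bar>) \<union> range (\<lambda>i. \<bar>G 0 $ i\<bar>)) / 2"
  have \<kappa>_le: "2 * \<kappa> \<le> \<bar>F 0 $ i\<bar>" "2 * \<kappa> \<le> \<bar>G 0 $ i\<bar>" for i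
    by (auto simp: \<kappa>_def intro!: Min_le)
  have \<kappa>: "\<kappa> > 0" using nz by (auto simp: \<kappa>_def)
  define \<rho>' where "\<rho>' = min (min \<rho> \<rho>\<^sub>1) (\<kappa> / K)"
  have \<rho>': "0 < \<rho>'" "\<rho>' \<le> \<rho>" "\<rho>' \<le> \<rho>\<^sub>1" "K * \<rho>' \<le> \<kappa>"
    using \<rho> \<rho>\<^sub>1 K \<kappa> mult_left_mono[of "min (min \<rho> \<rho>\<^sub>1) (\<kappa> / K)" "\<kappa> / K" K] by (auto simp: \<rho>'_def)
  define B where "B = cball (0::plane) \<rho>'"
  have B: "convex B" "closed B" "B \<noteq> {}" "B \<subseteq> cball 0 \<rho>" "0 \<in> B" using \<rho>' by (auto simp: B_def)
  define M where "M = max (norm (F 0)) (norm (G 0)) + \<kappa>"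
  have near: "norm (H x - H 0) \<le> \<kappa>"
    if "\<And>x y. x \<in> cball 0 \<rho> \<Longrightarrow> y \<in> cball 0 \<rho> \<Longrightarrow> norm (H x - H y) \<le> K * norm (x - y)" "x \<in> B" for H :: vfield and x
  proof -
    have "norm (H x - H 0) \<le> K * norm (x - 0)" using that B by blast
    also have "\<dots> \<le> K * \<rho>'" using that(2) K by (simp add: B_def)
    finally show ?thesis using \<rho>'(4) by simp
  qed
  have field: "transversal_field (\<lambda>x. H (closest_point B x)) K M \<kappa> sg"
    if H: "\<And>x y. x \<in> cball 0 \<rho> \<Longrightarrow> y \<in> cball 0 \<rho> \<Longrightarrow> norm (H x - H y) \<le> K * norm (x - y)"
      "norm (H 0) \<le> M - \<kappa>" and sg: "\<And>i. sg $ i = 1 \<or> sg $ i = -1" "\<And>i. 2 * \<kappa> \<le> sg $ i * H 0 $ i" for H sg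
  proof
    have cp: "closest_point B x \<in> B" for x using B by (simp add: closest_point_in_set)
    show "norm (H (closest_point B x) - H (closest_point B y)) \<le> K * norm (x - y)" for x y
    proof -
      have "norm (H (closest_point B x) - H (closest_point B y)) \<le> K * norm (closest_point B x - closest_point B y)"
        by (intro H(1) subsetD[OF B(4)] cp)
      also have "\<dots> \<le> K * norm (x - y)"
        using closest_point_lipschitz[OF B(1-3), of x y] K by (simp add: dist_norm)
      finally show ?thesis .
    qed
    fix x i
    have n: "norm (H (closest_point B x) - H 0) \<le> \<kappa>" by (rule near[OF H(1) cp])
    then show "norm (H (closest_point B x)) \<le> M"
      using H(2) norm_triangle_sub[of "H (closest_point B x)" "H 0"] by linarith
    have "\<bar>H (closest_point B x) $ i - H 0 $ i\<bar> \<le> \<kappa>"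
      using n component_le_norm_cart[of "H (closest_point B x) - H 0" i] by simp
    then show "\<kappa> \<le> sg $ i * H (closest_point B x) $ i"
      using sg(1)[of i] sg(2)[of i] by auto
  qed (use K \<kappa> sg in auto)
  have "transversal_field (\<lambda>x. F (closest_point B x)) K M \<kappa> (vector [a, b])"
  proof (rule field[OF F])
    show "2 * \<kappa> \<le> vector [a, b] $ i * F 0 $ i" for i
      using \<kappa>_le(1)[of i] sF[of i] by (simp add: s_def)
  qed (use s_unit in \<open>auto simp: s_def M_def\<close>)
  moreover have "transversal_field (\<lambda>x. G (closest_point B x)) K M \<kappa> (vector [- a, - b])"
  proof (rule field[OF G])
    have neg: "vector [- a, - b] = - s" by (simp add: s_def plane_eq_iff)
    show "2 * \<kappa> \<le> vector [- a, - b] $ i * G 0 $ i" for i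
      using \<kappa>_le(2)[of i] sG[of i] by (simp add: neg)
    show "vector [- a, - b] $ i = (1::real) \<or> vector [- a, - b] $ i = (-1::real)" for i :: 2
      using s_unit[of i] by (auto simp: neg)
  qed (auto simp: M_def)
  ultimately interpret P: transversal_pair "\<lambda>x. F (closest_point B x)" "\<lambda>x. G (closest_point B x)" K M \<kappa> a b
    by (simp add: transversal_pair_def)
  have "local_type (\<lambda>x. F (closest_point B x)) (\<lambda>x. G (closest_point B x)) K M \<kappa> a b (F, G) \<rho>' e"
  proof unfold_locales
    show "0 < e p * detZ (F, G) p" if "p \<in> ball 0 \<rho>'" "p $ i = 0" "p \<noteq> 0" for p i
      using \<rho>\<^sub>1(2)[of p i] \<rho>'(3) that by auto
  qed (use \<rho>' e in \<open>auto simp: B_def closest_point_self\<close>)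
  moreover have "ball 0 \<rho>' \<subseteq> U" using \<rho>(2) \<rho>'(2) by (auto simp: subset_iff)
  ultimately show ?thesis by blast
qed

lemma local_type_of_Omega:
  assumes U: "open U" "bounded U" "0 \<in> U" and r: "1 \<le> r" and Z: "Z \<in> Omega r U"
    and opp: "\<And>i. fst Z 0 $ i * snd Z 0 $ i < 0"
    and ab: "a = sgn (fst Z 0 $ 1)" "b = sgn (fst Z 0 $ 2)"
    and c: "c\<^sub>1 = 1 \<or> c\<^sub>1 = -1" "c\<^sub>2 = 1 \<or> c\<^sub>2 = -1"
    and nondegenerate: "detZ Z 0 \<noteq> 0 \<or>
      (c\<^sub>1 = sgn (pd 2 (detZ Z) 0) \<and> c\<^sub>2 = sgn (pd 1 (detZ Z) 0) \<and> (\<forall>i. pd i (detZ Z) 0 \<noteq> 0))"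
  shows "\<exists>X Y K M \<kappa> \<rho>. ball 0 \<rho> \<subseteq> U \<and> local_type X Y K M \<kappa> a b Z \<rho> (axis_sign (sgn (detZ Z 0)) c\<^sub>1 c\<^sub>2)"
proof -
  obtain F G where FG: "Z = (F, G)" by (metis prod.collapse)
  have Cr: "F \<in> Cr r U" "G \<in> Cr r U" using Z by (auto simp: FG Omega_def)
  obtain \<rho>F KF where 1: "0 < \<rho>F" "0 < KF" "cball 0 \<rho>F \<subseteq> U"
    "\<And>x y. x \<in> cball 0 \<rho>F \<Longrightarrow> y \<in> cball 0 \<rho>F \<Longrightarrow> norm (F x - F y) \<le> KF * norm (x - y)"
    using Cr_locally_lipschitz[OF U Cr(1) r] by metis
  obtain \<rho>G KG where 2: "0 < \<rho>G" "0 < KG" "cball 0 \<rho>G \<subseteq> U"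
    "\<And>x y. x \<in> cball 0 \<rho>G \<Longrightarrow> y \<in> cball 0 \<rho>G \<Longrightarrow> norm (G x - G y) \<le> KG * norm (x - y)"
    using Cr_locally_lipschitz[OF U Cr(2) r] by metis
  have le: "KF * norm (x - y) \<le> max KF KG * norm (x - y)" "KG * norm (x - y) \<le> max KF KG * norm (x - y)" for x y :: plane
    by (auto intro: mult_right_mono)
  have diff: "detZ Z differentiable (at 0)"
    unfolding FG using detZ_has_derivative[OF Cr_differentiable[OF U Cr(1) r U(3)] Cr_differentiable[OF U Cr(2) r U(3)]]
    by (rule differentiableI)
  show ?thesis
    unfolding FG
  proof (rule local_type_exists[where \<rho>="min \<rho>F \<rho>G" and K="max KF KG"])
    show "norm (F x - F y) \<le> max KF KG * norm (x - y)" if "x \<in> cball 0 (min \<rho>F \<rho>G)" "y \<in> cball 0 (min \<rho>F \<rho>G)" for x y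
      using order_trans[OF 1(4) le(1)] that by auto
    show "norm (G x - G y) \<le> max KF KG * norm (x - y)" if "x \<in> cball 0 (min \<rho>F \<rho>G)" "y \<in> cball 0 (min \<rho>F \<rho>G)" for x y
      using order_trans[OF 2(4) le(2)] that by auto
    show "\<exists>\<rho>>0. \<forall>p\<in>ball 0 \<rho>. \<forall>i. p $ i = 0 \<longrightarrow> p \<noteq> 0 \<longrightarrow>
        0 < axis_sign (sgn (detZ (F, G) 0)) c\<^sub>1 c\<^sub>2 p * detZ (F, G) p"
      using det_sign_near_origin[OF diff nondegenerate] by (simp add: FG)
    show "axis_sign (sgn (detZ (F, G) 0)) c\<^sub>1 c\<^sub>2 p = 1 \<or> axis_sign (sgn (detZ (F, G) 0)) c\<^sub>1 c\<^sub>2 p = -1" if "p \<noteq> 0" for p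
      using c that by (rule axis_sign_unit)
    show "cball 0 (min \<rho>F \<rho>G) \<subseteq> U" using 1(3) by (auto simp: subset_iff)
  qed (use 1 2 opp ab axis_sign_cell in \<open>auto simp: FG\<close>)
qed

text \<open>The determinant of the normal family is
\<alpha> + c_1 x_2 + c_2 x_1 - a b c_1 c_2 x_1 x_2. On the axes the last term vanishes, and for \<alpha> \<noteq> 0 the
sign is that of \<alpha> as long as |x| < |\<alpha>|. For |\<alpha>| < 1 the second component b + a \<alpha> at the origin
keeps the sign b.\<close>

lemma local_type_normal_family:
  assumes U: "open U" "0 \<in> U"
    and units: "a = 1 \<or> a = -1" "b = 1 \<or> b = -1" "c\<^sub>1 = 1 \<or> c\<^sub>1 = -1" "c\<^sub>2 = 1 \<or> c\<^sub>2 = -1"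
    and \<alpha>: "\<bar>\<alpha>\<bar> < 1"
  shows "\<exists>X Y K M \<kappa> \<rho>. ball 0 \<rho> \<subseteq> U \<and>
    local_type X Y K M \<kappa> a b (normal_family U a b c\<^sub>1 c\<^sub>2 \<alpha>) \<rho> (axis_sign (sgn \<alpha>) c\<^sub>1 c\<^sub>2)"
proof -
  obtain \<rho> where \<rho>: "0 < \<rho>" "cball 0 \<rho> \<subseteq> U" using U open_contains_cball by blast
  define F G where "F = fst (normal_family U a b c\<^sub>1 c\<^sub>2 \<alpha>)" and "G = snd (normal_family U a b c\<^sub>1 c\<^sub>2 \<alpha>)"
  have FG: "F x = vector [a - b * c\<^sub>2 * x $ 1, b + a * \<alpha>]" "G x = vector [- a, - b + a * c\<^sub>1 * x $ 2]" if "x \<in> U" for x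
    using that closure_subset by (auto simp: F_def G_def normal_family_def restrict_field_def)
  have aa: "a * a = 1" "b * b = 1" using units by auto
  have sgn_b: "sgn (b + a * \<alpha>) = b" using units \<alpha> by (auto simp: sgn_if abs_less_iff)
  have FU: "norm (F x - F y) \<le> 1 * norm (x - y)" if "x \<in> U" "y \<in> U" for x y
  proof -
    have "F x - F y = axis 1 (- b * c\<^sub>2 * (x $ 1 - y $ 1))"
      using that by (simp add: FG plane_eq_iff axis_def algebra_simps)
    then have "norm (F x - F y) = \<bar>x $ 1 - y $ 1\<bar>" using units by (auto simp: norm_axis abs_mult)
    then show ?thesis using component_le_norm_cart[of "x - y" 1] by simp
  qed
  have GU: "norm (G x - G y) \<le> 1 * norm (x - y)" if "x \<in> U" "y \<in> U" for x y
  proof -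
    have "G x - G y = axis 2 (a * c\<^sub>1 * (x $ 2 - y $ 2))"
      using that by (simp add: FG plane_eq_iff axis_def algebra_simps)
    then have "norm (G x - G y) = \<bar>x $ 2 - y $ 2\<bar>" using units by (auto simp: norm_axis abs_mult)
    then show ?thesis using component_le_norm_cart[of "x - y" 2] by simp
  qed
  have det: "detZ (F, G) p = \<alpha> + c\<^sub>1 * p $ 2 + c\<^sub>2 * p $ 1 - a * b * c\<^sub>1 * c\<^sub>2 * p $ 1 * p $ 2" if "p \<in> U" for p
  proof -
    have "detZ (F, G) p = - a * b + (a * a) * c\<^sub>1 * p $ 2 + (b * b) * c\<^sub>2 * p $ 1
        - a * b * c\<^sub>1 * c\<^sub>2 * p $ 1 * p $ 2 + a * b + (a * a) * \<alpha>"
      using that by (simp add: detZ_def FG algebra_simps)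
    then show ?thesis unfolding aa by simp
  qed
  have "\<exists>\<rho>>0. \<forall>p\<in>ball 0 \<rho>. \<forall>i. p $ i = 0 \<longrightarrow> p \<noteq> 0 \<longrightarrow> 0 < axis_sign (sgn \<alpha>) c\<^sub>1 c\<^sub>2 p * detZ (F, G) p"
  proof (intro exI[of _ "min \<rho> (if \<alpha> = 0 then \<rho> else \<bar>\<alpha>\<bar>)"] conjI ballI allI impI)
    fix p :: plane and i :: 2
    assume p: "p \<in> ball 0 (min \<rho> (if \<alpha> = 0 then \<rho> else \<bar>\<alpha>\<bar>))" "p $ i = 0" "p \<noteq> 0"
    then have pU: "p \<in> U" using \<rho>(2) by (auto simp: subset_iff)
    define x where "x = p $ other i"
    have x: "x \<noteq> 0" using p plane_eqI_other[of p i 0] by (auto simp: x_def)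
    have "norm p = \<bar>x\<bar>" using axis_other_eq[OF p(2)] norm_axis[of "other i" x] by (simp add: x_def)
    then have small: "\<alpha> \<noteq> 0 \<Longrightarrow> \<bar>x\<bar> < \<bar>\<alpha>\<bar>" using p(1) by simp
    obtain c where c: "c = 1 \<or> c = -1" "detZ (F, G) p = \<alpha> + c * x"
      "axis_sign (sgn \<alpha>) c\<^sub>1 c\<^sub>2 p = (if \<alpha> \<noteq> 0 then sgn \<alpha> else c * sgn x)"
    proof (cases "i = 1")
      case True
      then show ?thesis using that[of c\<^sub>1] units p(2) x det[OF pU] by (simp add: axis_sign_def x_def sgn_eq_0_iff)
    next
      case False
      then have "i = 2" using exhaust_2 by blast
      then show ?thesis using that[of c\<^sub>2] units p(2) x det[OF pU] by (simp add: axis_sign_def x_def sgn_eq_0_iff)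
    qed
    show "0 < axis_sign (sgn \<alpha>) c\<^sub>1 c\<^sub>2 p * detZ (F, G) p"
      using c x small by (auto simp: sgn_if abs_if split: if_splits)
  qed (use \<rho> in auto)
  moreover have F0: "F 0 = vector [a, b + a * \<alpha>]" "G 0 = vector [- a, - b]"
    using FG[OF U(2)] by auto
  have "F 0 $ i * G 0 $ i < 0" for i
  proof -
    have "0 < b * (b + a * \<alpha>)" using units \<alpha> by (auto simp: abs_less_iff)
    then show ?thesis using exhaust_2[of i] aa by (auto simp: F0 mult.commute)
  qed
  ultimately have "\<exists>X Y K M \<kappa> \<rho>. ball 0 \<rho> \<subseteq> U \<and> local_type X Y K M \<kappa> a b (F, G) \<rho> (axis_sign (sgn \<alpha>) c\<^sub>1 c\<^sub>2)"
    using \<rho> FU GU sgn_b units axis_sign_cell axis_sign_unit[OF units(3,4)]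
    by (intro local_type_exists[where K=1 and \<rho>=\<rho>]) (auto simp: F0 subset_iff)
  then show ?thesis by (simp add: F_def G_def)
qed

lemma eventually_sgn_derivative:
  fixes f :: "real \<Rightarrow> real"
  assumes "(f has_real_derivative D) (at 0)" "f 0 = 0" "D \<noteq> 0"
  shows "\<forall>\<^sub>F h in nhds 0. sgn (f h) = sgn (sgn D * h)"
proof -
  have "((\<lambda>h. f h / h) \<longlongrightarrow> D) (at 0)" using assms(1,2) by (simp add: DERIV_def)
  then have "((\<lambda>h. sgn D * (f h / h)) \<longlongrightarrow> sgn D * D) (at 0)" by (intro tendsto_intros)
  moreover have "0 < sgn D * D" using assms(3) by (simp add: sgn_if)
  ultimately have "\<forall>\<^sub>F h in at 0. 0 < sgn D * (f h / h)" by (rule order_tendstoD)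
  then have "\<forall>\<^sub>F h in nhds 0. h \<noteq> 0 \<longrightarrow> 0 < sgn D * (f h / h)" by (simp add: eventually_at_filter)
  then show ?thesis
  proof eventually_elim
    case (elim h)
    then show ?case
      using assms(2,3) by (cases "h = 0") (auto simp: sgn_if zero_less_divide_iff zero_less_mult_iff divide_less_0_iff split: if_splits)
  qed
qed

theorem proposition4p4:
  fixes r :: nat and U :: "(real ^ 2) set" and Z :: pwfield
    and \<gamma> :: "real \<Rightarrow> pwfield" and \<delta>\<^sub>0 a b c\<^sub>1 c\<^sub>2 :: real
  assumes "r \<ge> 1"
    and "open U" and "bounded U" and "0 \<in> U"
    and "Z \<in> Xi11 r U"
    and "unfolding_of r U Z \<delta>\<^sub>0 \<gamma>"
    and "transverse_at r U \<gamma> (Xi11 r U) Z"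
    and "a = sgn (fst Z 0 $ 1)" and "b = sgn (fst Z 0 $ 2)"
    and "c\<^sub>1 = sgn (pd 2 (detZ Z) 0)" and "c\<^sub>2 = sgn (pd 1 (detZ Z) 0)"
  shows "locally_weak_equivalent U {-\<delta>\<^sub>0<..<\<delta>\<^sub>0} \<gamma> UNIV (normal_family U a b c\<^sub>1 c\<^sub>2)"
proof -
  note r = \<open>r \<ge> 1\<close> and U = \<open>open U\<close> \<open>bounded U\<close> \<open>0 \<in> U\<close> and Z = \<open>Z \<in> Xi11 r U\<close>
  have \<delta>\<^sub>0: "0 < \<delta>\<^sub>0" and \<gamma>0: "\<gamma> 0 = Z" and smooth: "smooth_curve r U {-\<delta>\<^sub>0<..<\<delta>\<^sub>0} \<gamma>"
    using assms(6) by (auto simp: unfolding_of_def)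
  have Omega: "\<gamma> t \<in> Omega r U" if "\<bar>t\<bar> < \<delta>\<^sub>0" for t
  proof -
    have "t \<in> {-\<delta>\<^sub>0<..<\<delta>\<^sub>0}" using that by auto
    then show ?thesis using smooth unfolding smooth_curve_def by metis
  qed
  obtain V where V: "V \<in> Omega r U" "has_Omega_derivative r U \<gamma> V 0" "V \<notin> tangent_space r U (Xi11 r U) Z"
    using assms(7) by (auto simp: transverse_at_def)
  define \<Delta> where "\<Delta> = det_velocity Z V"
  have \<Delta>: "\<Delta> \<noteq> 0" unfolding \<Delta>_def by (rule det_velocity_nonzero[OF U r Z V(1,3)])
  have opp: "\<And>i. fst Z 0 $ i * snd Z 0 $ i < 0" and det0: "detZ Z 0 = 0" and pd: "\<And>i. pd i (detZ Z) 0 \<noteq> 0"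
    using Z by (auto simp: Xi11_def)
  have nz: "fst Z 0 $ i \<noteq> 0" "snd Z 0 $ i \<noteq> 0" for i using opp[of i] by auto
  have units: "a = 1 \<or> a = -1" "b = 1 \<or> b = -1" "c\<^sub>1 = 1 \<or> c\<^sub>1 = -1" "c\<^sub>2 = 1 \<or> c\<^sub>2 = -1"
    using nz pd assms(8-11) by (auto simp: sgn_if)
  have dX: "((\<lambda>t. fst (\<gamma> t) 0 $ i) has_real_derivative fst V 0 $ i) (at 0)"
    and dY: "((\<lambda>t. snd (\<gamma> t) 0 $ i) has_real_derivative snd V 0 $ i) (at 0)" for i
    using V Omega \<delta>\<^sub>0 unfolding has_Omega_derivative_def Omega_def mem_Times_iff
    by (auto intro!: Cr_curve_component_derivative[OF U \<delta>\<^sub>0])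
  have "((\<lambda>t. detZ (\<gamma> t) 0) has_real_derivative \<Delta>) (at 0)"
    unfolding detZ_def \<Delta>_def det_velocity_def
    by (rule derivative_eq_intros dX dY refl)+ (simp add: \<gamma>0 algebra_simps)
  then have ev_det: "\<forall>\<^sub>F t in nhds 0. sgn (detZ (\<gamma> t) 0) = sgn (sgn \<Delta> * t)"
    using \<Delta> by (intro eventually_sgn_derivative) (auto simp: \<gamma>0 det0)
  have ev_X: "\<forall>\<^sub>F t in nhds 0. \<forall>i. sgn (fst (\<gamma> t) 0 $ i) = sgn (fst Z 0 $ i)"
    and ev_Y: "\<forall>\<^sub>F t in nhds 0. \<forall>i. sgn (snd (\<gamma> t) 0 $ i) = sgn (snd Z 0 $ i)"
    using eventually_sgn_eq[OF DERIV_isCont[OF dX]] eventually_sgn_eq[OF DERIV_isCont[OF dY]] nz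
    by (auto intro!: eventually_all_finite simp: \<gamma>0)
  obtain d where d: "d > 0" "\<And>t. dist t 0 < d \<Longrightarrow> sgn (detZ (\<gamma> t) 0) = sgn (sgn \<Delta> * t) \<and>
      (\<forall>i. sgn (fst (\<gamma> t) 0 $ i) = sgn (fst Z 0 $ i)) \<and> (\<forall>i. sgn (snd (\<gamma> t) 0 $ i) = sgn (snd Z 0 $ i))"
    using eventually_conj[OF ev_det eventually_conj[OF ev_X ev_Y]] unfolding eventually_nhds_metric by blast
  \<comment> \<open>The bound 1 is for the normal family, where the second component of X has the sign b for |\<alpha>| < 1.\<close>
  define \<eta> where "\<eta> = min (min d \<delta>\<^sub>0) 1"
  have \<eta>: "0 < \<eta>" "\<eta> \<le> d" "\<eta> \<le> \<delta>\<^sub>0" "\<eta> \<le> 1" using d(1) \<delta>\<^sub>0 by (auto simp: \<eta>_def)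
  define A where "A = {-\<eta><..<\<eta>}"
  \<comment> \<open>The parameter is reversed if det Z decreases at the origin; \<mu> is its own inverse.\<close>
  define \<mu> where "\<mu> t = sgn \<Delta> * t" for t :: real
  have \<mu>\<mu>: "\<mu> (\<mu> t) = t" and abs_\<mu>: "\<bar>\<mu> t\<bar> = \<bar>t\<bar>" for t using \<Delta> by (auto simp: \<mu>_def sgn_if)
  have \<mu>_A: "\<mu> t \<in> A" if "t \<in> A" for t using that abs_\<mu>[of t] by (auto simp: A_def)
  have "locally_equivalent U (\<gamma> t) (normal_family U a b c\<^sub>1 c\<^sub>2 (\<mu> t))" if "t \<in> A" for t
  proof -
    have t: "\<bar>t\<bar> < \<eta>" using that by (auto simp: A_def)
    have sgns: "sgn (detZ (\<gamma> t) 0) = sgn (\<mu> t)" "\<And>i. sgn (fst (\<gamma> t) 0 $ i) = sgn (fst Z 0 $ i)"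
      "\<And>i. sgn (snd (\<gamma> t) 0 $ i) = sgn (snd Z 0 $ i)"
      using d(2)[of t] t \<eta> by (auto simp: \<mu>_def)
    have opp_t: "fst (\<gamma> t) 0 $ i * snd (\<gamma> t) 0 $ i < 0" for i
    proof -
      have "sgn (fst (\<gamma> t) 0 $ i * snd (\<gamma> t) 0 $ i) = sgn (fst Z 0 $ i * snd Z 0 $ i)"
        by (simp add: sgn_mult sgns)
      then show ?thesis using opp[of i] by (metis sgn_less)
    qed
    have nondegenerate: "detZ (\<gamma> t) 0 \<noteq> 0 \<or> (c\<^sub>1 = sgn (pd 2 (detZ (\<gamma> t)) 0) \<and>
        c\<^sub>2 = sgn (pd 1 (detZ (\<gamma> t)) 0) \<and> (\<forall>i. pd i (detZ (\<gamma> t)) 0 \<noteq> 0))"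
    proof (cases "t = 0")
      case True
      then show ?thesis using assms(10,11) pd by (simp add: \<gamma>0)
    next
      case False
      then have "\<mu> t \<noteq> 0" using abs_\<mu>[of t] by auto
      then show ?thesis using sgns(1) by (metis sgn_eq_0_iff)
    qed
    obtain X Y K M \<kappa> \<rho> where 1: "ball 0 \<rho> \<subseteq> U" "local_type X Y K M \<kappa> a b (\<gamma> t) \<rho> (axis_sign (sgn (\<mu> t)) c\<^sub>1 c\<^sub>2)"
      using local_type_of_Omega[OF U r Omega opp_t _ _ units(3,4) nondegenerate, of a b] t \<eta> assms(8,9)
      by (auto simp: sgns)
    have "\<bar>\<mu> t\<bar> < 1" using t \<eta> by (simp add: abs_\<mu>)
    then obtain X' Y' K' M' \<kappa>' \<rho>' where 2: "ball 0 \<rho>' \<subseteq> U"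
      "local_type X' Y' K' M' \<kappa>' a b (normal_family U a b c\<^sub>1 c\<^sub>2 (\<mu> t)) \<rho>' (axis_sign (sgn (\<mu> t)) c\<^sub>1 c\<^sub>2)"
      using local_type_normal_family[OF U(1,3) units] by blast
    show ?thesis by (rule locally_equivalent_if_same_local_type[OF 1(2) 2(2) 1(1) 2(1)])
  qed
  moreover have "homeomorphism A A \<mu> \<mu>"
  proof -
    have "\<mu> ` A = A" using \<mu>_A \<mu>\<mu> by (metis image_eqI image_subsetI subsetI subset_antisym)
    moreover have "continuous_on A \<mu>" unfolding \<mu>_def by (intro continuous_intros)
    ultimately show ?thesis by (simp add: homeomorphism_def \<mu>\<mu>)
  qed
  moreover have "open A" "0 \<in> A" "A \<subseteq> {-\<delta>\<^sub>0<..<\<delta>\<^sub>0}" using \<eta> by (auto simp: A_def)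
  moreover have "\<mu> 0 = 0" by (simp add: \<mu>_def)
  ultimately show ?thesis unfolding locally_weak_equivalent_def by blast
qed

end
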